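(* Let $T>0$, let $f:\mathbb{R}^k\times[0,T]\to\mathbb{R}^k$, $\beta,g,\lambda:[0,T]\to\mathbb{R}_{\ge0}$ with $\sigma(t):=\sqrt{g^2(t)-\lambda^2(t)}>0$ on $[0,T]$, and let $s(\cdot,t),d(\cdot,t)$ be (score and discriminator) functions $\mathbb{R}^k\to\mathbb{R}^k$ resp. $\mathbb{R}^k\to\mathbb{R}$. Define the drift $$c(x,t)=f(x,t)+\frac{g^2(t)}{2}s(x,t)+\Big(\beta(t)-\frac{g^2(t)}{2}\Big)\nabla d(x,t),$$ and let $\hat x(t)$ solve $d\hat x(t)=c(\hat x(t),t)\,dt+\sigma(t)\,dW_t$, $\hat x(0)\sim q_0$, with marginal density $q_t$. Assume regularity sufficient for the Feynman–Kac representation and Girsanov's theorem (e.g. $c$ smooth and bounded with bounded derivatives, $\sigma$ continuous and bounded away from $0$, $q_0$ a smooth positive density such that $(t,x)\mapsto q_t(x)$ is $C^{1,2}$ with polynomial growth, Novikov's condition for $c/\sigma$). For $x\in\mathbb{R}^k$ let $Y_s=x+\int_0^s\sigma(T-r)\,d\widetilde W_r$, $s\in[0,T]$, with $\widetilde W$ a standard Brownian motion, and let $p(\cdot\,|\,Y_0=x)$ denote the density of $Y_s$ (namely $\mathcal N(x,\int_0^s\sigma^2(T-r)dr\,I_k)$). Then $$\log q_T(x)\ge\mathbb{E}\big[\log q_0(Y_T)\,\big|\,Y_0=x\big]+\frac12\int_0^T\sigma^2(T-s)\,\mathbb{E}\big[\|\nabla\log p(Y_s|Y_0=x)\|_2^2\big]ds$$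 $$\qquad-\frac12\int_0^T\mathbb{E}\Big[\Big\|\frac{c(Y_s,T-s)}{\sigma(T-s)}-\sigma(T-s)\nabla\log p(Y_s|Y_0=x)\Big\|_2^2\Big]ds .$$
   Context: $W_t,\widetilde W_t$ are standard Brownian motions in $\mathbb{R}^k$; expectations are over $Y_s$ given $Y_0=x$. $\nabla$ is the gradient in the space variable.
   Formalization: The two ds-integrals each diverge at s=0 (E‖∇log p(Y_s|x)‖² = k/∫_0^s σ²(T−r)dr), so their difference is read as one integral of the difference of the integrands; log q_0(Y_T) is assumed integrable (otherwise its expectation is −∞ and the bound is trivial). *)

theory Defs
  imports "HOL-Probability.Probability"
begin

definition pd :: "real^'k \<Rightarrow> (real^'k \<Rightarrow> 'b::real_normed_vector) \<Rightarrow> real^'k \<Rightarrow> 'b" where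
  "pd e h = (\<lambda>x. frechet_derivative h (at x) e)"

fun iter_pd :: "(real^'k) list \<Rightarrow> (real^'k \<Rightarrow> 'b::real_normed_vector) \<Rightarrow> real^'k \<Rightarrow> 'b" where
  "iter_pd [] h = h"
| "iter_pd (e # es) h = pd e (iter_pd es h)"

definition smooth_fun :: "(real^'k \<Rightarrow> 'b::real_normed_vector) \<Rightarrow> bool" where
  "smooth_fun h \<longleftrightarrow> (\<forall>es x. iter_pd es h differentiable (at x))"

definition grad :: "(real^'k \<Rightarrow> real) \<Rightarrow> real^'k \<Rightarrow> real^'k" where
  "grad h x = (\<chi> i. frechet_derivative h (at x) (axis i 1))"

definition C12_on :: "real \<Rightarrow> (real \<Rightarrow> real^'k \<Rightarrow> real) \<Rightarrow> bool" where
  "C12_on T q \<longleftrightarrow>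
     (\<exists>Dt. (\<forall>t\<in>{0..T}. \<forall>x. ((\<lambda>u. q u x) has_real_derivative Dt t x) (at t within {0..T}))
          \<and> continuous_on ({0..T} \<times> UNIV) (\<lambda>(t,x). Dt t x))
   \<and> (\<forall>t\<in>{0..T}. \<forall>x. q t differentiable (at x))
   \<and> (\<forall>t\<in>{0..T}. \<forall>e x. pd e (q t) differentiable (at x))
   \<and> continuous_on ({0..T} \<times> UNIV) (\<lambda>(t,x). q t x)
   \<and> (\<forall>e. continuous_on ({0..T} \<times> UNIV) (\<lambda>(t,x). pd e (q t) x))
   \<and> (\<forall>e e'. continuous_on ({0..T} \<times> UNIV) (\<lambda>(t,x). pd e' (pd e (q t)) x))"

definition gauss_dens :: "real^'k \<Rightarrow> real \<Rightarrow> real^'k \<Rightarrow> real" where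
  "gauss_dens m v y = (\<Prod>i\<in>UNIV. normal_density (m $ i) (sqrt v) (y $ i))"

definition brownian_motion :: "'a measure \<Rightarrow> (real \<Rightarrow> 'a \<Rightarrow> real^'k) \<Rightarrow> bool" where
  "brownian_motion M W \<longleftrightarrow>
     prob_space M
   \<and> (\<forall>t\<ge>0. W t \<in> borel_measurable M)
   \<and> (\<forall>\<omega>\<in>space M. W 0 \<omega> = 0 \<and> continuous_on {0..} (\<lambda>t. W t \<omega>))
   \<and> (\<forall>u t. 0 \<le> u \<and> u < t \<longrightarrow>
        distributed M lborel (\<lambda>\<omega>. W t \<omega> - W u \<omega>) (\<lambda>y. ennreal (gauss_dens 0 (t - u) y)))
   \<and> (\<forall>(ts::nat \<Rightarrow> real) n. 0 \<le> ts 0 \<and> (\<forall>i<n. ts i \<le> ts (Suc i)) \<longrightarrow>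
        prob_space.indep_vars M (\<lambda>_. borel) (\<lambda>i \<omega>. W (ts (Suc i)) \<omega> - W (ts i) \<omega>) {..<n})"

definition indep_of_bm :: "'a measure \<Rightarrow> ('a \<Rightarrow> real^'k) \<Rightarrow> (real \<Rightarrow> 'a \<Rightarrow> real^'k) \<Rightarrow> bool" where
  "indep_of_bm M Z W \<longleftrightarrow>
     (\<forall>(ts::nat \<Rightarrow> real) n. ts 0 = 0 \<and> (\<forall>i<n. ts i \<le> ts (Suc i)) \<longrightarrow>
        prob_space.indep_vars M (\<lambda>_. borel)
          (\<lambda>j \<omega>. case j of None \<Rightarrow> Z \<omega> | Some i \<Rightarrow> W (ts (Suc i)) \<omega> - W (ts i) \<omega>)
          (insert None (Some ` {..<n})))"

text \<open>N t = \<integral>_0^t \<sigma>(r) dW_r for t in [0,T] (deterministic continuous integrand \<sigma>): N has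
  continuous paths and N t is the limit in probability of the (dyadic) Riemann--Ito sums.\<close>
definition wiener_integral ::
  "'a measure \<Rightarrow> (real \<Rightarrow> 'a \<Rightarrow> real^'k) \<Rightarrow> (real \<Rightarrow> real) \<Rightarrow> real \<Rightarrow> (real \<Rightarrow> 'a \<Rightarrow> real^'k) \<Rightarrow> bool" where
  "wiener_integral M W \<sigma> T N \<longleftrightarrow>
     (\<forall>t\<in>{0..T}. N t \<in> borel_measurable M)
   \<and> (\<forall>\<omega>\<in>space M. continuous_on {0..T} (\<lambda>t. N t \<omega>))
   \<and> (\<forall>t\<in>{0..T}. \<forall>\<epsilon>>0.
        (\<lambda>n. measure M {\<omega>\<in>space M. \<epsilon> < dist
            (\<Sum>i<2^n. \<sigma> (t * real i / 2^n) *\<^sub>R (W (t * real (Suc i) / 2^n) \<omega> - W (t * real i / 2^n) \<omega>))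
            (N t \<omega>)}) \<longlonglongrightarrow> 0)"

definition sigma_of :: "(real \<Rightarrow> real) \<Rightarrow> (real \<Rightarrow> real) \<Rightarrow> real \<Rightarrow> real" where
  "sigma_of g lam t = sqrt ((g t)\<^sup>2 - (lam t)\<^sup>2)"

definition drift ::
  "(real^'k \<Rightarrow> real \<Rightarrow> real^'k) \<Rightarrow> (real \<Rightarrow> real) \<Rightarrow> (real \<Rightarrow> real) \<Rightarrow>
   (real^'k \<Rightarrow> real \<Rightarrow> real^'k) \<Rightarrow> (real^'k \<Rightarrow> real \<Rightarrow> real) \<Rightarrow> real^'k \<Rightarrow> real \<Rightarrow> real^'k" where
  "drift f beta g s d x t =
     f x t + ((g t)\<^sup>2 / 2) *\<^sub>R s x t + (beta t - (g t)\<^sup>2 / 2) *\<^sub>R grad (\<lambda>y. d y t) x"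

end

theory Submission
  imports Defs
begin

text \<open>
  Neither the Fokker--Planck equation nor Girsanov's theorem in continuous time is needed. Expanding the
  square, the integrand on the right is \<open>E[c \<cdot> \<nabla>log p] - E[\<bar>c\<bar>\<^sup>2] / (2 \<sigma>\<^sup>2)\<close>. For the Euler scheme with steps
  \<open>\<xi>' = \<xi> + h c(\<xi>) + \<sigma> \<Delta>W\<close>, the density at \<open>x\<close> of the last iterate plus an independent Gaussian is an average, over the
  driftless Gaussian walk started at \<open>x\<close> and run backwards, of \<open>q\<^sub>0\<close> times an explicit exponential weight;
  Jensen's inequality bounds its logarithm from below, and since the walk conditioned on its endpoints is a
  Gaussian bridge, the mean of the exponent is exactly a Riemann sum of that integrand. The scheme
  converges pathwise to the solution because the drift is Lipschitz and the noise is additive. For a time \<open>t < T\<close> the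
  variance of the additional Gaussian is chosen as \<open>\<integral>\<^sub>t\<^sup>T \<sigma>\<^sup>2\<close>, so that \<open>log q\<^sub>0\<close> is integrated against the same Gaussian
  for all \<open>t\<close>; finally \<open>t\<close> tends to \<open>T\<close>.
\<close>

section \<open>Gaussian densities\<close>


text \<open>The terminal time is the obstacle. If \<open>w\<close> is the variance of
  \<open>Y\<close> after time \<open>u\<close>, the gradient of \<open>log p\<close> has mean square
  \<open>CARD('k) / w\<close>, so each of the two quadratic terms on the right has a non-integrable
  singularity of order \<open>1 / u\<close> at \<open>u = 0\<close>. It cancels in their difference,
  which is of order \<open>1 / sqrt u\<close> only; hence the two terms stay under one integral.
  Stopping at \<open>t < T\<close> leaves a Gaussian of positive variance, and the quantity bounded
  from below is the mean of a bounded continuous function of the Euler iterate. Pathwise convergence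
  is then enough, and no convergence of densities of the scheme has to be shown. Jensen's inequality
  can be applied one step at a time because the exponents that arise grow at most linearly, a class
  that is stable under averaging over a Gaussian bridge. The grids are dyadic because the Wiener
  integral is specified through dyadic sums. It is specified as a limit in probability;
  orthogonality of the increments turns this into an error bound in mean.\<close>

lemma gauss_dens_exp:
  assumes "v > 0"
  shows "gauss_dens m v (y :: real^'k) =
    (1 / sqrt (2 * pi * v)) ^ CARD('k) * exp (- (norm (y - m))\<^sup>2 / (2 * v))"
proof -
  have n: "(norm (y - m))\<^sup>2 = (\<Sum>i\<in>UNIV. (y $ i - m $ i)\<^sup>2)"
    unfolding norm_vec_def L2_set_def by (subst real_sqrt_pow2) (auto intro: sum_nonneg)
  have "gauss_dens m v y =
      (\<Prod>i\<in>(UNIV::'k set). (1 / sqrt (2 * pi * v)) * exp (- (y $ i - m $ i)\<^sup>2 / (2 * v)))"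
    unfolding gauss_dens_def normal_density_def using assms by simp
  also have "\<dots> = (1 / sqrt (2 * pi * v)) ^ CARD('k) * exp (\<Sum>i\<in>(UNIV::'k set). - (y $ i - m $ i)\<^sup>2 / (2 * v))"
    by (subst prod.distrib) (simp add: exp_sum)
  also have "(\<Sum>i\<in>(UNIV::'k set). - (y $ i - m $ i)\<^sup>2 / (2 * v)) = - (norm (y - m))\<^sup>2 / (2 * v)"
    unfolding n by (simp add: sum_negf sum_divide_distrib)
  finally show ?thesis .
qed

lemma gauss_dens_pos: "v > 0 \<Longrightarrow> gauss_dens m v y > 0"
  by (simp add: gauss_dens_exp)

lemma gauss_dens_nonneg [simp]: "gauss_dens m v y \<ge> 0"
  unfolding gauss_dens_def by (intro prod_nonneg) simp

lemma gauss_dens_measurable [measurable]: "gauss_dens m v \<in> borel_measurable borel"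
  unfolding gauss_dens_def by measurable

lemma gauss_dens_le:
  "v > 0 \<Longrightarrow> gauss_dens m v (y :: real^'k) \<le> (1 / sqrt (2 * pi * v)) ^ CARD('k)"
  by (simp add: gauss_dens_exp mult_left_le)

lemma gauss_dens_shift: "gauss_dens m v (y + a) = gauss_dens (m - a) v y"
  unfolding gauss_dens_def normal_density_def by (simp add: algebra_simps)

text \<open>The density factorises over the coordinate basis, so the integral is a product of
  one-dimensional normal integrals.\<close>

lemma nn_integral_gauss_dens:
  assumes "v > 0"
  shows "(\<integral>\<^sup>+y. ennreal (gauss_dens m v (y :: real^'k)) \<partial>lborel) = 1"
proof -
  have B: "(Basis :: (real^'k) set) = (\<lambda>i. axis i 1) ` UNIV"
    by (auto simp: Basis_vec_def)
  have inj: "inj_on (\<lambda>i. axis i (1::real) :: real^'k) UNIV"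
    by (auto simp: inj_on_def axis_eq_axis)
  have "(\<integral>\<^sup>+y. ennreal (gauss_dens m v (y :: real^'k)) \<partial>lborel) =
      (\<integral>\<^sup>+y. (\<Prod>b\<in>Basis. ennreal (normal_density (m \<bullet> b) (sqrt v) (y \<bullet> b))) \<partial>(lborel :: (real^'k) measure))"
    unfolding B gauss_dens_def
    by (subst prod.reindex[OF inj]) (simp add: inner_axis prod_ennreal)
  also have "\<dots> = (\<Prod>b\<in>(Basis :: (real^'k) set). (\<integral>\<^sup>+y. ennreal (normal_density (m \<bullet> b) (sqrt v) y) \<partial>lborel))"
    by (subst nn_integral_lborel_prod) auto
  also have "\<dots> = 1"
    using assms by (intro prod.neutral ballI) (simp add: nn_integral_eq_integral)
  finally show ?thesis .
qed

lemma integrable_gauss_dens: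
  "v > 0 \<Longrightarrow> integrable lborel (gauss_dens m v)"
  and integral_gauss_dens:
  "v > 0 \<Longrightarrow> (\<integral>y. gauss_dens m v y \<partial>lborel) = 1"
proof -
  assume v: "v > 0"
  show "integrable lborel (gauss_dens m v)"
    by (rule integrableI_nonneg) (auto simp: nn_integral_gauss_dens[OF v])
  show "(\<integral>y. gauss_dens m v y \<partial>lborel) = 1"
    by (subst integral_eq_nn_integral) (auto simp: nn_integral_gauss_dens[OF v])
qed

section \<open>Affine substitutions and reduction to the standard Gaussian\<close>

lemma nn_integral_lborel_affine:
  fixes f :: "'a::euclidean_space \<Rightarrow> ennreal"
  assumes [measurable]: "f \<in> borel_measurable borel" and c: "c \<noteq> 0"
  shows "(\<integral>\<^sup>+x. f x \<partial>lborel) = ennreal (\<bar>c\<bar> ^ DIM('a)) * (\<integral>\<^sup>+x. f (t + c *\<^sub>R x) \<partial>lborel)"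
  by (subst lborel_affine[OF c, of t])
     (simp add: nn_integral_density nn_integral_distr nn_integral_cmult ennreal_power)

lemma lborel_integrable_affine_iff:
  fixes f :: "'a::euclidean_space \<Rightarrow> 'b::{banach, second_countable_topology}"
  assumes [measurable]: "f \<in> borel_measurable borel" and c: "c \<noteq> 0"
  shows "integrable lborel (\<lambda>x. f (t + c *\<^sub>R x)) \<longleftrightarrow> integrable lborel f"
proof -
  have "(\<integral>\<^sup>+x. ennreal (norm (f x)) \<partial>lborel)
      = ennreal (\<bar>c\<bar> ^ DIM('a)) * (\<integral>\<^sup>+x. ennreal (norm (f (t + c *\<^sub>R x))) \<partial>lborel)"
    by (rule nn_integral_lborel_affine[OF _ c]) measurable
  then show ?thesis
    using c by (auto simp: integrable_iff_bounded ennreal_mult_less_top)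
qed

lemma lborel_integral_affine:
  fixes f :: "'a::euclidean_space \<Rightarrow> 'b::{banach, second_countable_topology}"
  assumes [measurable]: "f \<in> borel_measurable borel" and c: "c \<noteq> 0"
  shows "(\<integral>x. f x \<partial>lborel) = (\<bar>c\<bar> ^ DIM('a)) *\<^sub>R (\<integral>x. f (t + c *\<^sub>R x) \<partial>lborel)"
proof -
  have "(\<integral>x. f x \<partial>lborel) = (\<integral>x. f x \<partial>density (distr lborel borel (\<lambda>x. t + c *\<^sub>R x)) (\<lambda>_. ennreal (\<bar>c\<bar> ^ DIM('a))))"
    by (subst lborel_affine[OF c, of t]) (simp add: ennreal_power)
  also have "\<dots> = (\<bar>c\<bar> ^ DIM('a)) *\<^sub>R (\<integral>x. f (t + c *\<^sub>R x) \<partial>lborel)"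
    by (subst integral_density) (auto simp: integral_distr)
  finally show ?thesis .
qed

lemma gauss_dens_standardize:
  assumes "v > 0"
  shows "\<bar>sqrt v\<bar> ^ CARD('k) * gauss_dens m v (m + sqrt v *\<^sub>R z) = gauss_dens 0 1 (z :: real^'k)"
proof -
  have "(norm (sqrt v *\<^sub>R z))\<^sup>2 = v * (norm z)\<^sup>2"
    using assms by (simp add: power_mult_distrib)
  then show ?thesis
    using assms by (simp add: gauss_dens_exp real_sqrt_mult power_divide field_simps)
qed

text \<open>Moves the parameters \<open>m\<close> and \<open>v\<close> from the density into the
  integrand. Limits in mean or variance then become dominated convergence against one fixed
  Gaussian.\<close>

lemma integral_gauss_dens_standardize:
  fixes f :: "real^'k \<Rightarrow> 'b::{banach, second_countable_topology}"
  assumes [measurable]: "f \<in> borel_measurable borel" and v: "v > 0"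
  shows "(\<integral>y. gauss_dens m v y *\<^sub>R f y \<partial>lborel) = (\<integral>z. gauss_dens 0 1 z *\<^sub>R f (m + sqrt v *\<^sub>R z) \<partial>lborel)"
proof -
  have "(\<integral>y. gauss_dens m v y *\<^sub>R f y \<partial>lborel) =
     (\<bar>sqrt v\<bar> ^ DIM(real^'k)) *\<^sub>R (\<integral>z. gauss_dens m v (m + sqrt v *\<^sub>R z) *\<^sub>R f (m + sqrt v *\<^sub>R z) \<partial>lborel)"
    by (rule lborel_integral_affine) (use v in auto)
  also have "\<dots> = (\<integral>z. (\<bar>sqrt v\<bar> ^ CARD('k) * gauss_dens m v (m + sqrt v *\<^sub>R z)) *\<^sub>R f (m + sqrt v *\<^sub>R z) \<partial>lborel)"
    by (subst integral_scaleR_right[symmetric]) (simp add: DIM_cart)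
  finally show ?thesis unfolding gauss_dens_standardize[OF v] .
qed

lemma integrable_gauss_dens_standardize:
  fixes f :: "real^'k \<Rightarrow> 'b::{banach, second_countable_topology}"
  assumes [measurable]: "f \<in> borel_measurable borel" and v: "v > 0"
  shows "integrable lborel (\<lambda>y. gauss_dens m v y *\<^sub>R f y) \<longleftrightarrow>
    integrable lborel (\<lambda>z. gauss_dens 0 1 z *\<^sub>R f (m + sqrt v *\<^sub>R z))"
proof -
  have "integrable lborel (\<lambda>y. gauss_dens m v y *\<^sub>R f y) \<longleftrightarrow>
     integrable lborel (\<lambda>z. gauss_dens m v (m + sqrt v *\<^sub>R z) *\<^sub>R f (m + sqrt v *\<^sub>R z))"
    by (rule lborel_integrable_affine_iff[symmetric]) (use v in auto)
  also have "\<dots> \<longleftrightarrow> integrable lborel (\<lambda>z. (\<bar>sqrt v\<bar> ^ CARD('k)) *\<^sub>R (gauss_dens m v (m + sqrt v *\<^sub>R z) *\<^sub>R f (m + sqrt v *\<^sub>R z)))"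
  proof
    let ?h = "\<lambda>z. gauss_dens m v (m + sqrt v *\<^sub>R z) *\<^sub>R f (m + sqrt v *\<^sub>R z)"
    let ?a = "\<bar>sqrt v\<bar> ^ CARD('k)"
    assume "integrable lborel (\<lambda>z. ?a *\<^sub>R ?h z)"
    from integrable_scaleR_right[OF this, of "inverse ?a"] show "integrable lborel ?h"
      unfolding scaleR_scaleR[of "inverse ?a" ?a] using v by simp
  qed (rule integrable_scaleR_right)
  finally show ?thesis unfolding scaleR_scaleR gauss_dens_standardize[OF v] .
qed

text \<open>Moments are finite because a power of the norm is dominated by an exponential which turns the
  standard Gaussian into one of variance 2.\<close>

lemma integrable_gauss_dens_norm_power_std:
  "integrable lborel (\<lambda>z :: real^'k. gauss_dens 0 1 z * norm z ^ n)"
proof -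
  \<comment> \<open>The factor \<open>fact n\<close> comes from comparing \<open>norm z ^ n\<close>
    with one term of the exponential series, \<open>exp 1\<close> from
    \<open>norm z \<le> 1 + (norm z)\<^sup>2 / 4\<close>, and the power of \<open>sqrt 2\<close> is
    the ratio of the normalising constants for variances 1 and 2.\<close>
  define C where "C = fact n * exp 1 * (sqrt 2) ^ CARD('k)"
  have *: "norm z ^ n \<le> fact n * exp 1 * exp ((norm z)\<^sup>2 / 4)" for z :: "real^'k"
  proof -
    have "norm z ^ n / fact n \<le> exp (norm z)"
    proof -
      have "(\<Sum>i\<in>{n}. norm z ^ i /\<^sub>R fact i) \<le> (\<Sum>i. norm z ^ i /\<^sub>R fact i)"
        using summable_exp_generic[of "norm z"] by (intro sum_le_suminf) auto
      then show ?thesis by (simp add: exp_def divide_inverse mult.commute)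
    qed
    also have "norm z \<le> 1 + (norm z)\<^sup>2 / 4"
      using zero_le_power2[of "norm z - 2"] by (simp add: power2_eq_square algebra_simps)
    then have "exp (norm z) \<le> exp 1 * exp ((norm z)\<^sup>2 / 4)"
      by (simp flip: exp_add)
    finally show ?thesis by (simp add: field_simps)
  qed
  show ?thesis
  proof (rule Bochner_Integration.integrable_bound)
    show "integrable lborel (\<lambda>z :: real^'k. C * gauss_dens 0 2 z)"
      using integrable_gauss_dens[of 2 "0 :: real^'k"] by simp
    have "gauss_dens 0 1 z * norm z ^ n \<le> C * gauss_dens 0 2 z" for z :: "real^'k"
    proof -
      have "gauss_dens 0 1 z * norm z ^ n \<le> gauss_dens 0 1 z * (fact n * exp 1 * exp ((norm z)\<^sup>2 / 4))"
        by (rule mult_left_mono[OF *]) simp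
      also have "\<dots> = C * gauss_dens 0 2 z"
      proof -
        have "exp (- (norm z)\<^sup>2 / 2) * exp ((norm z)\<^sup>2 / 4) = exp (- (norm z)\<^sup>2 / 4)"
          by (simp flip: exp_add)
        moreover have "(1 / sqrt (2 * pi)) ^ CARD('k) = sqrt 2 ^ CARD('k) * (1 / sqrt (2 * pi * 2)) ^ CARD('k)"
          by (subst power_mult_distrib[symmetric], rule arg_cong[where f="\<lambda>a. a ^ CARD('k)"])
            (simp add: real_sqrt_mult field_simps)
        ultimately show ?thesis
          by (simp add: gauss_dens_exp C_def)
      qed
      finally show ?thesis .
    qed
    then show "AE z in lborel. norm (gauss_dens 0 1 z * norm z ^ n) \<le> norm (C * gauss_dens 0 2 (z :: real^'k))"
      by (intro AE_I2) (simp add: C_def abs_mult)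
  qed measurable
qed

lemma integrable_gauss_dens_poly_growth:
  fixes f :: "real^'k \<Rightarrow> 'b::{banach, second_countable_topology}"
  assumes [measurable]: "f \<in> borel_measurable borel" and v: "v > 0"
    and C: "\<And>y. norm (f y) \<le> C * (1 + norm y ^ n)"
  shows "integrable lborel (\<lambda>y. gauss_dens m v y *\<^sub>R f y)"
proof -
  have C0: "C \<ge> 0" 
  proof (rule ccontr)
    assume "\<not> C \<ge> 0"
    then have "C * (1 + norm (0 :: real^'k) ^ n) < 0"
      by (intro mult_neg_pos) (auto intro: add_pos_nonneg)
    with order_trans[OF norm_ge_zero C[of 0]] show False by linarith
  qed
  \<comment> \<open>One number above 1, \<open>norm m\<close> and \<open>sqrt v\<close> gives
    \<open>norm (m + sqrt v *\<^sub>R z) \<le> 2 * A * max 1 (norm z)\<close>, whose powers separate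
    into a constant and a power of \<open>norm z\<close>.\<close>
  define A where "A = max 1 (max (norm m) (sqrt v))"
  have A: "A \<ge> 1" "norm m \<le> A" "sqrt v \<le> A" by (auto simp: A_def)
  have bd: "norm (gauss_dens 0 1 z *\<^sub>R f (m + sqrt v *\<^sub>R z)) \<le>
     C * (gauss_dens 0 1 z + (2 * A) ^ n * (gauss_dens 0 1 z + gauss_dens 0 1 z * norm z ^ n))" for z
  proof -
    have "norm (m + sqrt v *\<^sub>R z) \<le> norm m + sqrt v * norm z"
      using v by (metis abs_of_nonneg norm_scaleR norm_triangle_ineq real_sqrt_ge_zero less_imp_le)
    also have "\<dots> \<le> A * (1 + norm z)"
      unfolding distrib_left mult_1_right by (intro add_mono A mult_right_mono) simp
    also have "\<dots> \<le> (2 * A) * max 1 (norm z)"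
      using A(1) mult_left_mono[of "1 + norm z" "2 * max 1 (norm z)" A] by (simp add: mult.assoc mult.left_commute)
    finally have "norm (m + sqrt v *\<^sub>R z) ^ n \<le> (2 * A * max 1 (norm z)) ^ n"
      by (rule power_mono) simp
    also have "\<dots> = (2 * A) ^ n * max 1 (norm z) ^ n"
      by (simp add: power_mult_distrib)
    also have "\<dots> \<le> (2 * A) ^ n * (1 + norm z ^ n)"
    proof (rule mult_left_mono)
      show "max 1 (norm z) ^ n \<le> 1 + norm z ^ n" by (cases "norm z \<le> 1") (simp_all add: max_def)
    qed (use A(1) in simp)
    finally have "norm (f (m + sqrt v *\<^sub>R z)) \<le> C * (1 + (2 * A) ^ n * (1 + norm z ^ n))"
      by (intro order_trans[OF C] mult_left_mono C0) simp
    then have "gauss_dens 0 1 z * norm (f (m + sqrt v *\<^sub>R z)) \<le> gauss_dens 0 1 z * (C * (1 + (2 * A) ^ n * (1 + norm z ^ n)))"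
      by (rule mult_left_mono) simp
    moreover have "gauss_dens 0 1 z * (C * (1 + (2 * A) ^ n * (1 + norm z ^ n))) =
      C * (gauss_dens 0 1 z + (2 * A) ^ n * (gauss_dens 0 1 z + gauss_dens 0 1 z * norm z ^ n))"
      by (simp only: distrib_left distrib_right mult_1_right mult.left_commute[of "gauss_dens 0 1 z"] mult.commute[of "gauss_dens 0 1 z" C]
          mult.commute[of "gauss_dens 0 1 z" "(2 * A) ^ n"])
    ultimately show ?thesis by (simp only: norm_scaleR abs_of_nonneg gauss_dens_nonneg)
  qed
  have "integrable lborel (\<lambda>z. gauss_dens 0 1 z *\<^sub>R f (m + sqrt v *\<^sub>R z))"
  proof (rule Bochner_Integration.integrable_bound)
    show "integrable lborel (\<lambda>z :: real^'k. C * (gauss_dens 0 1 z + (2 * A) ^ n * (gauss_dens 0 1 z + gauss_dens 0 1 z * norm z ^ n)))"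
      by (intro integrable_mult_right Bochner_Integration.integrable_add integrable_gauss_dens
          integrable_gauss_dens_norm_power_std) auto
    show "AE z in lborel. norm (gauss_dens 0 1 z *\<^sub>R f (m + sqrt v *\<^sub>R z)) \<le>
        norm (C * (gauss_dens 0 1 z + (2 * A) ^ n * (gauss_dens 0 1 z + gauss_dens 0 1 z * norm z ^ n)))"
      by (intro AE_I2 order_trans[OF bd]) simp
  qed measurable
  then show ?thesis
    by (subst integrable_gauss_dens_standardize) (use v in auto)
qed

text \<open>The reflection of \<open>z\<close> to \<open>- z\<close> preserves the density and
  changes the sign of the integrand.\<close>

lemma integral_gauss_dens_odd:
  "(\<integral>z. gauss_dens 0 1 z *\<^sub>R (z :: real^'k) \<partial>lborel) = 0"
proof -
  let ?I = "\<integral>z. gauss_dens 0 1 z *\<^sub>R (z :: real^'k) \<partial>lborel"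
  have "?I = (\<integral>z. gauss_dens 0 1 (- z) *\<^sub>R (- z :: real^'k) \<partial>lborel)"
    by (subst lborel_integral_affine[where c="-1" and t=0]) auto
  also have "\<dots> = - ?I"
    by (simp add: gauss_dens_exp)
  finally have "2 *\<^sub>R ?I = 0" by (simp add: scaleR_2)
  then show ?thesis by simp
qed

lemma integral_gauss_dens_mean:
  assumes v: "v > 0"
  shows "(\<integral>y. gauss_dens m v y *\<^sub>R (y :: real^'k) \<partial>lborel) = m"
proof -
  have i1: "integrable lborel (\<lambda>z :: real^'k. gauss_dens 0 1 z *\<^sub>R z)"
    by (rule integrable_gauss_dens_poly_growth[where C=1 and n=1]) auto
  have i2: "integrable lborel (\<lambda>z :: real^'k. gauss_dens 0 1 z)"
    by (rule integrable_gauss_dens) simp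
  have "(\<integral>y. gauss_dens m v y *\<^sub>R (y :: real^'k) \<partial>lborel) =
    (\<integral>z. gauss_dens 0 1 z *\<^sub>R m + sqrt v *\<^sub>R (gauss_dens 0 1 z *\<^sub>R z) \<partial>lborel)"
    by (subst integral_gauss_dens_standardize[OF _ v]) (auto simp: algebra_simps)
  also have "\<dots> = (\<integral>z. gauss_dens (0 :: real^'k) 1 z *\<^sub>R m \<partial>lborel) + sqrt v *\<^sub>R (\<integral>z. gauss_dens 0 1 z *\<^sub>R z \<partial>lborel)"
    using integrable_scaleR_right[OF i1, of "sqrt v"] i2
    by (subst Bochner_Integration.integral_add) (auto simp del: scaleR_scaleR integral_scaleR_left intro: integral_scaleR_right)
  also have "\<dots> = m"
    using i2 integral_gauss_dens[of 1 "0 :: real^'k"] by (simp add: integral_gauss_dens_odd)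
  finally show ?thesis .
qed

section \<open>Bridge factorisation, change of mean and Jensen's inequality\<close>

text \<open>The left side is the joint density of a walk from \<open>x\<close> at \<open>z\<close>
  (variance \<open>w\<close>) and then at \<open>y\<close> (variance \<open>v\<close> more). The
  right side is the density of the endpoint times the conditional density of \<open>z\<close>: a
  bridge with interpolated mean and variance \<open>v * w / (w + v)\<close>. The proof completes the
  square.\<close>

lemma gauss_dens_mult:
  fixes x y z :: "real^'k"
  assumes v: "v > 0" and w: "w > 0"
  shows "gauss_dens x w z * gauss_dens y v z =
    gauss_dens x (w + v) y *
      gauss_dens ((1 / (w + v)) *\<^sub>R (w *\<^sub>R y + v *\<^sub>R x)) (v * w / (w + v)) z"
proof -
  define m where "m = (1 / (w + v)) *\<^sub>R (w *\<^sub>R y + v *\<^sub>R x)"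
  have vw: "v * w / (w + v) > 0" using v w by simp
  have mult_exchange: "(a * b) * (a' * b') = (a * a') * (b * b')" for a b a' b' :: real by simp
  have E: "(norm (z - x))\<^sup>2 / (2 * w) + (norm (z - y))\<^sup>2 / (2 * v) =
     (norm (y - x))\<^sup>2 / (2 * (w + v)) + (norm (z - m))\<^sup>2 / (2 * (v * w / (w + v)))"
  proof -
    have n: "(norm (a :: real^'k))\<^sup>2 = a \<bullet> a" for a by (simp add: power2_norm_eq_inner)
    define s where "s = w + v"
    have s: "s > 0" using v w by (simp add: s_def)
    define a where "a = z - x"
    define b where "b = y - x"
    have 1: "z - y = a - b" by (simp add: a_def b_def)
    have 2: "z - m = a - (w / s) *\<^sub>R b"
    proof -
      have "m = (w / s) *\<^sub>R y + (v / s) *\<^sub>R x" by (simp add: m_def s_def algebra_simps)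
      moreover have "v / s = 1 - w / s" using s by (simp add: field_simps s_def)
      ultimately show ?thesis by (simp add: a_def b_def algebra_simps)
    qed
    have A: "(norm (z - y))\<^sup>2 = a \<bullet> a - 2 * (a \<bullet> b) + b \<bullet> b"
      unfolding 1 n by (simp add: inner_diff_left inner_diff_right inner_commute)
    have B: "(norm (z - m))\<^sup>2 = a \<bullet> a - 2 * (w / s) * (a \<bullet> b) + (w / s)\<^sup>2 * (b \<bullet> b)"
      unfolding 2 n by (simp add: inner_diff_left inner_diff_right inner_commute power2_eq_square)
    \<comment> \<open>With the origin at \<open>x\<close>, all squared norms are combinations of
      three numbers, \<open>a \<bullet> a\<close>, \<open>a \<bullet> b\<close> and
      \<open>b \<bullet> b\<close>. What remains is a rational identity, checked coefficient by
      coefficient in \<open>c1\<close>, \<open>c2\<close>, \<open>c3\<close>.\<close>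
    have C: "X / (2 * w) + (X - 2 * P + Y) / (2 * v) =
        Y / (2 * s) + (X - 2 * (w / s) * P + (w / s)\<^sup>2 * Y) / (2 * (v * w / s))" for X P Y :: real
    proof -
      have c1: "1 / (2 * w) + 1 / (2 * v) = 1 / (2 * (v * w / s))"
        using v w s by (simp add: field_simps) (simp add: s_def algebra_simps)
      have c2: "1 / v = (w / s) * (1 / (v * w / s))"
        using v w s by (simp add: field_simps)
      have c3: "1 / (2 * v) = 1 / (2 * s) + (w / s)\<^sup>2 * (1 / (2 * (v * w / s)))"
        using v w s by (simp add: field_simps power2_eq_square) (simp add: s_def algebra_simps)
      have "X / (2 * w) + (X - 2 * P + Y) / (2 * v) =
          X * (1 / (2 * w) + 1 / (2 * v)) - P * (1 / v) + Y * (1 / (2 * v))"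
        by (simp add: algebra_simps add_divide_distrib diff_divide_distrib)
      also have "\<dots> = Y / (2 * s) + (X - 2 * (w / s) * P + (w / s)\<^sup>2 * Y) / (2 * (v * w / s))"
        unfolding c1 c2 by (subst c3) (simp add: algebra_simps add_divide_distrib diff_divide_distrib)
      finally show ?thesis .
    qed
    have n1: "(norm (z - x))\<^sup>2 = a \<bullet> a" and n2: "(norm (y - x))\<^sup>2 = b \<bullet> b"
      by (simp_all add: a_def b_def n)
    show ?thesis
      unfolding A B n1 n2 s_def[symmetric] by (rule C)
  qed
  have "sqrt (2 * pi * w) * sqrt (2 * pi * v) = sqrt (2 * pi * (w + v)) * sqrt (2 * pi * (v * w / (w + v)))"
    using v w by (simp flip: real_sqrt_mult)
  then have "(1 / sqrt (2 * pi * w)) ^ CARD('k) * (1 / sqrt (2 * pi * v)) ^ CARD('k) =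
      (1 / sqrt (2 * pi * (w + v))) ^ CARD('k) * (1 / sqrt (2 * pi * (v * w / (w + v)))) ^ CARD('k)"
    by (simp flip: power_mult_distrib)
  moreover have "exp (- (norm (z - x))\<^sup>2 / (2 * w)) * exp (- (norm (z - y))\<^sup>2 / (2 * v)) =
      exp (- (norm (y - x))\<^sup>2 / (2 * (w + v))) * exp (- (norm (z - m))\<^sup>2 / (2 * (v * w / (w + v))))"
    using E by (simp flip: exp_add)
  ultimately show ?thesis
    unfolding m_def[symmetric] gauss_dens_exp[OF v] gauss_dens_exp[OF w]
      gauss_dens_exp[OF add_pos_pos[OF w v]] gauss_dens_exp[OF vw]
    by (simp only: mult_exchange[of _ "exp _" _ "exp _"])
qed

text \<open>The exponential is the Girsanov weight of a single step: it exchanges a step with drift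
  \<open>b\<close> for a driftless one.\<close>

lemma gauss_dens_tilt:
  fixes y z b :: "real^'k"
  assumes v: "v > 0"
  shows "gauss_dens (y + b) v z = gauss_dens y v z * exp (b \<bullet> (z - y) / v - (norm b)\<^sup>2 / (2 * v))"
proof -
  have "(norm (z - (y + b)))\<^sup>2 = (norm (z - y))\<^sup>2 - 2 * (b \<bullet> (z - y)) + (norm b)\<^sup>2"
    by (simp add: power2_norm_eq_inner inner_diff_left inner_diff_right inner_add_left inner_add_right inner_commute)
  then have "- (norm (z - (y + b)))\<^sup>2 / (2 * v) =
      - (norm (z - y))\<^sup>2 / (2 * v) + (b \<bullet> (z - y) / v - (norm b)\<^sup>2 / (2 * v))"
    by (simp only: diff_divide_distrib add_divide_distrib minus_divide_left[symmetric])
  then show ?thesis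
    unfolding gauss_dens_exp[OF v] by (simp only: exp_add mult.assoc)
qed

text \<open>Jensen's inequality for the probability density \<open>\<rho>\<close>. With an extended
  nonnegative integral on the right, integrability of \<open>exp (Z y)\<close> need not be known
  beforehand; if the integral is infinite there is nothing to prove.\<close>

lemma exp_integral_le_nn_integral_exp:
  fixes \<rho> Z :: "'a \<Rightarrow> real"
  assumes [measurable]: "Z \<in> borel_measurable M"
    and \<rho>: "integrable M \<rho>" "\<And>y. \<rho> y \<ge> 0" "(\<integral>y. \<rho> y \<partial>M) = 1"
    and Z: "integrable M (\<lambda>y. \<rho> y * Z y)"
  shows "ennreal (exp (\<integral>y. \<rho> y * Z y \<partial>M)) \<le> (\<integral>\<^sup>+y. ennreal (\<rho> y * exp (Z y)) \<partial>M)"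
proof (cases "(\<integral>\<^sup>+y. ennreal (\<rho> y * exp (Z y)) \<partial>M) = \<infinity>")
  case False
  define m where "m = (\<integral>y. \<rho> y * Z y \<partial>M)"
  have [measurable]: "\<rho> \<in> borel_measurable M" using \<rho> by auto
  have int: "integrable M (\<lambda>y. \<rho> y * exp (Z y))"
    using False \<rho>(2) by (intro integrableI_nonneg) (auto simp: top.not_eq_extremum)
  have "exp m = exp m * ((1 - m) * (\<integral>y. \<rho> y \<partial>M) + (\<integral>y. \<rho> y * Z y \<partial>M))"
    using \<rho> by (simp add: m_def)
  also have "\<dots> = (\<integral>y. exp m * ((1 - m) * \<rho> y + \<rho> y * Z y) \<partial>M)"
    using \<rho>(1) Z by simp
  also have "\<dots> \<le> (\<integral>y. \<rho> y * exp (Z y) \<partial>M)"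
  proof (rule integral_mono[OF _ int])
    show "integrable M (\<lambda>y. exp m * ((1 - m) * \<rho> y + \<rho> y * Z y))" using \<rho>(1) Z by simp
    fix y
    \<comment> \<open>The tangent to the exponential at the mean \<open>m\<close>. Integrated
      against \<open>\<rho>\<close>, its linear part vanishes.\<close>
    have "exp m * (1 + (Z y - m)) \<le> exp m * exp (Z y - m)"
      by (intro mult_left_mono exp_ge_add_one_self) simp
    then have "exp m * (1 + (Z y - m)) \<le> exp (Z y)" by (simp flip: exp_add)
    then have "\<rho> y * (exp m * (1 + (Z y - m))) \<le> \<rho> y * exp (Z y)"
      by (intro mult_left_mono \<rho>)
    then show "exp m * ((1 - m) * \<rho> y + \<rho> y * Z y) \<le> \<rho> y * exp (Z y)" by (simp add: algebra_simps)
  qed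
  finally have "exp m \<le> (\<integral>y. \<rho> y * exp (Z y) \<partial>M)" .
  then show ?thesis unfolding m_def[symmetric]
    by (subst nn_integral_eq_integral[OF int]) (auto simp: \<rho> ennreal_leI)
qed auto

section \<open>Discrete Girsanov bound for Gaussian chains\<close>


text \<open>One step of the discrete Girsanov argument: conditionally on its endpoints \<open>x\<close> and \<open>y\<close>, the driftless
  walk is a Gaussian bridge, and Jensen's inequality is applied to the bridge.\<close>

lemma gauss_step_lower_bound:
  fixes x y b :: "real^'k" and l :: "real^'k \<Rightarrow> real"
  assumes v: "v > 0" and w: "w > 0"
    and [measurable]: "l \<in> borel_measurable borel"
    and l: "\<And>z. \<bar>l z\<bar> \<le> C * (1 + norm z)"
  defines "m \<equiv> (1 / (w + v)) *\<^sub>R (w *\<^sub>R y + v *\<^sub>R x)"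
  shows "ennreal (gauss_dens x (w + v) y *
      exp ((\<integral>z. gauss_dens m (v * w / (w + v)) z * l z \<partial>lborel)
        - b \<bullet> (y - x) / (w + v) - (norm b)\<^sup>2 / (2 * v)))
    \<le> (\<integral>\<^sup>+z. ennreal (gauss_dens (y + b) v z * (gauss_dens x w z * exp (l z))) \<partial>lborel)"
proof -
  define s where "s = v * w / (w + v)"
  have s: "s > 0" using v w by (simp add: s_def)
  \<comment> \<open>Exponent inherited from later steps plus the Girsanov exponent of the present
    one; both are averaged over the bridge.\<close>
  define Z where "Z = (\<lambda>z. l z + b \<bullet> (z - y) / v - (norm b)\<^sup>2 / (2 * v))"
  have [measurable]: "Z \<in> borel_measurable borel" unfolding Z_def by measurable
  have il: "integrable lborel (\<lambda>z. gauss_dens m s z * l z)"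
    using integrable_gauss_dens_poly_growth[of l s C 1 m] l s by simp
  have iz: "integrable lborel (\<lambda>z. gauss_dens m s z *\<^sub>R z)"
    by (rule integrable_gauss_dens_poly_growth[where C=1 and n=1]) (auto simp: s)
  have ig: "integrable lborel (gauss_dens m s)" by (rule integrable_gauss_dens[OF s])
  have eqZ: "gauss_dens m s z * Z z = gauss_dens m s z * l z +
      ((1 / v) * (b \<bullet> (gauss_dens m s z *\<^sub>R z)) + gauss_dens m s z * (- (b \<bullet> y) / v - (norm b)\<^sup>2 / (2 * v)))" for z
    by (simp add: Z_def algebra_simps inner_diff_right diff_divide_distrib)
  have ib: "integrable lborel (\<lambda>z. b \<bullet> (gauss_dens m s z *\<^sub>R z))"
    using iz by (intro integrable_inner_right)
  have iZ: "integrable lborel (\<lambda>z. gauss_dens m s z * Z z)"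
    unfolding eqZ using il ib ig by (intro Bochner_Integration.integrable_add integrable_mult_right integrable_mult_left) auto
  have "(\<integral>z. gauss_dens m s z * Z z \<partial>lborel) = (\<integral>z. gauss_dens m s z * l z \<partial>lborel) +
      ((1 / v) * (\<integral>z. b \<bullet> (gauss_dens m s z *\<^sub>R z) \<partial>lborel) + (\<integral>z. gauss_dens m s z \<partial>lborel) * (- (b \<bullet> y) / v - (norm b)\<^sup>2 / (2 * v)))"
    unfolding eqZ using il ib ig by (subst Bochner_Integration.integral_add; simp)+
  also have "(\<integral>z. b \<bullet> (gauss_dens m s z *\<^sub>R z) \<partial>lborel) = b \<bullet> m"
    using integral_inner_right[of b lborel "\<lambda>z. gauss_dens m s z *\<^sub>R z"] iz integral_gauss_dens_mean[OF s, of m] by simp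
  also have "(\<integral>z. gauss_dens m s z \<partial>lborel) = 1" by (rule integral_gauss_dens[OF s])
  also have "(1 / v) * (b \<bullet> m) + 1 * (- (b \<bullet> y) / v - (norm b)\<^sup>2 / (2 * v)) = - b \<bullet> (y - x) / (w + v) - (norm b)\<^sup>2 / (2 * v)"
  proof -
    \<comment> \<open>The bridge mean differs from \<open>y\<close> by a multiple of
      \<open>v\<close>, which cancels the \<open>1 / v\<close> of the Girsanov exponent. This is how
      the score of the Gaussian of variance \<open>w + v\<close> appears, free of the step
      variance.\<close>
    have "m - y = - (v / (w + v)) *\<^sub>R (y - x)"
    proof -
      have "m = (w / (w + v)) *\<^sub>R y + (v / (w + v)) *\<^sub>R x" by (simp add: m_def algebra_simps)
      moreover have "w / (w + v) = 1 - v / (w + v)" using v w by (simp add: field_simps)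
      ultimately have "m = (1 - v / (w + v)) *\<^sub>R y + (v / (w + v)) *\<^sub>R x" by simp
      then show ?thesis by (simp add: scaleR_left_diff_distrib scaleR_right_diff_distrib)
    qed
    then have "b \<bullet> m - b \<bullet> y = - (v / (w + v)) * (b \<bullet> (y - x))"
      by (metis inner_diff_right inner_scaleR_right)
    then have "(1 / v) * (b \<bullet> m - b \<bullet> y) = - (b \<bullet> (y - x)) / (w + v)"
      using v by simp
    then show ?thesis by (simp add: algebra_simps diff_divide_distrib)
  qed
  finally have IZ: "(\<integral>z. gauss_dens m s z * Z z \<partial>lborel) = (\<integral>z. gauss_dens m s z * l z \<partial>lborel)
        - b \<bullet> (y - x) / (w + v) - (norm b)\<^sup>2 / (2 * v)" by simp
  have J: "ennreal (exp (\<integral>z. gauss_dens m s z * Z z \<partial>lborel)) \<le> (\<integral>\<^sup>+z. ennreal (gauss_dens m s z * exp (Z z)) \<partial>lborel)"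
    by (rule exp_integral_le_nn_integral_exp[OF _ ig _ integral_gauss_dens[OF s] iZ]) auto
  have eq: "gauss_dens (y + b) v z * (gauss_dens x w z * exp (l z)) =
      gauss_dens x (w + v) y * (gauss_dens m s z * exp (Z z))" for z
  proof -
    have "gauss_dens (y + b) v z * (gauss_dens x w z * exp (l z)) =
        (gauss_dens x w z * gauss_dens y v z) * (exp (b \<bullet> (z - y) / v - (norm b)\<^sup>2 / (2 * v)) * exp (l z))"
      unfolding gauss_dens_tilt[OF v] by simp
    also have "\<dots> = (gauss_dens x (w + v) y * gauss_dens m s z) * exp (Z z)"
      unfolding gauss_dens_mult[OF v w] m_def[symmetric] s_def[symmetric] by (simp add: Z_def algebra_simps flip: exp_add)
    finally show ?thesis by simp
  qed
  have "(\<integral>\<^sup>+z. ennreal (gauss_dens (y + b) v z * (gauss_dens x w z * exp (l z))) \<partial>lborel) =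
      ennreal (gauss_dens x (w + v) y) * (\<integral>\<^sup>+z. ennreal (gauss_dens m s z * exp (Z z)) \<partial>lborel)"
    unfolding eq by (subst nn_integral_cmult[symmetric]) (auto simp: ennreal_mult')
  with mult_left_mono[OF J, of "ennreal (gauss_dens x (w + v) y)"] show ?thesis
    unfolding IZ s_def[symmetric] by (simp add: ennreal_mult')
qed

text \<open>The third claim is the tower property: a bridge whose endpoint has law
  \<open>N(x, w + v)\<close> has marginal \<open>N(x, w)\<close> at the intermediate time. The first
  two keep \<open>L\<close> among the measurable functions of linear growth, so that the averaging
  can be iterated.\<close>

lemma bridge_average:
  fixes x :: "real^'k" and l :: "real^'k \<Rightarrow> real"
  assumes v: "v > 0" and w: "w > 0"
    and [measurable]: "l \<in> borel_measurable borel"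
    and l: "\<And>z. \<bar>l z\<bar> \<le> C * (1 + norm z)"
  defines "m \<equiv> \<lambda>y. (1 / (w + v)) *\<^sub>R (w *\<^sub>R y + v *\<^sub>R x)"
  defines "L \<equiv> \<lambda>y. \<integral>z. gauss_dens (m y) (v * w / (w + v)) z * l z \<partial>lborel"
  shows "L \<in> borel_measurable borel"
    and "\<exists>C'. \<forall>y. \<bar>L y\<bar> \<le> C' * (1 + norm y)"
    and "(\<integral>y. gauss_dens x (w + v) y * L y \<partial>lborel) = (\<integral>z. gauss_dens x w z * l z \<partial>lborel)"
proof -
  define s where "s = v * w / (w + v)"
  have s: "s > 0" using v w by (simp add: s_def)
  \<comment> \<open>As a quotient of densities in which \<open>y\<close> and \<open>z\<close> enter
    through differences, the bridge density is visibly jointly measurable, which the measurability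
    of \<open>L\<close> and Fubini's theorem require.\<close>
  have g2: "gauss_dens (m y) s z = gauss_dens x w z * gauss_dens y v z / gauss_dens x (w + v) y" for y z
    using gauss_dens_mult[OF v w, of x z y] gauss_dens_pos[of "w + v" x y] v w by (simp add: m_def s_def)
  have gsym: "gauss_dens y v z = gauss_dens z v y" for y z :: "real^'k"
    using v by (simp add: gauss_dens_exp norm_minus_commute)
  have gy: "gauss_dens y v z = gauss_dens 0 v (z - y)" for y z :: "real^'k"
    using gauss_dens_shift[of 0 v z "- y"] by simp
  have [measurable]: "(\<lambda>p :: (real^'k) \<times> (real^'k). gauss_dens (fst p) v (snd p)) \<in> borel_measurable (borel \<Otimes>\<^sub>M borel)"
    by (subst gy) measurable
  have [measurable]: "(\<lambda>p. gauss_dens (m (fst p)) s (snd p) * l (snd p)) \<in> borel_measurable (borel \<Otimes>\<^sub>M lborel)"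
    unfolding g2 by measurable
  show Lm [measurable]: "L \<in> borel_measurable borel"
    unfolding L_def s_def[symmetric] by (intro lborel.borel_measurable_lebesgue_integral) (simp add: split_beta')
  have C0: "C \<ge> 0" using l[of 0] by simp
  have iz1: "integrable lborel (\<lambda>z :: real^'k. gauss_dens 0 1 z *\<^sub>R norm z)"
    by (rule integrable_gauss_dens_poly_growth[where C=1 and n=1]) auto
  define K where "K = (\<integral>z. gauss_dens (0 :: real^'k) 1 z *\<^sub>R norm z \<partial>lborel)"
  have K0: "K \<ge> 0" unfolding K_def by (intro integral_nonneg_AE) simp
  have bdL: "\<bar>L y\<bar> \<le> C * (1 + norm y + norm x + sqrt s * K)" for y
  proof -
    have lm [measurable]: "(\<lambda>z. l (m y + sqrt s *\<^sub>R z)) \<in> borel_measurable borel" by measurable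
    have "L y = (\<integral>z. gauss_dens 0 1 z *\<^sub>R l (m y + sqrt s *\<^sub>R z) \<partial>lborel)"
      unfolding L_def s_def[symmetric] using integral_gauss_dens_standardize[OF _ s, of l "m y"] by simp
    also have "\<bar>\<dots>\<bar> \<le> (\<integral>z. norm (gauss_dens 0 1 z *\<^sub>R l (m y + sqrt s *\<^sub>R z)) \<partial>lborel)"
      using integral_norm_bound[of lborel "\<lambda>z. gauss_dens 0 1 z *\<^sub>R l (m y + sqrt s *\<^sub>R z)"] by simp
    also have "\<dots> \<le> (\<integral>z. C * (1 + norm (m y)) * gauss_dens (0 :: real^'k) 1 z + C * sqrt s * (gauss_dens 0 1 z *\<^sub>R norm z) \<partial>lborel)"
    proof (rule integral_mono')
      show "integrable lborel (\<lambda>z :: real^'k. C * (1 + norm (m y)) * gauss_dens 0 1 z + C * sqrt s * (gauss_dens 0 1 z *\<^sub>R norm z))"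
        using iz1 integrable_gauss_dens[of 1 "0 :: real^'k"] by simp
      fix z :: "real^'k"
      have "norm (m y + sqrt s *\<^sub>R z) \<le> norm (m y) + sqrt s * norm z"
        using norm_triangle_ineq[of "m y" "sqrt s *\<^sub>R z"] s by simp
      then have "C * (1 + norm (m y + sqrt s *\<^sub>R z)) \<le> C * (1 + norm (m y) + sqrt s * norm z)"
        using C0 by (intro mult_left_mono) auto
      with l[of "m y + sqrt s *\<^sub>R z"] have "\<bar>l (m y + sqrt s *\<^sub>R z)\<bar> \<le> C * (1 + norm (m y) + sqrt s * norm z)" by linarith
      from mult_left_mono[OF this, of "gauss_dens 0 1 z"]
      show "norm (gauss_dens 0 1 z *\<^sub>R l (m y + sqrt s *\<^sub>R z)) \<le>
         C * (1 + norm (m y)) * gauss_dens 0 1 z + C * sqrt s * (gauss_dens 0 1 z *\<^sub>R norm z)"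
        by (simp add: algebra_simps abs_mult)
    qed (use C0 s in simp)
    also have "\<dots> = C * (1 + norm (m y)) + C * sqrt s * K"
      using iz1 integrable_gauss_dens[of 1 "0 :: real^'k"] integral_gauss_dens[of 1 "0 :: real^'k"]
      by (subst Bochner_Integration.integral_add) (simp_all add: K_def)
    also have "\<dots> \<le> C * (1 + norm y + norm x + sqrt s * K)"
    proof -
      have "norm (m y) \<le> (w * norm y + v * norm x) / (w + v)"
        unfolding m_def using norm_triangle_ineq[of "w *\<^sub>R y" "v *\<^sub>R x"] v w
        by (simp add: divide_right_mono)
      also have "\<dots> \<le> norm y + norm x"
        using v w by (simp add: divide_le_eq algebra_simps)
      finally have "1 + norm (m y) + sqrt s * K \<le> 1 + norm y + norm x + sqrt s * K" by simp
      from mult_left_mono[OF this C0] show ?thesis by (simp add: algebra_simps)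
    qed
    finally show ?thesis .
  qed
  show "\<exists>C'. \<forall>y. \<bar>L y\<bar> \<le> C' * (1 + norm y)"
  proof (intro exI allI)
    fix y :: "real^'k"
    have a: "0 \<le> norm x + sqrt s * K" using K0 s by simp
    have "1 + norm y + norm x + sqrt s * K \<le> (1 + norm x + sqrt s * K) * (1 + norm y)"
      using mult_nonneg_nonneg[OF a norm_ge_zero[of y]] by (simp add: algebra_simps)
    from mult_left_mono[OF this C0] bdL[of y]
    show "\<bar>L y\<bar> \<le> (C * (1 + norm x + sqrt s * K)) * (1 + norm y)" by (simp add: mult.assoc)
  qed
  have gm: "gauss_dens x (w + v) y * (gauss_dens (m y) s z * l z) = (gauss_dens x w z * l z) * gauss_dens z v y" for y z
    using gauss_dens_mult[OF v w, of x z y] by (simp add: m_def s_def gsym[of y] ac_simps)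
  have il: "integrable lborel (\<lambda>z. gauss_dens x w z * l z)"
    using integrable_gauss_dens_poly_growth[of l w C 1 x] l w by simp
  have [measurable]: "(\<lambda>p. gauss_dens x w (fst p) * l (fst p) * gauss_dens (fst p) v (snd p)) \<in> borel_measurable (lborel \<Otimes>\<^sub>M lborel)"
    by measurable
  \<comment> \<open>The inner integral over \<open>y\<close> of the last factor is 1, so the
    absolute double integral reduces to that of \<open>gauss_dens x w z * l z\<close>.\<close>
  have int: "integrable (lborel \<Otimes>\<^sub>M lborel) (\<lambda>(z, y). gauss_dens x w z * l z * gauss_dens z v y)"
  proof (rule lborel_pair.Fubini_integrable)
    show "integrable lborel (\<lambda>z. \<integral>y. norm (case (z, y) of (z, y) \<Rightarrow> gauss_dens x w z * l z * gauss_dens z v y) \<partial>lborel)"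
      using integrable_norm[OF il] by (simp add: abs_mult integral_gauss_dens[OF v])
  qed (use v in \<open>auto simp: split_beta' intro: integrable_gauss_dens\<close>)
  have "(\<integral>y. gauss_dens x (w + v) y * L y \<partial>lborel) =
      (\<integral>y. (\<integral>z. gauss_dens x w z * l z * gauss_dens z v y \<partial>lborel) \<partial>lborel)"
    unfolding L_def s_def[symmetric] integral_mult_right_zero[symmetric] gm ..
  also have "\<dots> = (\<integral>z. (\<integral>y. gauss_dens x w z * l z * gauss_dens z v y \<partial>lborel) \<partial>lborel)"
    using lborel_pair.Fubini_integral[OF int] by simp
  also have "\<dots> = (\<integral>z. gauss_dens x w z * l z \<partial>lborel)"
    by (simp add: integral_gauss_dens[OF v])
  finally show "(\<integral>y. gauss_dens x (w + v) y * L y \<partial>lborel) = (\<integral>z. gauss_dens x w z * l z \<partial>lborel)" .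
qed

section \<open>Markov chains with Gaussian increments\<close>

text \<open>Given \<open>\<xi>\<close>, the next iterate is Gaussian with mean
  \<open>\<xi> + b \<xi>\<close> and variance \<open>v\<close>. Independence makes this precise as a
  product measure.\<close>

lemma (in prob_space) nn_integral_gauss_step:
  fixes \<xi> D :: "'a \<Rightarrow> real^'k"
  assumes ind: "indep_var borel \<xi> borel D"
    and D: "distributed M lborel D (\<lambda>y. ennreal (gauss_dens 0 v y))"
    and [measurable]: "b \<in> borel_measurable borel" "u \<in> borel_measurable borel"
  shows "(\<integral>\<^sup>+\<omega>. u (\<xi> \<omega> + b (\<xi> \<omega>) + D \<omega>) \<partial>M) =
    (\<integral>\<^sup>+\<omega>. (\<integral>\<^sup>+z. ennreal (gauss_dens (\<xi> \<omega> + b (\<xi> \<omega>)) v z) * u z \<partial>lborel) \<partial>M)"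
proof -
  have [measurable]: "\<xi> \<in> borel_measurable M" "D \<in> borel_measurable M"
    using ind by (auto simp: indep_var_distribution_eq)
  have dD: "distr M borel D = density lborel (\<lambda>y. ennreal (gauss_dens 0 v y))"
    using distributed_distr_eq_density[OF D] by (simp cong: distr_cong)
  interpret D: prob_space "distr M borel D" by (rule prob_space_distr) simp
  have "(\<integral>\<^sup>+\<omega>. u (\<xi> \<omega> + b (\<xi> \<omega>) + D \<omega>) \<partial>M) =
      (\<integral>\<^sup>+p. u (fst p + b (fst p) + snd p) \<partial>distr M (borel \<Otimes>\<^sub>M borel) (\<lambda>\<omega>. (\<xi> \<omega>, D \<omega>)))"
    by (subst nn_integral_distr) auto
  also have "distr M (borel \<Otimes>\<^sub>M borel) (\<lambda>\<omega>. (\<xi> \<omega>, D \<omega>)) = distr M borel \<xi> \<Otimes>\<^sub>M distr M borel D"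
    using ind by (simp add: indep_var_distribution_eq)
  also have "(\<integral>\<^sup>+p. u (fst p + b (fst p) + snd p) \<partial>(distr M borel \<xi> \<Otimes>\<^sub>M distr M borel D)) =
      (\<integral>\<^sup>+y. (\<integral>\<^sup>+z. u (y + b y + z) \<partial>distr M borel D) \<partial>distr M borel \<xi>)"
    by (subst D.nn_integral_fst[symmetric]) (auto cong: measurable_cong_sets)
  also have "\<dots> = (\<integral>\<^sup>+\<omega>. (\<integral>\<^sup>+z. u (\<xi> \<omega> + b (\<xi> \<omega>) + z) \<partial>distr M borel D) \<partial>M)"
    by (subst nn_integral_distr) (auto intro!: D.borel_measurable_nn_integral simp: split_beta')
  also have "\<dots> = (\<integral>\<^sup>+\<omega>. (\<integral>\<^sup>+z. ennreal (gauss_dens (\<xi> \<omega> + b (\<xi> \<omega>)) v z) * u z \<partial>lborel) \<partial>M)"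
  proof (rule nn_integral_cong)
    fix \<omega>
    let ?a = "\<xi> \<omega> + b (\<xi> \<omega>)"
    have "(\<integral>\<^sup>+z. u (?a + z) \<partial>distr M borel D) = (\<integral>\<^sup>+z. ennreal (gauss_dens 0 v z) * u (?a + z) \<partial>lborel)"
      unfolding dD by (subst nn_integral_density) auto
    also have "\<dots> = (\<integral>\<^sup>+z. ennreal (gauss_dens ?a v z) * u z \<partial>lborel)"
      by (subst nn_integral_lborel_affine[where c=1 and t="?a" and f="\<lambda>z. ennreal (gauss_dens ?a v z) * u z"])
         (auto simp: gauss_dens_shift[of ?a v _ ?a] add.commute)
    finally show "(\<integral>\<^sup>+z. u (?a + z) \<partial>distr M borel D) = (\<integral>\<^sup>+z. ennreal (gauss_dens ?a v z) * u z \<partial>lborel)" .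
  qed
  finally show ?thesis .
qed

text \<open>The right side is the density at \<open>x\<close> of \<open>\<xi> n\<close> plus an
  independent centred Gaussian of variance \<open>w n\<close>. Seen backwards from \<open>x\<close>,
  \<open>w i\<close> is the variance of the driftless walk at index \<open>i\<close>, which gains
  \<open>v i\<close> in passing from \<open>Suc i\<close> to \<open>i\<close>. Since every step
  replaces the exponent by its bridge mean, only the marginals \<open>N(x, w i)\<close> survive on
  the left.\<close>

lemma (in prob_space) gaussian_chain_lower_bound:
  fixes \<xi> D :: "nat \<Rightarrow> 'a \<Rightarrow> real^'k" and b :: "nat \<Rightarrow> real^'k \<Rightarrow> real^'k" and x :: "real^'k"
  assumes ind: "\<And>i. i < n \<Longrightarrow> indep_var borel (\<xi> i) borel (D i)"
    and D: "\<And>i. i < n \<Longrightarrow> distributed M lborel (D i) (\<lambda>y. ennreal (gauss_dens 0 (v i) y))"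
    and v: "\<And>i. i < n \<Longrightarrow> v i > 0"
    and \<xi>: "\<And>i \<omega>. i < n \<Longrightarrow> \<xi> (Suc i) \<omega> = \<xi> i \<omega> + b i (\<xi> i \<omega>) + D i \<omega>"
    and b [measurable]: "\<And>i. b i \<in> borel_measurable borel"
    and B: "\<And>i y. norm (b i y) \<le> B"
    and w: "\<And>i. i < n \<Longrightarrow> w i = w (Suc i) + v i" and wn: "w n > 0"
    and \<xi>0: "distributed M lborel (\<xi> 0) (\<lambda>y. ennreal (q0 y))"
    and q0: "\<And>y. q0 y > 0" and [measurable]: "q0 \<in> borel_measurable borel"
    and lnq0: "integrable lborel (\<lambda>y. ln (q0 y) * gauss_dens x (w 0) y)"
  shows "ennreal (exp ((\<integral>y. ln (q0 y) * gauss_dens x (w 0) y \<partial>lborel) +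
      (\<Sum>i<n. \<integral>y. gauss_dens x (w i) y * (- b i y \<bullet> (y - x) / w i - (norm (b i y))\<^sup>2 / (2 * v i)) \<partial>lborel)))
    \<le> (\<integral>\<^sup>+\<omega>. ennreal (gauss_dens x (w n) (\<xi> n \<omega>)) \<partial>M)"
proof -
  \<comment> \<open>Mean Girsanov exponent of step \<open>i\<close>, given that the backward walk is
    at \<open>y\<close> after that step. The uniform bound \<open>B\<close> on the drift makes it
    grow at most linearly.\<close>
  define a where "a i y = - b i y \<bullet> (y - x) / w i - (norm (b i y))\<^sup>2 / (2 * v i)" for i y
  have am [measurable]: "a i \<in> borel_measurable borel" for i unfolding a_def by measurable
  have wpos: "w i > 0" if "i \<le> n" for i
    using that by (induction rule: inc_induct) (use wn w v in \<open>fastforce intro: add_pos_pos\<close>)+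
  have B0: "B \<ge> 0" using B[of 0 0] norm_ge_zero[of "b 0 0"] by linarith
  have abd: "\<exists>C. \<forall>y. \<bar>a i y\<bar> \<le> C * (1 + norm y)" if i: "i < n" for i
  proof (intro exI allI)
    fix y
    have wi: "w i > 0" and vi: "v i > 0" using wpos v i by auto
    have 1: "\<bar>b i y \<bullet> (y - x)\<bar> \<le> B * (norm y + norm x)"
      using Cauchy_Schwarz_ineq2[of "b i y" "y - x"] mult_mono[OF B[of i y] norm_triangle_ineq4[of y x] B0 norm_ge_zero] by linarith
    have 2: "(norm (b i y))\<^sup>2 \<le> B\<^sup>2" using B by (intro power_mono) auto
    have "\<bar>a i y\<bar> \<le> \<bar>b i y \<bullet> (y - x)\<bar> / w i + (norm (b i y))\<^sup>2 / (2 * v i)"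
      unfolding a_def using wi vi abs_triangle_ineq4[of "- b i y \<bullet> (y - x) / w i" "(norm (b i y))\<^sup>2 / (2 * v i)"] by simp
    also have "\<dots> \<le> B * (norm y + norm x) / w i + B\<^sup>2 / (2 * v i)"
      using 1 2 wi vi by (intro add_mono divide_right_mono) auto
    also have "\<dots> \<le> (B / w i + B * norm x / w i + B\<^sup>2 / (2 * v i)) * (1 + norm y)"
    proof -
      have "0 \<le> B / w i + B * norm x / w i * norm y + B\<^sup>2 / (2 * v i) * norm y" using B0 wi vi by simp
      then show ?thesis by (simp add: distrib_left distrib_right add_divide_distrib)
    qed
    finally show "\<bar>a i y\<bar> \<le> (B / w i + B * norm x / w i + B\<^sup>2 / (2 * v i)) * (1 + norm y)" .
  qed
  have \<xi>m [measurable]: "\<xi> i \<in> borel_measurable M" if "i \<le> n" for i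
    using that
  proof (induction i)
    case 0 then show ?case using distributed_measurable[OF \<xi>0] by simp
  next
    case (Suc i)
    have "D i \<in> borel_measurable M" using distributed_measurable[OF D[of i]] Suc by simp
    with Suc show ?case by (subst measurable_cong[OF \<xi>]) auto
  qed
  \<comment> \<open>Backward induction on \<open>j\<close>. The exponent \<open>l\<close> carries
    the contribution of the steps from \<open>j\<close> to \<open>n - 1\<close>; besides the
    inequality, only its growth and its Gaussian mean are recorded, since it has no simple closed
    form.\<close>
  have main: "\<exists>l C. l \<in> borel_measurable borel \<and> (\<forall>y. \<bar>l y\<bar> \<le> C * (1 + norm y)) \<and>
      (\<integral>y. gauss_dens x (w j) y * l y \<partial>lborel) = (\<Sum>i=j..<n. \<integral>y. gauss_dens x (w i) y * a i y \<partial>lborel) \<and>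
      (\<integral>\<^sup>+\<omega>. ennreal (gauss_dens x (w j) (\<xi> j \<omega>) * exp (l (\<xi> j \<omega>))) \<partial>M) \<le>
        (\<integral>\<^sup>+\<omega>. ennreal (gauss_dens x (w n) (\<xi> n \<omega>)) \<partial>M)" if "j \<le> n" for j
    using that
  proof (induction rule: inc_induct)
    case base
    show ?case by (rule exI[of _ "\<lambda>_. 0"], rule exI[of _ 0]) auto
  next
    case (step j)
    then obtain l C where [measurable]: "l \<in> borel_measurable borel" and l: "\<And>y. \<bar>l y\<bar> \<le> C * (1 + norm y)"
      and lint: "(\<integral>y. gauss_dens x (w (Suc j)) y * l y \<partial>lborel) = (\<Sum>i=Suc j..<n. \<integral>y. gauss_dens x (w i) y * a i y \<partial>lborel)"
      and lE: "(\<integral>\<^sup>+\<omega>. ennreal (gauss_dens x (w (Suc j)) (\<xi> (Suc j) \<omega>) * exp (l (\<xi> (Suc j) \<omega>))) \<partial>M) \<le>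
        (\<integral>\<^sup>+\<omega>. ennreal (gauss_dens x (w n) (\<xi> n \<omega>)) \<partial>M)"
      by auto
    have vj: "v j > 0" and wj: "w (Suc j) > 0" and wj0: "w j > 0" and wjeq: "w (Suc j) + v j = w j"
      using step v[of j] wpos[of j] wpos[of "Suc j"] w[of j] by auto
    define L where "L y = (\<integral>z. gauss_dens ((1 / w j) *\<^sub>R (w (Suc j) *\<^sub>R y + v j *\<^sub>R x)) (v j * w (Suc j) / w j) z * l z \<partial>lborel)" for y
    note br = bridge_average[OF vj wj \<open>l \<in> borel_measurable borel\<close> l, of x, unfolded wjeq, folded L_def]
    have [measurable]: "L \<in> borel_measurable borel" by (rule br(1))
    obtain C' where C': "\<And>y. \<bar>L y\<bar> \<le> C' * (1 + norm y)" using br(2) by auto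
    obtain C'' where C'': "\<And>y. \<bar>a j y\<bar> \<le> C'' * (1 + norm y)" using abd step by blast
    show ?case
    proof (intro exI conjI allI)
      \<comment> \<open>The new exponent is the bridge average of the old one plus the term of step
        \<open>j\<close>. By the tower property the average keeps the mean, so exactly one summand
        is added.\<close>
      show "(\<lambda>y. L y + a j y) \<in> borel_measurable borel" by measurable
      show "\<bar>L y + a j y\<bar> \<le> (C' + C'') * (1 + norm y)" for y
        using C'[of y] C''[of y] abs_triangle_ineq[of "L y" "a j y"] by (simp add: distrib_right)
      have iL: "integrable lborel (\<lambda>y. gauss_dens x (w j) y * L y)"
        using integrable_gauss_dens_poly_growth[of L "w j" C' 1 x] C' wj0 by simp
      have ia: "integrable lborel (\<lambda>y. gauss_dens x (w j) y * a j y)"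
        using integrable_gauss_dens_poly_growth[of "a j" "w j" C'' 1 x] C'' wj0 by simp
      have "(\<integral>y. gauss_dens x (w j) y * (L y + a j y) \<partial>lborel) =
          (\<integral>y. gauss_dens x (w (Suc j)) y * l y \<partial>lborel) + (\<integral>y. gauss_dens x (w j) y * a j y \<partial>lborel)"
        using iL ia br(3) by (simp add: distrib_left)
      also have "\<dots> = (\<Sum>i=j..<n. \<integral>y. gauss_dens x (w i) y * a i y \<partial>lborel)"
        unfolding lint using step by (simp add: sum.atLeast_Suc_lessThan)
      finally show "(\<integral>y. gauss_dens x (w j) y * (L y + a j y) \<partial>lborel) = (\<Sum>i=j..<n. \<integral>y. gauss_dens x (w i) y * a i y \<partial>lborel)" .
      have "(\<integral>\<^sup>+\<omega>. ennreal (gauss_dens x (w j) (\<xi> j \<omega>) * exp (L (\<xi> j \<omega>) + a j (\<xi> j \<omega>))) \<partial>M) \<le>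
          (\<integral>\<^sup>+\<omega>. (\<integral>\<^sup>+z. ennreal (gauss_dens (\<xi> j \<omega> + b j (\<xi> j \<omega>)) (v j) z) *
              ennreal (gauss_dens x (w (Suc j)) z * exp (l z)) \<partial>lborel) \<partial>M)"
      proof (rule nn_integral_mono)
        fix \<omega>
        have "L y + a j y = L y - b j y \<bullet> (y - x) / w j - (norm (b j y))\<^sup>2 / (2 * v j)" for y
          by (simp add: a_def)
        then show "ennreal (gauss_dens x (w j) (\<xi> j \<omega>) * exp (L (\<xi> j \<omega>) + a j (\<xi> j \<omega>))) \<le>
          (\<integral>\<^sup>+z. ennreal (gauss_dens (\<xi> j \<omega> + b j (\<xi> j \<omega>)) (v j) z) *
              ennreal (gauss_dens x (w (Suc j)) z * exp (l z)) \<partial>lborel)"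
          using gauss_step_lower_bound[OF vj wj \<open>l \<in> borel_measurable borel\<close> l, of x "\<xi> j \<omega>" "b j (\<xi> j \<omega>)"]
          unfolding wjeq L_def[symmetric] by (simp only: ennreal_mult'[symmetric] gauss_dens_nonneg)
      qed
      also have "\<dots> = (\<integral>\<^sup>+\<omega>. ennreal (gauss_dens x (w (Suc j)) (\<xi> (Suc j) \<omega>) * exp (l (\<xi> (Suc j) \<omega>))) \<partial>M)"
        using step
        by (subst nn_integral_gauss_step[OF ind[of j] D[of j], symmetric]) (auto simp: \<xi>)
      also note lE
      finally show "(\<integral>\<^sup>+\<omega>. ennreal (gauss_dens x (w j) (\<xi> j \<omega>) * exp (L (\<xi> j \<omega>) + a j (\<xi> j \<omega>))) \<partial>M) \<le>
        (\<integral>\<^sup>+\<omega>. ennreal (gauss_dens x (w n) (\<xi> n \<omega>)) \<partial>M)" .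
    qed
  qed
  from main[of 0] obtain l C where [measurable]: "l \<in> borel_measurable borel" and l: "\<And>y. \<bar>l y\<bar> \<le> C * (1 + norm y)"
      and lint: "(\<integral>y. gauss_dens x (w 0) y * l y \<partial>lborel) = (\<Sum>i<n. \<integral>y. gauss_dens x (w i) y * a i y \<partial>lborel)"
      and lE: "(\<integral>\<^sup>+\<omega>. ennreal (gauss_dens x (w 0) (\<xi> 0 \<omega>) * exp (l (\<xi> 0 \<omega>))) \<partial>M) \<le>
        (\<integral>\<^sup>+\<omega>. ennreal (gauss_dens x (w n) (\<xi> n \<omega>)) \<partial>M)"
    by (auto simp: atLeast0LessThan)
  have w0: "w 0 > 0" by (rule wpos) simp
  have il: "integrable lborel (\<lambda>y. gauss_dens x (w 0) y * l y)"
    using integrable_gauss_dens_poly_growth[of l "w 0" C 1 x] l w0 by simp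
  have iq: "integrable lborel (\<lambda>y. gauss_dens x (w 0) y * ln (q0 y))"
    using lnq0 by (simp add: mult.commute)
  \<comment> \<open>A last use of Jensen's inequality, under \<open>N(x, w 0)\<close> itself:
    positivity of \<open>q0\<close> allows it to enter the exponent as \<open>ln (q0 y)\<close>, and
    the law of \<open>\<xi> 0\<close> turns the integral into an expectation.\<close>
  have "ennreal (exp (\<integral>y. gauss_dens x (w 0) y * (ln (q0 y) + l y) \<partial>lborel)) \<le>
      (\<integral>\<^sup>+y. ennreal (gauss_dens x (w 0) y * exp (ln (q0 y) + l y)) \<partial>lborel)"
    using il iq by (intro exp_integral_le_nn_integral_exp integrable_gauss_dens integral_gauss_dens w0) (auto simp: distrib_left)
  also have "\<dots> = (\<integral>\<^sup>+y. ennreal (q0 y) * ennreal (gauss_dens x (w 0) y * exp (l y)) \<partial>lborel)"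
    by (intro nn_integral_cong) (simp add: exp_add q0 less_imp_le ac_simps flip: ennreal_mult)
  also have "\<dots> = (\<integral>\<^sup>+\<omega>. ennreal (gauss_dens x (w 0) (\<xi> 0 \<omega>) * exp (l (\<xi> 0 \<omega>))) \<partial>M)"
    by (rule distributed_nn_integral[OF \<xi>0]) measurable
  also note lE
  also have "(\<integral>y. gauss_dens x (w 0) y * (ln (q0 y) + l y) \<partial>lborel) =
     (\<integral>y. ln (q0 y) * gauss_dens x (w 0) y \<partial>lborel) + (\<Sum>i<n. \<integral>y. gauss_dens x (w i) y * a i y \<partial>lborel)"
    using il iq by (simp add: distrib_left lint mult.commute[of "ln (q0 _)"])
  finally show ?thesis unfolding a_def .
qed

section \<open>Wiener integrals as limits of Riemann sums\<close>


lemma (in prob_space) distributed_gauss_scale: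
  fixes D :: "'a \<Rightarrow> real^'k"
  assumes D: "distributed M lborel D (\<lambda>y. ennreal (gauss_dens 0 v y))" and v: "v > 0" and a: "a \<noteq> 0"
  shows "distributed M lborel (\<lambda>\<omega>. a *\<^sub>R D \<omega>) (\<lambda>y. ennreal (gauss_dens 0 (a\<^sup>2 * v) y))"
proof -
  have [measurable]: "D \<in> borel_measurable M" using distributed_measurable[OF D] by simp
  have g: "gauss_dens 0 v z = \<bar>a\<bar> ^ CARD('k) * gauss_dens 0 (a\<^sup>2 * v) (a *\<^sub>R z)" for z :: "real^'k"
  proof -
    have "(1 / sqrt (2 * pi * v)) ^ CARD('k) = \<bar>a\<bar> ^ CARD('k) * (1 / sqrt (2 * pi * (a\<^sup>2 * v))) ^ CARD('k)"
      using a v by (subst power_mult_distrib[symmetric], intro arg_cong[where f="\<lambda>c. c ^ CARD('k)"])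
        (simp add: real_sqrt_mult)
    moreover have "(norm (a *\<^sub>R z))\<^sup>2 / (2 * (a\<^sup>2 * v)) = (norm z)\<^sup>2 / (2 * v)"
      using a v by (simp add: power_mult_distrib)
    ultimately show ?thesis using a v by (simp add: gauss_dens_exp)
  qed
  show ?thesis
    unfolding distributed_def
  proof (intro conjI measure_eqI)
    fix A assume "A \<in> sets (distr M lborel (\<lambda>\<omega>. a *\<^sub>R D \<omega>))"
    then have [measurable]: "A \<in> sets borel" by simp
    have "emeasure (distr M lborel (\<lambda>\<omega>. a *\<^sub>R D \<omega>)) A = (\<integral>\<^sup>+\<omega>. indicator A (a *\<^sub>R D \<omega>) \<partial>M)"
      by (subst nn_integral_indicator[symmetric], simp, subst nn_integral_distr) auto
    also have "\<dots> = (\<integral>\<^sup>+z. ennreal (gauss_dens 0 v z) * indicator A (a *\<^sub>R z) \<partial>lborel)"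
      by (rule distributed_nn_integral[OF D, symmetric]) measurable
    also have "\<dots> = ennreal (\<bar>a\<bar> ^ CARD('k)) * (\<integral>\<^sup>+z. ennreal (gauss_dens 0 (a\<^sup>2 * v) (0 + a *\<^sub>R z)) * indicator A (0 + a *\<^sub>R z) \<partial>lborel)"
      unfolding g by (subst nn_integral_cmult[symmetric]) (auto simp: ennreal_mult' mult.assoc)
    also have "\<dots> = (\<integral>\<^sup>+y. ennreal (gauss_dens 0 (a\<^sup>2 * v) y) * indicator A y \<partial>lborel)"
      by (subst (2) nn_integral_lborel_affine[where t=0 and c=a]) (auto simp: a DIM_cart)
    also have "\<dots> = emeasure (density lborel (\<lambda>y. ennreal (gauss_dens 0 (a\<^sup>2 * v) y))) A"
      by (subst emeasure_density) auto
    finally show "emeasure (distr M lborel (\<lambda>\<omega>. a *\<^sub>R D \<omega>)) A =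
      emeasure (density lborel (\<lambda>y. ennreal (gauss_dens 0 (a\<^sup>2 * v) y))) A" .
  qed auto
qed

text \<open>The integral in the second moment is a constant of the dimension; what matters later is
  that the moment is proportional to \<open>v\<close>.\<close>

lemma (in prob_space) distributed_gauss_moments:
  fixes D :: "'a \<Rightarrow> real^'k"
  assumes D: "distributed M lborel D (\<lambda>y. ennreal (gauss_dens 0 v y))" and v: "v > 0"
  shows "integrable M D" "expectation D = 0" "integrable M (\<lambda>\<omega>. (norm (D \<omega>))\<^sup>2)"
    "expectation (\<lambda>\<omega>. (norm (D \<omega>))\<^sup>2) = v * (\<integral>z. gauss_dens (0 :: real^'k) 1 z * (norm z)\<^sup>2 \<partial>lborel)"
proof -
  have [measurable]: "D \<in> borel_measurable M" using distributed_measurable[OF D] by simp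
  have dD: "distr M borel D = density lborel (\<lambda>y. ennreal (gauss_dens 0 v y))"
    using distributed_distr_eq_density[OF D] by (simp cong: distr_cong)
  have i1: "integrable lborel (\<lambda>y :: real^'k. gauss_dens 0 v y *\<^sub>R y)"
    by (rule integrable_gauss_dens_poly_growth[where C=1 and n=1]) (auto simp: v)
  have i2: "integrable lborel (\<lambda>y :: real^'k. gauss_dens 0 v y *\<^sub>R (norm y)\<^sup>2)"
    by (rule integrable_gauss_dens_poly_growth[where C=1 and n=2]) (auto simp: v)
  have "integrable (distr M borel D) (\<lambda>y. y)"
    unfolding dD by (subst integrable_density) (use i1 in auto)
  then show "integrable M D" by (subst (asm) integrable_distr_eq) auto
  have "integrable (distr M borel D) (\<lambda>y. (norm y)\<^sup>2)"
    unfolding dD by (subst integrable_density) (use i2 in auto)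
  then show "integrable M (\<lambda>\<omega>. (norm (D \<omega>))\<^sup>2)" by (subst (asm) integrable_distr_eq) auto
  have "expectation D = integral\<^sup>L (distr M borel D) (\<lambda>y. y)"
    by (subst integral_distr) auto
  also have "\<dots> = 0"
    unfolding dD by (subst integral_density) (auto simp: integral_gauss_dens_mean[OF v])
  finally show "expectation D = 0" .
  have "expectation (\<lambda>\<omega>. (norm (D \<omega>))\<^sup>2) = integral\<^sup>L (distr M borel D) (\<lambda>y. (norm y)\<^sup>2)"
    by (subst integral_distr) auto
  also have "\<dots> = (\<integral>y. gauss_dens (0 :: real^'k) v y *\<^sub>R (norm y)\<^sup>2 \<partial>lborel)"
    unfolding dD by (subst integral_density) (auto simp: v)
  also have "\<dots> = (\<integral>z. gauss_dens (0 :: real^'k) 1 z *\<^sub>R (norm (0 + sqrt v *\<^sub>R z))\<^sup>2 \<partial>lborel)"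
    by (rule integral_gauss_dens_standardize[OF _ v]) measurable
  also have "\<dots> = (\<integral>z. v * (gauss_dens (0 :: real^'k) 1 z * (norm z)\<^sup>2) \<partial>lborel)"
    using v by (intro Bochner_Integration.integral_cong) (auto simp: power_mult_distrib)
  finally show "expectation (\<lambda>\<omega>. (norm (D \<omega>))\<^sup>2) = v * (\<integral>z. gauss_dens (0 :: real^'k) 1 z * (norm z)\<^sup>2 \<partial>lborel)"
    by simp
qed

lemma (in prob_space) indep_var_of_indep_vars:
  assumes ind: "indep_vars (\<lambda>_. N) X I" and "i \<in> I" "j \<in> I" "i \<noteq> j"
  shows "indep_var N (X i) N (X j)"
proof -
  have "indep_var (PiM {i} (\<lambda>_. N)) (\<lambda>\<omega>. restrict (\<lambda>i. X i \<omega>) {i}) (PiM {j} (\<lambda>_. N)) (\<lambda>\<omega>. restrict (\<lambda>i. X i \<omega>) {j})"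
    using assms by (intro indep_var_restrict[OF ind]) auto
  from indep_var_compose[OF this, of "\<lambda>f. f i" N "\<lambda>f. f j" N] show ?thesis
    by (simp add: comp_def)
qed

text \<open>Orthogonality of the increments: the inner product of two distinct ones is a sum over
  coordinates of products of independent centred real variables, so all cross terms have mean
  zero.\<close>

lemma (in prob_space) expectation_norm_sum_indep:
  fixes D :: "nat \<Rightarrow> 'a \<Rightarrow> real^'k"
  assumes ind: "indep_vars (\<lambda>_. borel) D {..<n}"
    and int: "\<And>i. i < n \<Longrightarrow> integrable M (D i)" and mean: "\<And>i. i < n \<Longrightarrow> expectation (D i) = 0"
    and sq: "\<And>i. i < n \<Longrightarrow> integrable M (\<lambda>\<omega>. (norm (D i \<omega>))\<^sup>2)"
  shows "integrable M (\<lambda>\<omega>. (norm (\<Sum>i<n. b i *\<^sub>R D i \<omega>))\<^sup>2)"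
    "expectation (\<lambda>\<omega>. (norm (\<Sum>i<n. b i *\<^sub>R D i \<omega>))\<^sup>2) = (\<Sum>i<n. (b i)\<^sup>2 * expectation (\<lambda>\<omega>. (norm (D i \<omega>))\<^sup>2))"
proof -
  have off: "integrable M (\<lambda>\<omega>. D i \<omega> \<bullet> D j \<omega>) \<and> expectation (\<lambda>\<omega>. D i \<omega> \<bullet> D j \<omega>) = 0" if "i < n" "j < n" "i \<noteq> j" for i j
  proof -
    have c: "indep_var borel (\<lambda>\<omega>. D i \<omega> $ c) borel (\<lambda>\<omega>. D j \<omega> $ c)" for c
      using indep_var_compose[OF indep_var_of_indep_vars[OF ind, of i j], of "\<lambda>y. y $ c" borel "\<lambda>y. y $ c" borel] that
      by (simp add: comp_def)
    have ic: "integrable M (\<lambda>\<omega>. D i \<omega> $ c)" and ec: "expectation (\<lambda>\<omega>. D i \<omega> $ c) = 0" if "i < n" for i c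
      using integrable_bounded_linear[OF bounded_linear_vec_nth int[OF that]]
        integral_bounded_linear[OF bounded_linear_vec_nth int[OF that], of c] mean[OF that] by auto
    have "integrable M (\<lambda>\<omega>. D i \<omega> $ c * D j \<omega> $ c)" "expectation (\<lambda>\<omega>. D i \<omega> $ c * D j \<omega> $ c) = 0" for c
      using indep_var_integrable[OF c ic ic] indep_var_lebesgue_integral[OF c ic ic] ec that by auto
    then show ?thesis by (simp add: inner_vec_def)
  qed
  have all: "integrable M (\<lambda>\<omega>. D i \<omega> \<bullet> D j \<omega>)" if "i < n" "j < n" for i j
    using off[OF that] sq[OF that(1)] by (cases "i = j") (auto simp: power2_norm_eq_inner)
  have eq: "(norm (\<Sum>i<n. b i *\<^sub>R D i \<omega>))\<^sup>2 = (\<Sum>i<n. \<Sum>j<n. b i * b j * (D i \<omega> \<bullet> D j \<omega>))" for \<omega>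
    by (simp add: power2_norm_eq_inner inner_sum_left inner_sum_right sum_distrib_left mult.assoc)
      (subst sum.swap, simp add: inner_commute mult.left_commute)
  show "integrable M (\<lambda>\<omega>. (norm (\<Sum>i<n. b i *\<^sub>R D i \<omega>))\<^sup>2)"
    unfolding eq by (intro Bochner_Integration.integrable_sum integrable_mult_right all) auto
  have "expectation (\<lambda>\<omega>. (norm (\<Sum>i<n. b i *\<^sub>R D i \<omega>))\<^sup>2) = (\<Sum>i<n. \<Sum>j<n. b i * b j * expectation (\<lambda>\<omega>. D i \<omega> \<bullet> D j \<omega>))"
    unfolding eq
    by (subst Bochner_Integration.integral_sum, use all in force)
      (intro sum.cong refl, subst Bochner_Integration.integral_sum, use all in force, simp)
  also have "\<dots> = (\<Sum>i<n. \<Sum>j<n. if j = i then (b i)\<^sup>2 * expectation (\<lambda>\<omega>. (norm (D i \<omega>))\<^sup>2) else 0)"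
    using off by (intro sum.cong refl) (auto simp: power2_norm_eq_inner power2_eq_square[of "b _"])
  also have "\<dots> = (\<Sum>i<n. (b i)\<^sup>2 * expectation (\<lambda>\<omega>. (norm (D i \<omega>))\<^sup>2))"
    by (simp add: sum.delta)
  finally show "expectation (\<lambda>\<omega>. (norm (\<Sum>i<n. b i *\<^sub>R D i \<omega>))\<^sup>2) = (\<Sum>i<n. (b i)\<^sup>2 * expectation (\<lambda>\<omega>. (norm (D i \<omega>))\<^sup>2))" .
qed

text \<open>The variance of \<open>norm (Y \<omega>)\<close> is nonnegative.\<close>

lemma (in prob_space) expectation_norm_le_sqrt:
  fixes Y :: "'a \<Rightarrow> 'b::{banach, second_countable_topology}"
  assumes [measurable]: "Y \<in> borel_measurable M" and sq: "integrable M (\<lambda>\<omega>. (norm (Y \<omega>))\<^sup>2)"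
  shows "integrable M (\<lambda>\<omega>. norm (Y \<omega>))" "expectation (\<lambda>\<omega>. norm (Y \<omega>)) \<le> sqrt (expectation (\<lambda>\<omega>. (norm (Y \<omega>))\<^sup>2))"
proof -
  show int: "integrable M (\<lambda>\<omega>. norm (Y \<omega>))"
  proof (rule Bochner_Integration.integrable_bound)
    show "integrable M (\<lambda>\<omega>. 1 + (norm (Y \<omega>))\<^sup>2)" using sq by simp
    have "norm (Y \<omega>) \<le> 1 + (norm (Y \<omega>))\<^sup>2" for \<omega>
    proof -
      have "2 * norm (Y \<omega>) \<le> 1 + (norm (Y \<omega>))\<^sup>2"
        using zero_le_power2[of "norm (Y \<omega>) - 1"] by (simp add: power2_eq_square algebra_simps)
      with norm_ge_zero[of "Y \<omega>"] show ?thesis by linarith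
    qed
    then show "AE \<omega> in M. norm (norm (Y \<omega>)) \<le> norm (1 + (norm (Y \<omega>))\<^sup>2)"
      by (intro AE_I2) (simp add: abs_of_nonneg)
  qed measurable
  have "0 \<le> variance (\<lambda>\<omega>. norm (Y \<omega>))" by (intro integral_nonneg_AE) simp
  also have "\<dots> = expectation (\<lambda>\<omega>. (norm (Y \<omega>))\<^sup>2) - (expectation (\<lambda>\<omega>. norm (Y \<omega>)))\<^sup>2"
    by (rule variance_eq[OF int sq])
  finally show "expectation (\<lambda>\<omega>. norm (Y \<omega>)) \<le> sqrt (expectation (\<lambda>\<omega>. (norm (Y \<omega>))\<^sup>2))"
    by (intro real_le_rsqrt) simp
qed

text \<open>Each coarse increment telescopes into \<open>b\<close> fine ones, and
  \<open>i div b\<close> is the coarse cell containing the fine cell \<open>i\<close>. This carries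
  Riemann sums over different grids to a common refinement.\<close>

lemma sum_increments_refine:
  fixes V :: "nat \<Rightarrow> 'a::real_vector"
  assumes "b > 0"
  shows "(\<Sum>j<a. f j *\<^sub>R (V (Suc j * b) - V (j * b))) = (\<Sum>i<a * b. f (i div b) *\<^sub>R (V (Suc i) - V i))"
proof -
  have "f j *\<^sub>R (V (Suc j * b) - V (j * b)) = (\<Sum>i=j * b..<j * b + b. f (i div b) *\<^sub>R (V (Suc i) - V i))" for j
  proof -
    have "(\<Sum>i=j * b..<j * b + b. f (i div b) *\<^sub>R (V (Suc i) - V i)) = (\<Sum>i=j * b..<j * b + b. f j *\<^sub>R (V (Suc i) - V i))"
    proof (intro sum.cong refl)
      fix i assume "i \<in> {j * b..<j * b + b}"
      then have "i div b = j" using assms by (intro div_nat_eqI) (auto simp: mult.commute)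
      then show "f (i div b) *\<^sub>R (V (Suc i) - V i) = f j *\<^sub>R (V (Suc i) - V i)" by simp
    qed
    also have "\<dots> = f j *\<^sub>R (V (j * b + b) - V (j * b))"
      by (subst scaleR_sum_right[symmetric], subst sum_Suc_diff') auto
    finally show ?thesis by (simp add: add.commute)
  qed
  then show ?thesis by (simp add: sum.nat_group)
qed

text \<open>A Fatou lemma for convergence in probability. Such convergence does not control means of
  unbounded variables, so the distance is truncated at level \<open>r\<close>; the bound
  \<open>c\<close>, uniform in \<open>r\<close>, survives the removal of the truncation by monotone
  convergence.\<close>

lemma (in prob_space) expectation_dist_le_of_tendsto_prob:
  fixes A N :: "'a \<Rightarrow> 'b::euclidean_space" and Y :: "nat \<Rightarrow> 'a \<Rightarrow> 'b"
  assumes [measurable]: "A \<in> borel_measurable M" "N \<in> borel_measurable M" "\<And>m. Y m \<in> borel_measurable M"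
    and lim: "\<And>\<epsilon>. \<epsilon> > 0 \<Longrightarrow> (\<lambda>m. measure M {\<omega>\<in>space M. \<epsilon> < dist (Y m \<omega>) (N \<omega>)}) \<longlonglongrightarrow> 0"
    and int: "\<And>m. m \<ge> m0 \<Longrightarrow> integrable M (\<lambda>\<omega>. norm (A \<omega> - Y m \<omega>))"
    and bd: "\<And>m. m \<ge> m0 \<Longrightarrow> expectation (\<lambda>\<omega>. norm (A \<omega> - Y m \<omega>)) \<le> c"
  shows "integrable M (\<lambda>\<omega>. norm (A \<omega> - N \<omega>))" "expectation (\<lambda>\<omega>. norm (A \<omega> - N \<omega>)) \<le> c"
proof -
  define R where "R r \<omega> = min (real r) (norm (A \<omega> - N \<omega>))" for r \<omega>
  have [measurable]: "R r \<in> borel_measurable M" for r unfolding R_def by measurable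
  have Rint: "integrable M (R r)" for r
    by (rule integrable_const_bound[where B="real r"]) (auto simp: R_def)
  have Rle: "expectation (R r) \<le> c" for r
  proof (rule field_le_epsilon)
    fix \<epsilon> :: real assume \<epsilon>: "\<epsilon> > 0"
    \<comment> \<open>Outside the exceptional event \<open>Y m\<close> is within
      \<open>\<epsilon> / 2\<close> of \<open>N\<close>; on it the truncated distance is at most
      \<open>r\<close>, while its probability tends to 0.\<close>
    have "(\<lambda>m. c + \<epsilon> / 2 + real r * measure M {\<omega>\<in>space M. \<epsilon> / 2 < dist (Y m \<omega>) (N \<omega>)}) \<longlonglongrightarrow> c + \<epsilon> / 2 + real r * 0"
      using \<epsilon> by (intro tendsto_intros lim) simp
    moreover have "\<exists>m0. \<forall>m\<ge>m0. expectation (R r) \<le> c + \<epsilon> / 2 + real r * measure M {\<omega>\<in>space M. \<epsilon> / 2 < dist (Y m \<omega>) (N \<omega>)}"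
    proof (intro exI allI impI)
      fix m assume m: "m \<ge> m0"
      let ?S = "{\<omega>\<in>space M. \<epsilon> / 2 < dist (Y m \<omega>) (N \<omega>)}"
      have S [measurable]: "?S \<in> sets M" by measurable
      have "expectation (R r) \<le> expectation (\<lambda>\<omega>. norm (A \<omega> - Y m \<omega>) + (\<epsilon> / 2 + real r * indicator ?S \<omega>))"
      proof (rule integral_mono[OF Rint])
        show "integrable M (\<lambda>\<omega>. norm (A \<omega> - Y m \<omega>) + (\<epsilon> / 2 + real r * indicator ?S \<omega>))"
          using int[OF m] by (intro Bochner_Integration.integrable_add integrable_mult_right) (auto simp: integrable_indicator_iff less_top[symmetric])
        fix \<omega> assume \<omega>: "\<omega> \<in> space M"
        have "norm (A \<omega> - N \<omega>) \<le> norm (A \<omega> - Y m \<omega>) + dist (Y m \<omega>) (N \<omega>)"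
          using dist_triangle[of "A \<omega>" "N \<omega>" "Y m \<omega>"] by (simp add: dist_norm)
        then show "R r \<omega> \<le> norm (A \<omega> - Y m \<omega>) + (\<epsilon> / 2 + real r * indicator ?S \<omega>)"
        proof (cases "\<omega> \<in> ?S")
          case True
          have "min (real r) (norm (A \<omega> - N \<omega>)) \<le> real r" by simp
          then show ?thesis
            using True \<epsilon> norm_ge_zero[of "A \<omega> - Y m \<omega>"] unfolding R_def indicator_eq_1_iff[THEN iffD2, OF True] by linarith
        next
          case False
          then show ?thesis using \<open>_ \<le> _ + dist _ _\<close> \<omega> by (auto simp: R_def min_def)
        qed
      qed
      also have "\<dots> = expectation (\<lambda>\<omega>. norm (A \<omega> - Y m \<omega>)) + (\<epsilon> / 2 + real r * measure M ?S)"
        using int[OF m] by (subst Bochner_Integration.integral_add) (auto simp: integrable_indicator_iff less_top[symmetric] prob_space)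
      also have "\<dots> \<le> c + \<epsilon> / 2 + real r * measure M ?S" using bd[OF m] by simp
      finally show "expectation (R r) \<le> c + \<epsilon> / 2 + real r * measure M ?S" .
    qed
    ultimately have "expectation (R r) \<le> c + \<epsilon> / 2 + real r * 0"
      by (rule LIMSEQ_le_const)
    then show "expectation (R r) \<le> c + \<epsilon>" using \<epsilon> by simp
  qed
  have c0: "c \<ge> 0" 
  proof -
    have "R 0 = (\<lambda>_. 0)" by (auto simp: R_def fun_eq_iff)
    then show ?thesis using Rle[of 0] by simp
  qed
  have "(\<integral>\<^sup>+\<omega>. ennreal (norm (A \<omega> - N \<omega>)) \<partial>M) = (\<integral>\<^sup>+\<omega>. (SUP r. ennreal (R r \<omega>)) \<partial>M)"
  proof (rule nn_integral_cong)
    fix \<omega>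
    obtain r0 :: nat where r0: "norm (A \<omega> - N \<omega>) \<le> real r0" using real_arch_simple by blast
    show "ennreal (norm (A \<omega> - N \<omega>)) = (SUP r. ennreal (R r \<omega>))"
    proof (rule antisym)
      have "ennreal (norm (A \<omega> - N \<omega>)) = ennreal (R r0 \<omega>)" using r0 by (simp add: R_def min_def)
      then show "ennreal (norm (A \<omega> - N \<omega>)) \<le> (SUP r. ennreal (R r \<omega>))" by (metis SUP_upper UNIV_I)
      show "(SUP r. ennreal (R r \<omega>)) \<le> ennreal (norm (A \<omega> - N \<omega>))"
        by (intro SUP_least ennreal_leI) (simp add: R_def)
    qed
  qed
  also have "\<dots> = (SUP r. (\<integral>\<^sup>+\<omega>. ennreal (R r \<omega>) \<partial>M))"
    by (rule nn_integral_monotone_convergence_SUP) (auto simp: incseq_def le_fun_def R_def intro!: ennreal_leI)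
  also have "\<dots> \<le> ennreal c"
  proof (rule SUP_least)
    fix r
    have "(\<integral>\<^sup>+\<omega>. ennreal (R r \<omega>) \<partial>M) = ennreal (expectation (R r))"
      by (rule nn_integral_eq_integral[OF Rint]) (simp add: R_def)
    then show "(\<integral>\<^sup>+\<omega>. ennreal (R r \<omega>) \<partial>M) \<le> ennreal c" using Rle by (simp add: ennreal_leI)
  qed
  finally have *: "(\<integral>\<^sup>+\<omega>. ennreal (norm (A \<omega> - N \<omega>)) \<partial>M) \<le> ennreal c" .
  show int: "integrable M (\<lambda>\<omega>. norm (A \<omega> - N \<omega>))"
    by (rule integrableI_nonneg) (use * in \<open>auto intro: le_less_trans\<close>)
  have "ennreal (expectation (\<lambda>\<omega>. norm (A \<omega> - N \<omega>))) \<le> ennreal c"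
    using * by (subst (asm) nn_integral_eq_integral[OF int]) auto
  then show "expectation (\<lambda>\<omega>. norm (A \<omega> - N \<omega>)) \<le> c" using c0 by simp
qed

text \<open>By induction \<open>\<xi> i\<close> is a measurable function of the initial value and
  the first \<open>i\<close> increments, that is, of the block \<open>A i\<close>. That block is
  independent of the next increment, since disjoint blocks of independent variables are
  independent.\<close>

lemma (in prob_space) indep_var_recursion:
  fixes V :: "nat option \<Rightarrow> 'a \<Rightarrow> 'b::second_countable_topology"
  assumes ind: "indep_vars (\<lambda>_. borel) V (insert None (Some ` {..<n}))"
    and G [measurable]: "\<And>i. G i \<in> borel_measurable (borel \<Otimes>\<^sub>M borel)"
    and \<xi>0: "\<And>\<omega>. \<xi> 0 \<omega> = V None \<omega>"
    and \<xi>: "\<And>i \<omega>. i < n \<Longrightarrow> \<xi> (Suc i) \<omega> = G i (\<xi> i \<omega>, V (Some i) \<omega>)"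
    and j: "j < n"
  shows "indep_var borel (\<xi> j) borel (V (Some j))"
proof -
  define A where "A j = insert None (Some ` {..<j})" for j :: nat
  have "\<exists>F. F \<in> borel_measurable (PiM (A i) (\<lambda>_. borel)) \<and> (\<forall>\<omega>. \<xi> i \<omega> = F (restrict (\<lambda>k. V k \<omega>) (A i)))" if "i \<le> n" for i
    using that
  proof (induction i)
    case 0
    show ?case
      by (rule exI[of _ "\<lambda>f. f None"]) (auto simp: A_def \<xi>0)
  next
    case (Suc i)
    then obtain F where F [measurable]: "F \<in> borel_measurable (PiM (A i) (\<lambda>_. borel))"
      and eq: "\<And>\<omega>. \<xi> i \<omega> = F (restrict (\<lambda>k. V k \<omega>) (A i))" using Suc_leD by blast
    have sub: "A i \<subseteq> A (Suc i)" by (auto simp: A_def)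
    have [measurable]: "(\<lambda>f. restrict f (A i)) \<in> measurable (PiM (A (Suc i)) (\<lambda>_. borel :: 'b measure)) (PiM (A i) (\<lambda>_. borel))"
      by (rule measurable_restrict_subset[OF sub])
    have [measurable]: "(\<lambda>f. f (Some i)) \<in> borel_measurable (PiM (A (Suc i)) (\<lambda>_. borel :: 'b measure))"
      by (rule measurable_component_singleton) (auto simp: A_def)
    show ?case
    proof (intro exI conjI allI)
      show "(\<lambda>f. G i (F (restrict f (A i)), f (Some i))) \<in> borel_measurable (PiM (A (Suc i)) (\<lambda>_. borel))"
        by measurable
      fix \<omega>
      have "restrict (restrict (\<lambda>k. V k \<omega>) (A (Suc i))) (A i) = restrict (\<lambda>k. V k \<omega>) (A i)"
        using sub by (auto simp: restrict_def fun_eq_iff)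
      then show "\<xi> (Suc i) \<omega> = G i (F (restrict (restrict (\<lambda>k. V k \<omega>) (A (Suc i))) (A i)), restrict (\<lambda>k. V k \<omega>) (A (Suc i)) (Some i))"
        using Suc by (simp add: \<xi> eq) (simp add: A_def)
    qed
  qed
  from this[of j] j obtain F where F: "F \<in> borel_measurable (PiM (A j) (\<lambda>_. borel))"
    and eq: "\<And>\<omega>. \<xi> j \<omega> = F (restrict (\<lambda>k. V k \<omega>) (A j))" using less_imp_le by blast
  have "indep_var (PiM (A j) (\<lambda>_. borel)) (\<lambda>\<omega>. restrict (\<lambda>i. V i \<omega>) (A j)) (PiM {Some j} (\<lambda>_. borel)) (\<lambda>\<omega>. restrict (\<lambda>i. V i \<omega>) {Some j})"
    using j by (intro indep_var_restrict[OF ind]) (auto simp: A_def)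
  from indep_var_compose[OF this F, of "\<lambda>f. f (Some j)" borel] show ?thesis
    by (simp add: comp_def flip: eq)
qed

text \<open>\<open>N (h * real l)\<close> is known only as the limit of dyadic sums over
  \<open>{0..h * real l}\<close>, whose grid does not match that of \<open>S\<close>. On a common
  refinement the difference is a sum of independent centred increments whose coefficients are at
  most \<open>\<delta>\<close>, so its second moment is at most \<open>\<delta>\<^sup>2\<close>
  times \<open>T\<close> times a constant of the dimension. This bound passes to the limit.\<close>

lemma wiener_integral_riemann_error:
  fixes W N :: "real \<Rightarrow> 'a \<Rightarrow> real^'k"
  assumes BM: "brownian_motion M W" and N: "wiener_integral M W \<sigma> T N"
    and t: "0 < t" "t \<le> T" and l: "l \<le> 2 ^ n"
    and \<delta>: "\<And>r r'. r \<in> {0..T} \<Longrightarrow> r' \<in> {0..T} \<Longrightarrow> \<bar>r - r'\<bar> \<le> t / 2 ^ n \<Longrightarrow> \<bar>\<sigma> r - \<sigma> r'\<bar> \<le> \<delta>"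
  defines "h \<equiv> t / 2 ^ n"
  defines "S \<equiv> \<lambda>\<omega>. \<Sum>i<l. \<sigma> (h * real i) *\<^sub>R (W (h * real (Suc i)) \<omega> - W (h * real i) \<omega>)"
  shows "integrable M (\<lambda>\<omega>. norm (S \<omega> - N (h * real l) \<omega>))"
    and "(\<integral>\<omega>. norm (S \<omega> - N (h * real l) \<omega>) \<partial>M) \<le> \<delta> * sqrt (T * (\<integral>z. gauss_dens (0 :: real^'k) 1 z * (norm z)\<^sup>2 \<partial>lborel))"
proof -
  interpret prob_space M using BM by (simp add: brownian_motion_def)
  define K where "K = (\<integral>z. gauss_dens (0 :: real^'k) 1 z * (norm z)\<^sup>2 \<partial>lborel)"
  have K0: "K \<ge> 0" unfolding K_def by (intro integral_nonneg_AE) simp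
  have \<delta>0: "\<delta> \<ge> 0" using \<delta>[of 0 0] t by simp
  have h: "h > 0" using t by (simp add: h_def)
  have Wm: "W r \<in> borel_measurable M" if "r \<ge> 0" for r using BM that by (simp add: brownian_motion_def)
  have hl: "h * real l \<le> t"
  proof -
    have "h * real l \<le> h * 2 ^ n" using h l by (intro mult_left_mono) (auto simp: numeral_power_le_of_nat_cancel_iff of_nat_le_iff[symmetric] simp del: of_nat_le_iff)
    then show ?thesis by (simp add: h_def)
  qed
  have hl': "h * real l \<in> {0..T}" using hl h t by simp
  define Y where "Y m \<omega> = (\<Sum>i<2^m. \<sigma> (h * real l * real i / 2^m) *\<^sub>R
      (W (h * real l * real (Suc i) / 2^m) \<omega> - W (h * real l * real i / 2^m) \<omega>))" for m \<omega>
  have Nm: "N (h * real l) \<in> borel_measurable M" using N hl' by (simp add: wiener_integral_def)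
  have Sm: "S \<in> borel_measurable M"
    unfolding S_def using h by (intro borel_measurable_sum borel_measurable_scaleR borel_measurable_diff Wm) auto
  have Ym: "Y m \<in> borel_measurable M" for m
    unfolding Y_def using h by (intro borel_measurable_sum borel_measurable_scaleR borel_measurable_diff Wm) auto
  have lim: "(\<lambda>m. measure M {\<omega>\<in>space M. \<epsilon> < dist (Y m \<omega>) (N (h * real l) \<omega>)}) \<longlonglongrightarrow> 0" if "\<epsilon> > 0" for \<epsilon>
    using N hl' that unfolding wiener_integral_def Y_def by blast
  have E: "integrable M (\<lambda>\<omega>. norm (S \<omega> - Y m \<omega>)) \<and> expectation (\<lambda>\<omega>. norm (S \<omega> - Y m \<omega>)) \<le> \<delta> * sqrt (T * K)" if m: "m \<ge> n" for m
  proof (cases "l = 0")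
    case True
    then show ?thesis using K0 \<delta>0 t by (simp add: S_def Y_def)
  next
    case False
    \<comment> \<open>The common refinement has \<open>l * 2 ^ m\<close> cells of length
      \<open>\<theta>\<close>: a cell of \<open>S\<close> consists of \<open>2 ^ m\<close> of them,
      a cell of \<open>Y m\<close> of \<open>l\<close> of them.\<close>
    define \<theta> where "\<theta> = h / 2 ^ m"
    have \<theta>: "\<theta> > 0" using h by (simp add: \<theta>_def)
    define b where "b i = \<sigma> (\<theta> * 2 ^ m * real (i div 2 ^ m)) - \<sigma> (\<theta> * real l * real (i div l))" for i
    define D where "D i \<omega> = W (\<theta> * real (Suc i)) \<omega> - W (\<theta> * real i) \<omega>" for i \<omega>
    have S_eq: "S \<omega> = (\<Sum>i<l * 2^m. \<sigma> (\<theta> * 2 ^ m * real (i div 2 ^ m)) *\<^sub>R D i \<omega>)" for \<omega>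
      using sum_increments_refine[of "2^m" "\<lambda>j. \<sigma> (\<theta> * 2 ^ m * real j)" "\<lambda>i. W (\<theta> * real i) \<omega>" l]
      by (simp add: S_def D_def \<theta>_def ac_simps) (simp add: distrib_right[symmetric] add_divide_distrib distrib_left)
    have Y_eq: "Y m \<omega> = (\<Sum>i<l * 2^m. \<sigma> (\<theta> * real l * real (i div l)) *\<^sub>R D i \<omega>)" for \<omega>
      using sum_increments_refine[of l "\<lambda>j. \<sigma> (\<theta> * real l * real j)" "\<lambda>i. W (\<theta> * real i) \<omega>" "2^m"] False
      by (simp add: Y_def D_def \<theta>_def ac_simps) (simp add: ac_simps distrib_left)
    have diff: "S \<omega> - Y m \<omega> = (\<Sum>i<l * 2^m. b i *\<^sub>R D i \<omega>)" for \<omega>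
      unfolding S_eq Y_eq b_def by (simp add: sum_subtractf scaleR_left_diff_distrib)
    have b: "\<bar>b i\<bar> \<le> \<delta>" if i: "i < l * 2^m" for i
      unfolding b_def
    proof (rule \<delta>)
      have i1: "2 ^ m * (i div 2 ^ m) \<le> i" "i < 2 ^ m * (i div 2 ^ m) + 2 ^ m"
        using dividend_less_times_div[of "2 ^ m" i] by (simp_all add: add.commute)
      have i2: "l * (i div l) \<le> i" "i < l * (i div l) + l"
        using dividend_less_times_div[of l i] False by (simp_all add: add.commute)
      have l2: "l \<le> 2 ^ m" using l m by (meson one_le_numeral order_trans power_increasing)
      have up: "\<theta> * real i' \<le> T" if "i' \<le> i" for i'
      proof -
        have "\<theta> * real i' \<le> \<theta> * real (l * 2 ^ m)" using that i \<theta> by (intro mult_left_mono) (simp_all del: of_nat_mult)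
        also have "\<dots> = h * real l" by (simp add: \<theta>_def)
        finally show ?thesis using hl t by simp
      qed
      show "\<theta> * 2 ^ m * real (i div 2 ^ m) \<in> {0..T}" using up[OF i1(1)] \<theta> by (simp add: mult.assoc)
      show "\<theta> * real l * real (i div l) \<in> {0..T}" using up[OF i2(1)] \<theta> by (simp add: mult.assoc)
      \<comment> \<open>Both numbers round \<open>i\<close> down, to multiples of
        \<open>2 ^ m\<close> and of \<open>l\<close>. Since \<open>m \<ge> n\<close> gives
        \<open>l \<le> 2 ^ m\<close>, both lie within \<open>2 ^ m\<close> below \<open>i\<close>,
        so the two times at which \<open>\<sigma>\<close> is read differ by at most
        \<open>h\<close>.\<close>
      have "\<bar>real (2 ^ m * (i div 2 ^ m)) - real (l * (i div l))\<bar> \<le> real (2 ^ m)"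
        using i1 i2 l2 by linarith
      then have "\<theta> * \<bar>real (2 ^ m * (i div 2 ^ m)) - real (l * (i div l))\<bar> \<le> \<theta> * real (2 ^ m)"
        using \<theta> by (intro mult_left_mono) auto
      moreover have "\<theta> * 2 ^ m * real (i div 2 ^ m) - \<theta> * real l * real (i div l) =
          \<theta> * (real (2 ^ m * (i div 2 ^ m)) - real (l * (i div l)))"
        by (simp add: algebra_simps)
      ultimately show "\<bar>\<theta> * 2 ^ m * real (i div 2 ^ m) - \<theta> * real l * real (i div l)\<bar> \<le> t / 2 ^ n"
        using \<theta> unfolding h_def[symmetric] by (simp only: abs_mult abs_of_pos) (simp add: \<theta>_def)
    qed
    have ind: "indep_vars (\<lambda>_. borel) D {..<l * 2^m}"
    proof -
      have "\<forall>(ts::nat \<Rightarrow> real) n. 0 \<le> ts 0 \<and> (\<forall>i<n. ts i \<le> ts (Suc i)) \<longrightarrow>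
        indep_vars (\<lambda>_. borel) (\<lambda>i \<omega>. W (ts (Suc i)) \<omega> - W (ts i) \<omega>) {..<n}"
        using BM by (simp add: brownian_motion_def)
      from this[rule_format, of "\<lambda>i. \<theta> * real i" "l * 2^m"] \<theta> show ?thesis
        unfolding D_def[abs_def] by simp
    qed
    have dist: "distributed M lborel (D i) (\<lambda>y. ennreal (gauss_dens 0 \<theta> y))" for i
    proof -
      have "distributed M lborel (\<lambda>\<omega>. W (\<theta> * real (Suc i)) \<omega> - W (\<theta> * real i) \<omega>) (\<lambda>y. ennreal (gauss_dens 0 (\<theta> * real (Suc i) - \<theta> * real i) y))"
      proof -
        have "\<forall>u t. 0 \<le> u \<and> u < t \<longrightarrow> distributed M lborel (\<lambda>\<omega>. W t \<omega> - W u \<omega>) (\<lambda>y. ennreal (gauss_dens 0 (t - u) y))"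
          using BM by (simp add: brownian_motion_def)
        from this[rule_format, of "\<theta> * real i" "\<theta> * real (Suc i)"] show ?thesis using \<theta> by simp
      qed
      then show ?thesis unfolding D_def[abs_def] by (simp add: algebra_simps)
    qed
    note mom = distributed_gauss_moments[OF dist \<theta>]
    have sq: "integrable M (\<lambda>\<omega>. (norm (S \<omega> - Y m \<omega>))\<^sup>2)"
      unfolding diff by (rule expectation_norm_sum_indep(1)[OF ind]) (use mom in auto)
    have "expectation (\<lambda>\<omega>. (norm (S \<omega> - Y m \<omega>))\<^sup>2) = (\<Sum>i<l * 2^m. (b i)\<^sup>2 * (\<theta> * K))"
      unfolding diff K_def by (subst expectation_norm_sum_indep(2)[OF ind]) (use mom in auto)
    also have "\<dots> \<le> (\<Sum>i<l * 2^m. \<delta>\<^sup>2 * (\<theta> * K))"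
    proof (intro sum_mono mult_right_mono)
      fix i assume "i \<in> {..<l * 2^m}"
      then have "\<bar>b i\<bar> \<le> \<bar>\<delta>\<bar>" using b \<delta>0 by simp
      then show "(b i)\<^sup>2 \<le> \<delta>\<^sup>2" by (simp add: abs_le_square_iff)
    qed (use \<theta> K0 in simp)
    also have "\<dots> = \<delta>\<^sup>2 * ((h * real l) * K)" by (simp add: \<theta>_def)
    also have "\<dots> \<le> \<delta>\<^sup>2 * (T * K)" using hl t K0 by (intro mult_left_mono mult_right_mono) auto
    finally have le: "expectation (\<lambda>\<omega>. (norm (S \<omega> - Y m \<omega>))\<^sup>2) \<le> \<delta>\<^sup>2 * (T * K)" .
    have m': "(\<lambda>\<omega>. S \<omega> - Y m \<omega>) \<in> borel_measurable M" using Sm Ym by measurable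
    from expectation_norm_le_sqrt[OF m' sq] real_sqrt_le_mono[OF le] \<delta>0
    show ?thesis by (auto simp: real_sqrt_mult)
  qed
  show "integrable M (\<lambda>\<omega>. norm (S \<omega> - N (h * real l) \<omega>))"
    by (rule expectation_dist_le_of_tendsto_prob(1)[OF Sm Nm Ym lim, of n]) (use E in auto)
  show "expectation (\<lambda>\<omega>. norm (S \<omega> - N (h * real l) \<omega>)) \<le> \<delta> * sqrt (T * (\<integral>z. gauss_dens (0 :: real^'k) 1 z * (norm z)\<^sup>2 \<partial>lborel))"
    unfolding K_def[symmetric]
    by (rule expectation_dist_le_of_tendsto_prob(2)[OF Sm Nm Ym lim, of n]) (use E in auto)
qed

section \<open>Euler approximation of integral equations\<close>


text \<open>The Henstock--Kurzweil integral of a non-integrable function is 0 by convention, so continuity of a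
  solution needs an argument: beyond the supremum \<open>m\<close> of the times up to which the integrand is integrable,
  the solution would be a translate of the continuous noise, hence the integrand is continuous off \<open>m\<close>.\<close>

lemma integral_equation_continuous:
  fixes c :: "'b::euclidean_space \<Rightarrow> real \<Rightarrow> 'b" and x \<nu> :: "real \<Rightarrow> 'b"
  assumes T: "T \<ge> 0"
    and c: "continuous_on (UNIV \<times> {0..T}) (\<lambda>(y, t). c y t)"
    and B: "\<And>y t. t \<in> {0..T} \<Longrightarrow> norm (c y t) \<le> B"
    and \<nu>: "continuous_on {0..T} \<nu>"
    and x: "\<And>t. t \<in> {0..T} \<Longrightarrow> x t = x0 + integral {0..t} (\<lambda>r. c (x r) r) + \<nu> t"
  shows "(\<lambda>r. c (x r) r) integrable_on {0..T}" and "continuous_on {0..T} x"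
proof -
  let ?g = "\<lambda>r. c (x r) r"
  have comp: "continuous_on S ?g" if "S \<subseteq> {0..T}" "continuous_on S x" for S
  proof -
    have "continuous_on S (\<lambda>r. (\<lambda>(y, t). c y t) (x r, r))"
      using that by (intro continuous_on_compose2[OF c]) (auto intro!: continuous_intros)
    then show ?thesis by simp
  qed
  have cont: "continuous_on {0..t} x" if t: "t \<in> {0..T}" "?g integrable_on {0..t}" for t
  proof -
    have "continuous_on {0..t} (\<lambda>r. x0 + integral {0..r} ?g + \<nu> r)"
      using t \<nu> by (intro continuous_intros indefinite_integral_continuous_1)
        (auto elim: continuous_on_subset)
    then show ?thesis
      by (rule continuous_on_eq) (use t x in auto)
  qed
  define I where "I = {t \<in> {0..T}. ?g integrable_on {0..t}}"
  have I0: "0 \<in> I" using T integrable_on_refl[of ?g 0] by (auto simp: I_def)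
  have bdd: "bdd_above I" by (rule bdd_aboveI[of _ T]) (auto simp: I_def)
  define m where "m = Sup I"
  have m: "m \<in> {0..T}"
  proof -
    have "m \<le> T" unfolding m_def by (rule cSup_least) (use I0 in \<open>auto simp: I_def\<close>)
    with cSup_upper[OF I0 bdd] show ?thesis by (simp add: m_def)
  qed
  have below: "t \<in> I" if "0 \<le> t" "t < m" for t
  proof -
    have "I \<noteq> {}" using I0 by auto
    from less_cSupD[OF this that(2)[unfolded m_def]] obtain s where s: "s \<in> I" "t < s" by blast
    have "?g integrable_on {0..t}"
      by (rule integrable_on_subinterval[of ?g "{0..s}"]) (use s in \<open>auto simp: I_def\<close>)
    with s that show ?thesis unfolding I_def by simp
  qed
  have c1: "continuous_on {0..<m} x"
    unfolding continuous_on_eq_continuous_within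
  proof
    fix t assume t: "t \<in> {0..<m}"
    define s where "s = (t + m) / 2"
    have s: "t < s" "s < m" using t by (auto simp: s_def)
    then have "continuous_on {0..s} x" using below[of s] t by (intro cont) (auto simp: I_def)
    then have "continuous (at t within {0..s}) x" using s t by (auto simp: continuous_on_eq_continuous_within)
    moreover have "at t within {0..s} = at t within {0..<m}"
      using s t by (intro at_within_nhd[of t "{..<s}"]) auto
    ultimately show "continuous (at t within {0..<m}) x" by simp
  qed
  have c2: "continuous_on {m<..T} x"
  proof (rule continuous_on_eq)
    show "continuous_on {m<..T} (\<lambda>t. x0 + \<nu> t)"
      using \<nu> m by (intro continuous_intros) (auto elim: continuous_on_subset)
    fix t assume t: "t \<in> {m<..T}"
    then have "t \<notin> I" using cSup_upper[OF _ bdd, of t] by (auto simp: m_def)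
    then have "\<not> ?g integrable_on {0..t}" using t m by (auto simp: I_def)
    then show "x0 + \<nu> t = x t" using x[of t] t m by (simp add: not_integrable_integral)
  qed
  have piece: "?g integrable_on S"
    if S: "S \<subseteq> {0..T}" "S \<in> sets lebesgue" "(\<lambda>_. B) integrable_on S" "continuous_on S x" for S
  proof -
    have "?g absolutely_integrable_on S"
    proof (rule measurable_bounded_by_integrable_imp_absolutely_integrable[OF _ S(2,3)])
      show "?g \<in> borel_measurable (lebesgue_on S)"
        using S by (intro continuous_imp_measurable_on_sets_lebesgue comp)
    qed (use B S in auto)
    then show ?thesis by (rule set_lebesgue_integral_eq_integral)
  qed
  have "(\<lambda>_. B) integrable_on {0..<m}" "(\<lambda>_. B) integrable_on {m<..T}"
    by (rule integrable_spike_set[OF integrable_const_ivl[of B 0 m]]; rule negligible_subset[of "{m}"]; force)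
       (rule integrable_spike_set[OF integrable_const_ivl[of B m T]]; rule negligible_subset[of "{m}"]; force)
  then have "?g integrable_on {0..<m}" "?g integrable_on {m<..T}"
    using c1 c2 m by (auto intro!: piece)
  moreover have "{0..<m} \<inter> {m<..T} = {}" by auto
  ultimately have "?g integrable_on ({0..<m} \<union> {m<..T})"
    \<comment> \<open>The integrand is bounded and continuous on each side of \<open>m\<close>, so
      both pieces are integrable.\<close>
    by (intro integrable_Un) simp_all
  then show int: "?g integrable_on {0..T}"
    by (rule integrable_spike_set) (rule negligible_subset[of "{m}"], use m in auto)+
  show "continuous_on {0..T} x" using cont[of T] int T by simp
qed

text \<open>A discrete Gronwall argument for one path. \<open>Z i\<close> is the mismatch between
  summed and exact noise at grid point \<open>i\<close>, and \<open>\<epsilon>\<close> is a modulus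
  of the drift along the exact solution, not along the scheme.\<close>

lemma euler_error:
  fixes c :: "'b::euclidean_space \<Rightarrow> real \<Rightarrow> 'b" and x \<nu> :: "real \<Rightarrow> 'b" and \<xi> d :: "nat \<Rightarrow> 'b"
  assumes h: "h > 0" "h * real n \<le> T" and L: "L \<ge> 0"
    and Lip: "\<And>y y' t. t \<in> {0..T} \<Longrightarrow> norm (c y t - c y' t) \<le> L * norm (y - y')"
    and int: "(\<lambda>r. c (x r) r) integrable_on {0..T}"
    and x: "\<And>t. t \<in> {0..T} \<Longrightarrow> x t = \<xi> 0 + integral {0..t} (\<lambda>r. c (x r) r) + \<nu> t"
    and \<xi>: "\<And>i. i < n \<Longrightarrow> \<xi> (Suc i) = \<xi> i + h *\<^sub>R c (\<xi> i) (h * real i) + d i"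
    and \<epsilon>: "\<And>r r'. r \<in> {0..T} \<Longrightarrow> r' \<in> {0..T} \<Longrightarrow> \<bar>r - r'\<bar> \<le> h \<Longrightarrow> norm (c (x r) r - c (x r') r') \<le> \<epsilon>"
  defines "Z \<equiv> \<lambda>i. norm ((\<Sum>l<i. d l) - \<nu> (h * real i))"
  shows "norm (\<xi> n - x (h * real n)) \<le> Z n + exp (L * h * real n) * (\<Sum>l<n. h * (L * Z l + \<epsilon>))"
proof -
  \<comment> \<open>Since the noise is additive, subtracting its mismatch leaves an error driven by
    the drift alone. No increment of the noise appears in the recursion for
    \<open>F\<close>.\<close>
  define F where "F i = (\<xi> i - x (h * real i)) - ((\<Sum>l<i. d l) - \<nu> (h * real i))" for i
  have T0: "T \<ge> 0" using h order_trans[OF mult_nonneg_nonneg[of h "real n"] h(2)] by simp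
  have \<epsilon>0: "\<epsilon> \<ge> 0" using \<epsilon>[of 0 0] T0 h by simp
  have in_T: "h * real i \<in> {0..T}" if "i \<le> n" for i
  proof -
    have "h * real i \<le> h * real n" using that h by (intro mult_left_mono) auto
    from order_trans[OF this h(2)] show ?thesis using h by simp
  qed
  have \<xi>x: "norm (\<xi> i - x (h * real i)) \<le> norm (F i) + Z i" for i
    using norm_triangle_ineq[of "F i" "(\<Sum>l<i. d l) - \<nu> (h * real i)"] by (simp add: F_def Z_def)
  have main: "norm (F i) \<le> (1 + h * L) ^ i * (\<Sum>l<i. h * (L * Z l + \<epsilon>))" if "i \<le> n" for i
    using that
  proof (induction i)
    case 0
    have "x 0 = \<xi> 0 + \<nu> 0" using x[of 0] T0 by simp
    then show ?case by (simp add: F_def)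
  next
    case (Suc i)
    let ?a = "h * real i" and ?b = "h * real (Suc i)"
    have ab: "?a \<le> ?b" "?b - ?a = h" using h by (auto simp: algebra_simps)
    have int_ab: "(\<lambda>r. c (x r) r) integrable_on {?a..?b}"
      using int in_T[of i] in_T[of "Suc i"] Suc by (auto intro: integrable_on_subinterval)
    have "integral {0..?a} (\<lambda>r. c (x r) r) + integral {?a..?b} (\<lambda>r. c (x r) r) = integral {0..?b} (\<lambda>r. c (x r) r)"
      using in_T[of i] in_T[of "Suc i"] Suc ab
      by (intro Henstock_Kurzweil_Integration.integral_combine) (auto intro: integrable_on_subinterval[OF int])
    then have xs: "x ?b - x ?a = integral {?a..?b} (\<lambda>r. c (x r) r) + \<nu> ?b - \<nu> ?a"
      using x[OF in_T[of i]] x[OF in_T[of "Suc i"]] Suc by (simp add: algebra_simps)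
    \<comment> \<open>Local error of the left-endpoint rule for the drift along the exact
      solution.\<close>
    define R where "R = h *\<^sub>R c (x ?a) ?a - integral {?a..?b} (\<lambda>r. c (x r) r)"
    have R: "norm R \<le> h * \<epsilon>"
    proof -
      have "((\<lambda>r. c (x ?a) ?a) has_integral (?b - ?a) *\<^sub>R c (x ?a) ?a) {?a..?b}"
        using has_integral_const_real[of "c (x ?a) ?a" ?a ?b] ab by simp
      from has_integral_diff[OF this integrable_integral[OF int_ab]]
      have "((\<lambda>r. c (x ?a) ?a - c (x r) r) has_integral R) {?a..?b}" by (simp only: R_def ab(2))
      then have "norm R \<le> \<epsilon> * measure lborel {?a..?b}"
      proof (rule has_integral_bound_real[OF \<epsilon>0 finite.emptyI])
        fix r assume "r \<in> {?a..?b} - {}"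
        then have r: "r \<in> {?a..?b}" by simp
        show "norm (c (x ?a) ?a - c (x r) r) \<le> \<epsilon>"
        proof (rule \<epsilon>)
          have "0 \<le> ?a" "?b \<le> T" using in_T[of i] in_T[of "Suc i"] Suc(2) by simp_all
          then show "?a \<in> {0..T}" "r \<in> {0..T}" using r ab(1) by simp_all
          show "\<bar>?a - r\<bar> \<le> h" using r ab by simp
        qed
      qed
      then show ?thesis using ab by (simp add: mult.commute)
    qed
    have Fs: "F (Suc i) = F i + h *\<^sub>R (c (\<xi> i) ?a - c (x ?a) ?a) + R"
    proof -
      have "F (Suc i) - F i = (\<xi> (Suc i) - \<xi> i) - (x ?b - x ?a) - d i + (\<nu> ?b - \<nu> ?a)"
        by (simp add: F_def)
      then show ?thesis unfolding xs using \<xi>[of i] Suc by (simp add: R_def algebra_simps)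
    qed
    have "norm (h *\<^sub>R (c (\<xi> i) ?a - c (x ?a) ?a)) \<le> h * (L * (norm (F i) + Z i))"
    proof -
      have "norm (c (\<xi> i) ?a - c (x ?a) ?a) \<le> L * norm (\<xi> i - x ?a)"
        using in_T[of i] Suc by (intro Lip) auto
      also have "\<dots> \<le> L * (norm (F i) + Z i)" using L \<xi>x by (intro mult_left_mono) auto
      finally show ?thesis using h by (simp add: mult_left_mono)
    qed
    then have "norm (F (Suc i)) \<le> norm (F i) + h * (L * (norm (F i) + Z i)) + h * \<epsilon>"
      unfolding Fs using R norm_triangle_ineq[of "F i + h *\<^sub>R (c (\<xi> i) ?a - c (x ?a) ?a)" R]
        norm_triangle_ineq[of "F i" "h *\<^sub>R (c (\<xi> i) ?a - c (x ?a) ?a)"] by linarith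
    also have "\<dots> = (1 + h * L) * norm (F i) + h * (L * Z i + \<epsilon>)" by (simp add: algebra_simps)
    also have "\<dots> \<le> (1 + h * L) * ((1 + h * L) ^ i * (\<Sum>l<i. h * (L * Z l + \<epsilon>))) + (1 + h * L) ^ Suc i * (h * (L * Z i + \<epsilon>))"
    proof (rule add_mono)
      show "(1 + h * L) * norm (F i) \<le> (1 + h * L) * ((1 + h * L) ^ i * (\<Sum>l<i. h * (L * Z l + \<epsilon>)))"
        using Suc h L by (intro mult_left_mono) auto
      have "1 \<le> (1 + h * L) ^ Suc i" using h L by (intro one_le_power) simp
      moreover have "0 \<le> h * (L * Z i + \<epsilon>)" using h L \<epsilon>0 by (simp add: Z_def)
      ultimately show "h * (L * Z i + \<epsilon>) \<le> (1 + h * L) ^ Suc i * (h * (L * Z i + \<epsilon>))"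
        using mult_right_mono[of 1 "(1 + h * L) ^ Suc i" "h * (L * Z i + \<epsilon>)"] by simp
    qed
    also have "\<dots> = (1 + h * L) ^ Suc i * (\<Sum>l<Suc i. h * (L * Z l + \<epsilon>))"
      by (simp add: distrib_left mult.assoc)
    finally show ?case .
  qed
  have "(1 + h * L) ^ n \<le> exp (h * L) ^ n" using h L by (intro power_mono) auto
  also have "\<dots> = exp (L * h * real n)" by (simp add: exp_of_nat_mult[symmetric] ac_simps)
  finally have "(1 + h * L) ^ n * (\<Sum>l<n. h * (L * Z l + \<epsilon>)) \<le> exp (L * h * real n) * (\<Sum>l<n. h * (L * Z l + \<epsilon>))"
    using h L \<epsilon>0 by (intro mult_right_mono sum_nonneg) (auto simp: Z_def)
  with main[of n] \<xi>x[of n] show ?thesis by simp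
qed

text \<open>Bounds on first derivatives in the basis directions bound the operator norm of the
  derivative by their sum, and the mean value inequality gives a Lipschitz constant independent of
  \<open>t\<close>.\<close>

lemma smooth_bounded_lipschitz:
  fixes F :: "real \<Rightarrow> real^'k \<Rightarrow> real^'k"
  assumes smooth: "\<forall>t\<in>{0..T}. smooth_fun (F t)"
    and bd: "\<forall>es. \<exists>B. \<forall>t\<in>{0..T}. \<forall>y. norm (iter_pd es (F t) y) \<le> B"
  shows "\<exists>L\<ge>0. \<forall>t\<in>{0..T}. \<forall>y y'. norm (F t y - F t y') \<le> L * norm (y - y')"
proof -
  have "\<forall>e. \<exists>B. \<forall>t\<in>{0..T}. \<forall>y. norm (frechet_derivative (F t) (at y) e) \<le> B"
  proof
    fix e show "\<exists>B. \<forall>t\<in>{0..T}. \<forall>y. norm (frechet_derivative (F t) (at y) e) \<le> B"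
      using bd[rule_format, of "[e]"] by (simp add: pd_def)
  qed
  from choice[OF this] obtain B
    where B: "\<And>e t y. t \<in> {0..T} \<Longrightarrow> norm (frechet_derivative (F t) (at y) e) \<le> B e" by blast
  define L where "L = (\<Sum>e\<in>Basis. \<bar>B e\<bar>)"
  have L0: "L \<ge> 0" by (simp add: L_def sum_nonneg)
  have "norm (F t y - F t y') \<le> L * norm (y - y')" if t: "t \<in> {0..T}" for t y y'
  proof -
    have diff: "(F t has_derivative frechet_derivative (F t) (at y)) (at y)" for y
      
    proof -
      have "iter_pd [] (F t) differentiable (at y)" using smooth t unfolding smooth_fun_def by blast
      then show ?thesis by (simp add: frechet_derivative_works)
    qed
    have on: "onorm (frechet_derivative (F t) (at y)) \<le> L" for y
    proof (rule onorm_bound[OF L0])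
      fix v :: "real^'k"
      have lin: "linear (frechet_derivative (F t) (at y))" using diff has_derivative_linear by blast
      have "frechet_derivative (F t) (at y) v = (\<Sum>e\<in>Basis. (v \<bullet> e) *\<^sub>R frechet_derivative (F t) (at y) e)"
        by (subst euclidean_representation[of v, symmetric]) (simp add: linear_sum[OF lin] linear_scale[OF lin])
      also have "norm \<dots> \<le> (\<Sum>e\<in>Basis. \<bar>B e\<bar> * norm v)"
      proof (rule sum_norm_le)
        fix e :: "real^'k" assume e: "e \<in> Basis"
        have "norm (frechet_derivative (F t) (at y) e) \<le> \<bar>B e\<bar>" using B[OF t, of y e] by linarith
        then show "norm ((v \<bullet> e) *\<^sub>R frechet_derivative (F t) (at y) e) \<le> \<bar>B e\<bar> * norm v"
          using Basis_le_norm[OF e, of v] by (simp add: mult.commute mult_mono)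
      qed
      also have "\<dots> = L * norm v" by (simp add: L_def sum_distrib_right)
      finally show "norm (frechet_derivative (F t) (at y) v) \<le> L * norm v" .
    qed
    show ?thesis
      by (rule differentiable_bound[of UNIV]) (use diff on in auto)
  qed
  with L0 show ?thesis by blast
qed

section \<open>The limiting rate\<close>


text \<open>This is \<open>E[c \<cdot> \<nabla>log p] - E[\<bar>c\<bar>\<^sup>2] / (2 \<sigma>\<^sup>2)\<close> at time \<open>r\<close>, for \<open>p\<close> the density of \<open>N(x, w)\<close>.\<close>

definition girsanov_rate ::
  "(real^'k \<Rightarrow> real \<Rightarrow> real^'k) \<Rightarrow> (real \<Rightarrow> real) \<Rightarrow> real^'k \<Rightarrow> real \<Rightarrow> real \<Rightarrow> real" where
  "girsanov_rate c \<sigma> x w r =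
    (\<integral>y. gauss_dens x w y * (- c y r \<bullet> (y - x) / w - (norm (c y r))\<^sup>2 / (2 * (\<sigma> r)\<^sup>2)) \<partial>lborel)"

primrec euler ::
  "(real^'k \<Rightarrow> real \<Rightarrow> real^'k) \<Rightarrow> (real \<Rightarrow> real) \<Rightarrow> (real \<Rightarrow> 'a \<Rightarrow> real^'k) \<Rightarrow> ('a \<Rightarrow> real^'k) \<Rightarrow>
    real \<Rightarrow> nat \<Rightarrow> 'a \<Rightarrow> real^'k" where
  "euler c \<sigma> W Z h 0 \<omega> = Z \<omega>"
| "euler c \<sigma> W Z h (Suc i) \<omega> = euler c \<sigma> W Z h i \<omega> + h *\<^sub>R c (euler c \<sigma> W Z h i \<omega>) (h * real i)
    + \<sigma> (h * real i) *\<^sub>R (W (h * real (Suc i)) \<omega> - W (h * real i) \<omega>)"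

text \<open>For a drift that does not depend on space and without noise, the Euler scheme is the
  left Riemann sum; the Lipschitz constant is 0 and only the modulus term remains.\<close>

lemma riemann_sum_error:
  fixes f :: "real \<Rightarrow> 'b::euclidean_space"
  assumes h: "h > 0" "h * real n \<le> T" and f: "continuous_on {0..T} f"
    and \<epsilon>: "\<And>r r'. r \<in> {0..T} \<Longrightarrow> r' \<in> {0..T} \<Longrightarrow> \<bar>r - r'\<bar> \<le> h \<Longrightarrow> norm (f r - f r') \<le> \<epsilon>"
  shows "norm ((\<Sum>i<n. h *\<^sub>R f (h * real i)) - integral {0..h * real n} f) \<le> h * real n * \<epsilon>"
  using euler_error[of h n T 0 "\<lambda>_. f" "\<lambda>t. integral {0..t} f" "\<lambda>i. \<Sum>l<i. h *\<^sub>R f (h * real l)" "\<lambda>_. 0" "\<lambda>_. 0" \<epsilon>]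
    h \<epsilon> integrable_continuous_interval[OF f] by (simp add: ac_simps)

lemma dyadic_mesh_tendsto: "(\<lambda>n. t / 2 ^ n) \<longlonglongrightarrow> (0 :: real)"
  by (rule LIMSEQ_divide_realpow_zero) simp

lemma uniform_modulus_dyadic:
  fixes f :: "real \<Rightarrow> 'b::real_normed_vector"
  assumes f: "continuous_on {0..T} f" and e: "e > 0"
  shows "\<forall>\<^sub>F n in sequentially. \<forall>r\<in>{0..T}. \<forall>r'\<in>{0..T}. \<bar>r - r'\<bar> \<le> t / 2 ^ n \<longrightarrow> norm (f r - f r') \<le> e"
proof -
  have "uniformly_continuous_on {0..T} f"
    by (rule compact_uniformly_continuous[OF f]) simp
  then obtain d where d: "d > 0" "\<And>r r'. r \<in> {0..T} \<Longrightarrow> r' \<in> {0..T} \<Longrightarrow> dist r' r < d \<Longrightarrow> dist (f r') (f r) < e"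
    using e unfolding uniformly_continuous_on_def by metis
  have "\<forall>\<^sub>F n in sequentially. t / 2 ^ n < d"
    using order_tendstoD(2)[OF dyadic_mesh_tendsto d(1)] .
  then show ?thesis
  proof eventually_elim
    case (elim n)
    show ?case
    proof (intro ballI impI)
      fix r r' assume "r \<in> {0..T}" "r' \<in> {0..T}" "\<bar>r - r'\<bar> \<le> t / 2 ^ n"
      then show "norm (f r - f r') \<le> e"
        using d(2)[of r' r] elim by (force simp: dist_norm)
    qed
  qed
qed

text \<open>Quantitative form of the regularity assumptions. The lower bound \<open>s0\<close> makes
  the accumulated variance grow at least linearly, which measures how fast the bridge variance may
  degenerate near \<open>T\<close>.\<close>

locale bounded_drift =
  fixes T :: real and c :: "real^'k \<Rightarrow> real \<Rightarrow> real^'k" and \<sigma> :: "real \<Rightarrow> real" and B L s0 :: real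
  assumes T: "T > 0"
    and c_cont: "continuous_on (UNIV \<times> {0..T}) (\<lambda>(y, t). c y t)"
    and c_bd: "\<And>y t. t \<in> {0..T} \<Longrightarrow> norm (c y t) \<le> B"
    and L: "L \<ge> 0" and c_lip: "\<And>y y' t. t \<in> {0..T} \<Longrightarrow> norm (c y t - c y' t) \<le> L * norm (y - y')"
    and \<sigma>_cont: "continuous_on {0..T} \<sigma>" and s0: "s0 > 0" and \<sigma>_ge: "\<And>t. t \<in> {0..T} \<Longrightarrow> \<sigma> t \<ge> s0"
begin

lemma B_nonneg: "B \<ge> 0"
  using c_bd[of 0 0] T norm_ge_zero[of "c 0 0"] by (simp del: norm_ge_zero)

lemma \<sigma>_pos: "t \<in> {0..T} \<Longrightarrow> \<sigma> t > 0"
  using \<sigma>_ge[of t] s0 by linarith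

lemma c_measurable: "r \<in> {0..T} \<Longrightarrow> (\<lambda>y. c y r) \<in> borel_measurable borel"
proof -
  assume r: "r \<in> {0..T}"
  have "continuous_on UNIV (\<lambda>y. (\<lambda>(y, t). c y t) (y, r))"
    by (rule continuous_on_compose2[OF c_cont]) (use r in \<open>auto intro!: continuous_intros\<close>)
  then show ?thesis by (intro borel_measurable_continuous_onI) simp
qed

text \<open>Variance of the noise accumulated up to \<open>t\<close>; \<open>V T - V r\<close> is
  the variance of the backward walk when it has come down from \<open>T\<close> to
  \<open>r\<close>.\<close>

definition V :: "real \<Rightarrow> real" where "V t = integral {0..t} (\<lambda>r. (\<sigma> r)\<^sup>2)"

lemma \<sigma>2_cont: "continuous_on {0..T} (\<lambda>r. (\<sigma> r)\<^sup>2)"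
  by (intro continuous_intros \<sigma>_cont)

lemma V_cont: "continuous_on {0..T} V"
  unfolding V_def by (intro indefinite_integral_continuous_1 integrable_continuous_interval \<sigma>2_cont)

lemma V_diff_ge:
  assumes "0 \<le> r" "r \<le> t" "t \<le> T"
  shows "V t - V r \<ge> s0\<^sup>2 * (t - r)"
proof -
  have i: "(\<lambda>r. (\<sigma> r)\<^sup>2) integrable_on {0..T}" by (intro integrable_continuous_interval \<sigma>2_cont)
  have i': "(\<lambda>r. (\<sigma> r)\<^sup>2) integrable_on {a..b}" if "0 \<le> a" "b \<le> T" for a b
    using i that by (auto intro: integrable_on_subinterval)
  have "V r + integral {r..t} (\<lambda>r. (\<sigma> r)\<^sup>2) = V t"
    unfolding V_def using assms by (intro Henstock_Kurzweil_Integration.integral_combine i') auto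
  moreover have "integral {r..t} (\<lambda>_. s0\<^sup>2) \<le> integral {r..t} (\<lambda>r. (\<sigma> r)\<^sup>2)"
    using assms s0 \<sigma>_ge by (intro integral_le i') (auto intro!: power_mono)
  ultimately show ?thesis using assms by (simp add: mult.commute)
qed

text \<open>With \<open>y - x\<close> equal to \<open>sqrt w\<close> times a standard variable, half
  a power of the singular factor \<open>1 / w\<close> is gained.\<close>

lemma girsanov_rate_standardize:
  assumes w: "w > 0" and r: "r \<in> {0..T}"
  shows "girsanov_rate c \<sigma> x w r = (\<integral>z. gauss_dens 0 1 z *
    (- c (x + sqrt w *\<^sub>R z) r \<bullet> z / sqrt w - (norm (c (x + sqrt w *\<^sub>R z) r))\<^sup>2 / (2 * (\<sigma> r)\<^sup>2)) \<partial>lborel)"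
proof -
  have [measurable]: "(\<lambda>y. c y r) \<in> borel_measurable borel" by (rule c_measurable[OF r])
  have "sqrt w / w = 1 / sqrt w" using w by (simp add: field_simps)
  then have "a \<bullet> (sqrt w *\<^sub>R z) / w = a \<bullet> z / sqrt w" for a z :: "real^'k"
    by (metis inner_scaleR_right mult.commute mult_1 times_divide_eq_left)
  then show ?thesis
    unfolding girsanov_rate_def
    using integral_gauss_dens_standardize[OF _ w, of "\<lambda>y. - c y r \<bullet> (y - x) / w - (norm (c y r))\<^sup>2 / (2 * (\<sigma> r)\<^sup>2)" x]
    by simp
qed

lemma girsanov_rate_integrand_bound:
  assumes a: "a > 0" "a \<le> w" and r: "r \<in> {0..T}"
  shows "norm (gauss_dens 0 1 z * (- c y r \<bullet> z / sqrt w - (norm (c y r))\<^sup>2 / (2 * (\<sigma> r)\<^sup>2)))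
    \<le> (B / sqrt a) * (gauss_dens 0 1 z * norm z) + B\<^sup>2 / (2 * s0\<^sup>2) * gauss_dens 0 1 z"
proof -
  have "\<bar>c y r \<bullet> z / sqrt w\<bar> \<le> B * norm z / sqrt a"
  proof -
    have "\<bar>c y r \<bullet> z\<bar> \<le> B * norm z"
      using Cauchy_Schwarz_ineq2[of "c y r" z] mult_right_mono[OF c_bd[OF r, of y] norm_ge_zero[of z]] by linarith
    then show ?thesis using a B_nonneg by (simp add: abs_divide frac_le)
  qed
  moreover have "(norm (c y r))\<^sup>2 / (2 * (\<sigma> r)\<^sup>2) \<le> B\<^sup>2 / (2 * s0\<^sup>2)"
    using c_bd[OF r, of y] \<sigma>_ge[OF r] s0 by (intro frac_le) (auto intro!: power_mono)
  moreover have "0 \<le> (norm (c y r))\<^sup>2 / (2 * (\<sigma> r)\<^sup>2)" by simp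
  ultimately have "\<bar>- c y r \<bullet> z / sqrt w - (norm (c y r))\<^sup>2 / (2 * (\<sigma> r)\<^sup>2)\<bar> \<le> B * norm z / sqrt a + B\<^sup>2 / (2 * s0\<^sup>2)"
    using abs_triangle_ineq4[of "- c y r \<bullet> z / sqrt w" "(norm (c y r))\<^sup>2 / (2 * (\<sigma> r)\<^sup>2)"] by simp
  from mult_left_mono[OF this gauss_dens_nonneg[of 0 1 z]] show ?thesis
    by (simp only: real_norm_def abs_mult abs_of_nonneg[OF gauss_dens_nonneg]) (simp add: algebra_simps)
qed

lemma integrable_rate_bound:
  "integrable lborel (\<lambda>z :: real^'k. C1 * (gauss_dens 0 1 z * norm z) + C2 * gauss_dens 0 1 z)"
  using integrable_gauss_dens_norm_power_std[where 'k='k and n=1] integrable_gauss_dens[of 1 "0 :: real^'k"] by simp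

definition K1 :: real where "K1 = (\<integral>z. gauss_dens (0 :: real^'k) 1 z * norm z \<partial>lborel)"

lemma girsanov_rate_bound:
  assumes w: "w > 0" and r: "r \<in> {0..T}"
  shows "\<bar>girsanov_rate c \<sigma> x w r\<bar> \<le> B * K1 / sqrt w + B\<^sup>2 / (2 * s0\<^sup>2)"
proof -
  let ?g = "\<lambda>z. (B / sqrt w) * (gauss_dens (0 :: real^'k) 1 z * norm z) + B\<^sup>2 / (2 * s0\<^sup>2) * gauss_dens 0 1 z"
  have "\<bar>girsanov_rate c \<sigma> x w r\<bar> \<le> (\<integral>z. ?g z \<partial>lborel)"
    unfolding girsanov_rate_standardize[OF w r]
    unfolding real_norm_def[symmetric]
    by (rule order_trans[OF integral_norm_bound])
      (intro integral_mono' integrable_rate_bound girsanov_rate_integrand_bound[OF w order_refl r],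
       use B_nonneg s0 w in simp)
  also have "\<dots> = B * K1 / sqrt w + B\<^sup>2 / (2 * s0\<^sup>2)"
    using integrable_gauss_dens_norm_power_std[where 'k='k and n=1] integrable_gauss_dens[of 1 "0 :: real^'k"] integral_gauss_dens[of 1 "0 :: real^'k"]
    by (subst Bochner_Integration.integral_add) (auto simp: K1_def)
  finally show ?thesis .
qed

text \<open>Dominated convergence in standardized form: for all variances above \<open>a\<close> one
  integrable function dominates. Continuity in both variables jointly is what later permits
  perturbing the variance in the Riemann sums.\<close>

lemma girsanov_rate_continuous:
  assumes a: "a > 0"
  shows "continuous_on ({a..b} \<times> {0..T}) (\<lambda>(w, r). girsanov_rate c \<sigma> x w r)"
  unfolding continuous_on_sequentially
proof (intro allI ballI impI, elim conjE)
  fix p :: "nat \<Rightarrow> real \<times> real" and q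
  assume q: "q \<in> {a..b} \<times> {0..T}" and p: "\<forall>n. p n \<in> {a..b} \<times> {0..T}" and lim: "p \<longlonglongrightarrow> q"
  define w r where "w n = fst (p n)" and "r n = snd (p n)" for n
  define w' r' where "w' = fst q" and "r' = snd q"
  have pw: "w n \<ge> a" "w n > 0" "r n \<in> {0..T}" for n using p[rule_format, of n] a by (auto simp: w_def r_def)
  have qw: "w' \<ge> a" "w' > 0" "r' \<in> {0..T}" using q a by (auto simp: w'_def r'_def)
  have lw: "w \<longlonglongrightarrow> w'" and lr: "r \<longlonglongrightarrow> r'"
    using tendsto_fst[OF lim] tendsto_snd[OF lim] by (auto simp: w_def[abs_def] r_def[abs_def] w'_def r'_def)
  have ls: "(\<lambda>n. sqrt (w n)) \<longlonglongrightarrow> sqrt w'" using lw by (intro tendsto_intros)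
  have l\<sigma>: "(\<lambda>n. \<sigma> (r n)) \<longlonglongrightarrow> \<sigma> r'"
    by (rule continuous_on_tendsto_compose[OF \<sigma>_cont lr]) (use pw qw in auto)
  define F where "F w r z = gauss_dens 0 1 z *
    (- c (x + sqrt w *\<^sub>R z) r \<bullet> z / sqrt w - (norm (c (x + sqrt w *\<^sub>R z) r))\<^sup>2 / (2 * (\<sigma> r)\<^sup>2))" for w r z
  have Fm: "F w r \<in> borel_measurable lborel" if "r \<in> {0..T}" for w r
  proof -
    have [measurable]: "(\<lambda>y. c y r) \<in> borel_measurable borel" by (rule c_measurable[OF that])
    have [measurable]: "(\<lambda>z. c (x + sqrt w *\<^sub>R z) r) \<in> borel_measurable borel"
      using measurable_compose[of "\<lambda>z. x + sqrt w *\<^sub>R z" borel borel "\<lambda>y. c y r"] by simp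
    show ?thesis unfolding F_def by measurable
  qed
  have "(\<lambda>n. \<integral>z. F (w n) (r n) z \<partial>lborel) \<longlonglongrightarrow> (\<integral>z. F w' r' z \<partial>lborel)"
  proof (rule integral_dominated_convergence[where w="\<lambda>z. (B / sqrt a) * (gauss_dens 0 1 z * norm z) + B\<^sup>2 / (2 * s0\<^sup>2) * gauss_dens 0 1 z"])
    show "F w' r' \<in> borel_measurable lborel" "\<And>n. F (w n) (r n) \<in> borel_measurable lborel"
      using Fm pw qw by auto
    show "integrable lborel (\<lambda>z :: real^'k. (B / sqrt a) * (gauss_dens 0 1 z * norm z) + B\<^sup>2 / (2 * s0\<^sup>2) * gauss_dens 0 1 z)"
      by (rule integrable_rate_bound)
    show "AE z in lborel. norm (F (w n) (r n) z) \<le> (B / sqrt a) * (gauss_dens 0 1 z * norm z) + B\<^sup>2 / (2 * s0\<^sup>2) * gauss_dens 0 1 z" for n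
      unfolding F_def using girsanov_rate_integrand_bound[OF a pw(1) pw(3)] by (intro AE_I2) auto
    show "AE z in lborel. (\<lambda>n. F (w n) (r n) z) \<longlonglongrightarrow> F w' r' z"
    proof (rule AE_I2)
      fix z :: "real^'k"
      have "(\<lambda>n. (\<lambda>(y, t). c y t) (x + sqrt (w n) *\<^sub>R z, r n)) \<longlonglongrightarrow> (\<lambda>(y, t). c y t) (x + sqrt w' *\<^sub>R z, r')"
        by (rule continuous_on_tendsto_compose[OF c_cont]) (use pw qw in \<open>auto intro!: tendsto_intros ls lr\<close>)
      then have lc: "(\<lambda>n. c (x + sqrt (w n) *\<^sub>R z) (r n)) \<longlonglongrightarrow> c (x + sqrt w' *\<^sub>R z) r'" by simp
      show "(\<lambda>n. F (w n) (r n) z) \<longlonglongrightarrow> F w' r' z"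
        unfolding F_def using qw \<sigma>_pos[OF qw(3)] by (intro tendsto_intros lc l\<sigma> ls) auto
    qed
  qed
  then show "((\<lambda>(w, r). girsanov_rate c \<sigma> x w r) \<circ> p) \<longlonglongrightarrow> (case q of (w, r) \<Rightarrow> girsanov_rate c \<sigma> x w r)"
    unfolding F_def comp_def case_prod_beta w_def[symmetric] r_def[symmetric] w'_def[symmetric] r'_def[symmetric]
    by (subst girsanov_rate_standardize[OF pw(2,3)], subst girsanov_rate_standardize[OF qw(2,3)])
qed

definition rate :: "real^'k \<Rightarrow> real \<Rightarrow> real" where
  "rate x r = girsanov_rate c \<sigma> x (V T - V r) r"

text \<open>On \<open>{0..t}\<close> the variance \<open>V T - V r\<close> stays above
  \<open>s0\<^sup>2 * (T - t)\<close>.\<close>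

lemma rate_continuous:
  assumes t: "0 \<le> t" "t < T"
  shows "continuous_on {0..t} (rate x)"
proof -
  define a where "a = s0\<^sup>2 * (T - t)"
  have a: "a > 0" using s0 t by (simp add: a_def)
  have Vc: "continuous_on {0..t} V" using V_cont t by (auto elim: continuous_on_subset)
  have rng: "V T - V r \<in> {a..V T}" if "r \<in> {0..t}" for r
  proof -
    have "s0\<^sup>2 * (T - t) \<le> s0\<^sup>2 * (T - r)" using that by (intro mult_left_mono) auto
    moreover have "V r \<ge> 0"
    proof -
      have "0 \<le> s0\<^sup>2 * (r - 0)" using that by simp
      also have "\<dots> \<le> V r - V 0" using that t by (intro V_diff_ge) auto
      finally show ?thesis by (simp add: V_def)
    qed
    moreover have "V T - V r \<ge> s0\<^sup>2 * (T - r)" using that t by (intro V_diff_ge) auto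
    ultimately show ?thesis by (simp add: a_def)
  qed
  have "(\<lambda>r. (V T - V r, r)) ` {0..t} \<subseteq> {a..V T} \<times> {0..T}"
  proof (rule image_subsetI)
    fix r assume "r \<in> {0..t}"
    with rng[OF this] t show "(V T - V r, r) \<in> {a..V T} \<times> {0..T}" by simp
  qed
  moreover have "continuous_on {0..t} (\<lambda>r. (V T - V r, r))"
    by (intro continuous_on_Pair continuous_on_diff continuous_on_const continuous_on_id Vc)
  ultimately have "continuous_on {0..t} (\<lambda>r. (\<lambda>(w, r). girsanov_rate c \<sigma> x w r) (V T - V r, r))"
    by (rule continuous_on_compose2[OF girsanov_rate_continuous[OF a], rotated])
  then show ?thesis by (simp add: rate_def[abs_def])
qed

end

section \<open>Passage to the limit along the Euler scheme\<close>


lemma tendsto_gauss_dens: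
  fixes f :: "nat \<Rightarrow> real^'k"
  assumes w: "w \<longlonglongrightarrow> w'" "\<And>n. w n > 0" "w' > 0" and f: "f \<longlonglongrightarrow> y"
  shows "(\<lambda>n. gauss_dens x (w n) (f n)) \<longlonglongrightarrow> gauss_dens x w' y"
  unfolding gauss_dens_exp[OF w(2)] gauss_dens_exp[OF w(3)]
  by (intro tendsto_intros w f) (use w in auto)

context bounded_drift
begin

text \<open>The chain bound with step drift \<open>h *\<^sub>R c\<close> and step variance
  \<open>h\<close> times \<open>\<sigma>\<close> squared. The variances \<open>w i\<close> are
  counted down from \<open>V T\<close> by a Riemann sum, so the Gaussian facing
  \<open>ln (q0 y)\<close> has variance exactly \<open>V T\<close> on every grid, and the
  discretisation error falls on the leftover variance \<open>w n\<close>.\<close>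

lemma euler_lower_bound:
  fixes W :: "real \<Rightarrow> 'a \<Rightarrow> real^'k" and X0 :: "'a \<Rightarrow> real^'k"
  assumes BM: "brownian_motion M W" and init: "indep_of_bm M X0 W"
    and X0: "distributed M lborel X0 (\<lambda>y. ennreal (q0 y))"
    and q0: "\<And>y. q0 y > 0" "q0 \<in> borel_measurable borel"
    and lnq0: "integrable lborel (\<lambda>y. ln (q0 y) * gauss_dens x (V T) y)"
    and h: "h > 0" "h * real n \<le> T"
  defines "w \<equiv> \<lambda>i. V T - (\<Sum>l<i. h * (\<sigma> (h * real l))\<^sup>2)"
  assumes wn: "w n > 0"
  shows "ennreal (exp ((\<integral>y. ln (q0 y) * gauss_dens x (V T) y \<partial>lborel) + (\<Sum>i<n. h * girsanov_rate c \<sigma> x (w i) (h * real i))))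
    \<le> (\<integral>\<^sup>+\<omega>. ennreal (gauss_dens x (w n) (euler c \<sigma> W X0 h n \<omega>)) \<partial>M)"
proof -
  interpret prob_space M using BM by (simp add: brownian_motion_def)
  have in_T: "h * real i \<in> {0..T}" if "i \<le> n" for i
  proof -
    have "h * real i \<le> h * real n" using that h by (intro mult_left_mono) auto
    from order_trans[OF this h(2)] show ?thesis using h by simp
  qed
  \<comment> \<open>Extended by zero beyond \<open>n\<close>, because measurability and the bound
    are asked for at every index while \<open>c\<close> is controlled only for times in
    \<open>{0..T}\<close>.\<close>
  define b where "b i = (if i < n then (\<lambda>y. h *\<^sub>R c y (h * real i)) else (\<lambda>_. 0))" for i
  have b [measurable]: "b i \<in> borel_measurable borel" for i
    using c_measurable[OF in_T[of i]] by (auto simp: b_def)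
  have bB: "norm (b i y) \<le> h * B" for i y
    using c_bd[OF in_T[of i], of y] h B_nonneg by (auto simp: b_def)
  define D where "D i \<omega> = W (h * real (Suc i)) \<omega> - W (h * real i) \<omega>" for i \<omega>
  define U where "U j \<omega> = (case j of None \<Rightarrow> X0 \<omega> | Some i \<Rightarrow> D i \<omega>)" for j \<omega>
  define \<xi> where "\<xi> = euler c \<sigma> W X0 h"
  have \<xi>s: "\<xi> (Suc i) \<omega> = \<xi> i \<omega> + b i (\<xi> i \<omega>) + \<sigma> (h * real i) *\<^sub>R D i \<omega>" if "i < n" for i \<omega>
    using that by (simp add: \<xi>_def b_def D_def)
  have indU: "indep_vars (\<lambda>_. borel) U (insert None (Some ` {..<n}))"
  proof -
    have "\<forall>(ts::nat \<Rightarrow> real) n. ts 0 = 0 \<and> (\<forall>i<n. ts i \<le> ts (Suc i)) \<longrightarrow>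
        indep_vars (\<lambda>_. borel)
          (\<lambda>j \<omega>. case j of None \<Rightarrow> X0 \<omega> | Some i \<Rightarrow> W (ts (Suc i)) \<omega> - W (ts i) \<omega>)
          (insert None (Some ` {..<n}))"
      using init by (simp add: indep_of_bm_def)
    from this[rule_format, of "\<lambda>i. h * real i" n] h show ?thesis
      unfolding U_def[abs_def] D_def by simp
  qed
  have ind: "indep_var borel (\<xi> i) borel (\<lambda>\<omega>. \<sigma> (h * real i) *\<^sub>R D i \<omega>)" if "i < n" for i
  proof -
    have "indep_var borel (\<xi> i) borel (U (Some i))"
      by (rule indep_var_recursion[OF indU, where G="\<lambda>i (y, z). y + b i y + \<sigma> (h * real i) *\<^sub>R z"])
        (use that \<xi>s in \<open>auto simp: U_def \<xi>_def\<close>)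
    from indep_var_compose[OF this, of "\<lambda>y. y" borel "\<lambda>z. \<sigma> (h * real i) *\<^sub>R z" borel] show ?thesis
      by (simp add: comp_def U_def)
  qed
  have dist: "distributed M lborel (\<lambda>\<omega>. \<sigma> (h * real i) *\<^sub>R D i \<omega>) (\<lambda>y. ennreal (gauss_dens 0 ((\<sigma> (h * real i))\<^sup>2 * h) y))" if "i < n" for i
  proof (rule distributed_gauss_scale)
    have "\<forall>u t. 0 \<le> u \<and> u < t \<longrightarrow> distributed M lborel (\<lambda>\<omega>. W t \<omega> - W u \<omega>) (\<lambda>y. ennreal (gauss_dens 0 (t - u) y))"
      using BM by (simp add: brownian_motion_def)
    from this[rule_format, of "h * real i" "h * real (Suc i)"] h
    show "distributed M lborel (D i) (\<lambda>y. ennreal (gauss_dens 0 h y))"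
      unfolding D_def[abs_def] by (simp add: distrib_left)
    show "\<sigma> (h * real i) \<noteq> 0" using \<sigma>_pos[OF in_T[of i]] that by simp
  qed (rule h)
  have w0: "w 0 = V T" by (simp add: w_def)
  have "ennreal (exp ((\<integral>y. ln (q0 y) * gauss_dens x (w 0) y \<partial>lborel) +
      (\<Sum>i<n. \<integral>y. gauss_dens x (w i) y * (- b i y \<bullet> (y - x) / w i - (norm (b i y))\<^sup>2 / (2 * ((\<sigma> (h * real i))\<^sup>2 * h))) \<partial>lborel)))
    \<le> (\<integral>\<^sup>+\<omega>. ennreal (gauss_dens x (w n) (\<xi> n \<omega>)) \<partial>M)"
  proof (rule gaussian_chain_lower_bound[where D="\<lambda>i \<omega>. \<sigma> (h * real i) *\<^sub>R D i \<omega>" and B="h * B"])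
    show "distributed M lborel (\<xi> 0) (\<lambda>y. ennreal (q0 y))" 
    proof -
      have "\<xi> 0 = X0" by (rule ext) (simp add: \<xi>_def)
      then show ?thesis using X0 by simp
    qed
    show "(\<sigma> (h * real i))\<^sup>2 * h > 0" if "i < n" for i using \<sigma>_pos[OF in_T[of i]] that h by simp
    show "w i = w (Suc i) + (\<sigma> (h * real i))\<^sup>2 * h" for i by (simp add: w_def)
  qed (use ind dist \<xi>s b bB wn q0 lnq0 w0 in auto)
  also have "(\<Sum>i<n. \<integral>y. gauss_dens x (w i) y * (- b i y \<bullet> (y - x) / w i - (norm (b i y))\<^sup>2 / (2 * ((\<sigma> (h * real i))\<^sup>2 * h))) \<partial>lborel)
      = (\<Sum>i<n. h * girsanov_rate c \<sigma> x (w i) (h * real i))"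
  proof (intro sum.cong refl)
    fix i assume "i \<in> {..<n}"
    then have i: "i < n" by simp
    have s: "\<sigma> (h * real i) > 0" using \<sigma>_pos[OF in_T[of i]] i by simp
    have "gauss_dens x (w i) y * (- b i y \<bullet> (y - x) / w i - (norm (b i y))\<^sup>2 / (2 * ((\<sigma> (h * real i))\<^sup>2 * h))) =
        h * (gauss_dens x (w i) y * (- c y (h * real i) \<bullet> (y - x) / w i - (norm (c y (h * real i)))\<^sup>2 / (2 * (\<sigma> (h * real i))\<^sup>2)))" for y
    proof -
      have "(norm (b i y))\<^sup>2 / (2 * ((\<sigma> (h * real i))\<^sup>2 * h)) = h * ((norm (c y (h * real i)))\<^sup>2 / (2 * (\<sigma> (h * real i))\<^sup>2))"
        using i h by (simp add: b_def power_mult_distrib power2_eq_square[of h])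
      moreover have "- b i y \<bullet> (y - x) / w i = h * (- c y (h * real i) \<bullet> (y - x) / w i)"
        using i by (simp add: b_def)
      ultimately show ?thesis by (simp only: right_diff_distrib[symmetric] mult.left_commute[of h])
    qed
    then show "(\<integral>y. gauss_dens x (w i) y * (- b i y \<bullet> (y - x) / w i - (norm (b i y))\<^sup>2 / (2 * ((\<sigma> (h * real i))\<^sup>2 * h))) \<partial>lborel)
      = h * girsanov_rate c \<sigma> x (w i) (h * real i)"
      unfolding girsanov_rate_def by (simp only: integral_mult_right_zero)
  qed
  finally show ?thesis unfolding w0 \<xi>_def .
qed

text \<open>The noise mismatch tends to 0 in mean, hence almost surely along a subsequence. This
  suffices for a limit in an inequality between expectations. On each such path the deterministic
  error bound applies.\<close>

lemma euler_converges:
  fixes W N X :: "real \<Rightarrow> 'a \<Rightarrow> real^'k"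
  assumes BM: "brownian_motion M W" and noise: "wiener_integral M W \<sigma> T N"
    and SDE: "AE \<omega> in M. \<forall>t\<in>{0..T}. X t \<omega> = X 0 \<omega> + integral {0..t} (\<lambda>r. c (X r \<omega>) r) + N t \<omega>"
    and t: "0 < t" "t \<le> T"
  shows "\<exists>r::nat \<Rightarrow> nat. strict_mono r \<and>
    (AE \<omega> in M. (\<lambda>n. euler c \<sigma> W (X 0) (t / 2 ^ r n) (2 ^ r n) \<omega>) \<longlonglongrightarrow> X t \<omega>)"
proof -
  define h where "h n = t / 2 ^ n" for n :: nat
  have h: "h n > 0" "h n * real (2 ^ n) = t" for n using t by (auto simp: h_def)
  define S where "S n i \<omega> = (\<Sum>l<i. \<sigma> (h n * real l) *\<^sub>R (W (h n * real (Suc l)) \<omega> - W (h n * real l) \<omega>))" for n i \<omega>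
  define Z where "Z n i \<omega> = norm (S n i \<omega> - N (h n * real i) \<omega>)" for n i \<omega>
  \<comment> \<open>Exactly the noise terms of the pathwise error bound: the mismatch at the
    endpoint and its sum over the grid weighted by the mesh.\<close>
  define Q where "Q n \<omega> = Z n (2 ^ n) \<omega> + h n * (\<Sum>i<2^n. Z n i \<omega>)" for n \<omega>
  define K where "K = sqrt (T * (\<integral>z. gauss_dens (0 :: real^'k) 1 z * (norm z)\<^sup>2 \<partial>lborel))"
  have K0: "K \<ge> 0" unfolding K_def using T by (intro real_sqrt_ge_zero mult_nonneg_nonneg integral_nonneg_AE) auto
  have Zint: "integrable M (Z n i)" if "i \<le> 2 ^ n" for n i
  proof -
    have "bounded (\<sigma> ` {0..T})" by (intro compact_imp_bounded compact_continuous_image \<sigma>_cont) simp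
    then obtain s1 where "\<forall>r\<in>{0..T}. \<bar>\<sigma> r\<bar> \<le> s1" unfolding bounded_iff by auto
    then have s1: "\<And>r. r \<in> {0..T} \<Longrightarrow> \<bar>\<sigma> r\<bar> \<le> s1" by blast
    \<comment> \<open>For integrability any modulus will do, so the crude bound is used on every
      grid.\<close>
    have "\<bar>\<sigma> r - \<sigma> r'\<bar> \<le> 2 * s1" if "r \<in> {0..T}" "r' \<in> {0..T}" for r r'
      using s1[OF that(1)] s1[OF that(2)] by linarith
    from wiener_integral_riemann_error(1)[OF BM noise t \<open>i \<le> 2 ^ n\<close> this] show ?thesis
      by (simp add: Z_def[abs_def] S_def h_def)
  qed
  have Qint: "integrable M (Q n)" for n
    unfolding Q_def using Zint by (intro Bochner_Integration.integrable_add integrable_mult_right Bochner_Integration.integrable_sum) auto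
  have Q0: "Q n \<omega> \<ge> 0" for n \<omega>
    unfolding Q_def Z_def using h(1)[of n] by (intro add_nonneg_nonneg mult_nonneg_nonneg sum_nonneg) auto
  have "(\<lambda>n. \<integral>\<omega>. norm (Q n \<omega>) \<partial>M) \<longlonglongrightarrow> 0"
  proof (rule LIMSEQ_I)
    fix e :: real assume e: "e > 0"
    \<comment> \<open>Each mean mismatch is at most \<open>\<delta> * K\<close>, and
      \<open>Q\<close> collects a total weight \<open>1 + t\<close>. The added 1 keeps the
      denominator positive when \<open>K\<close> is 0.\<close>
    define \<delta> where "\<delta> = e / (2 * ((1 + t) * K + 1))"
    have \<delta>: "\<delta> > 0" using e K0 t by (auto simp: \<delta>_def intro!: divide_pos_pos add_nonneg_pos mult_nonneg_nonneg)
    obtain n0 where n0: "\<And>n r r'. n \<ge> n0 \<Longrightarrow> r \<in> {0..T} \<Longrightarrow> r' \<in> {0..T} \<Longrightarrow> \<bar>r - r'\<bar> \<le> t / 2 ^ n \<Longrightarrow> \<bar>\<sigma> r - \<sigma> r'\<bar> \<le> \<delta>"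
      using uniform_modulus_dyadic[OF \<sigma>_cont \<delta>, of t] unfolding eventually_sequentially real_norm_def by blast
    show "\<exists>n0. \<forall>n\<ge>n0. norm ((\<integral>\<omega>. norm (Q n \<omega>) \<partial>M) - 0) < e"
    proof (intro exI allI impI)
      fix n assume n: "n \<ge> n0"
      have ZE: "(\<integral>\<omega>. Z n i \<omega> \<partial>M) \<le> \<delta> * K" if "i \<le> 2 ^ n" for i
        using wiener_integral_riemann_error(2)[OF BM noise t that n0[OF n]]
        by (simp add: Z_def[abs_def] S_def h_def K_def)
      have "(\<integral>\<omega>. norm (Q n \<omega>) \<partial>M) = (\<integral>\<omega>. Z n (2 ^ n) \<omega> \<partial>M) + h n * (\<Sum>i<2^n. \<integral>\<omega>. Z n i \<omega> \<partial>M)"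
      proof -
        have i1: "integrable M (Z n (2 ^ n))" and i2: "integrable M (\<lambda>\<omega>. \<Sum>i<2^n. Z n i \<omega>)"
          using Zint by (auto intro!: Bochner_Integration.integrable_sum)
        have "(\<integral>\<omega>. norm (Q n \<omega>) \<partial>M) = (\<integral>\<omega>. Z n (2 ^ n) \<omega> + h n * (\<Sum>i<2^n. Z n i \<omega>) \<partial>M)"
          using Q0 by (simp add: Q_def)
        also have "\<dots> = (\<integral>\<omega>. Z n (2 ^ n) \<omega> \<partial>M) + h n * (\<integral>\<omega>. (\<Sum>i<2^n. Z n i \<omega>) \<partial>M)"
          using i1 i2 by simp
        also have "(\<integral>\<omega>. (\<Sum>i<2^n. Z n i \<omega>) \<partial>M) = (\<Sum>i<2^n. \<integral>\<omega>. Z n i \<omega> \<partial>M)"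
          by (rule Bochner_Integration.integral_sum) (use Zint in auto)
        finally show ?thesis .
      qed
      also have "\<dots> \<le> \<delta> * K + h n * (\<Sum>i<(2::nat)^n. \<delta> * K)"
        using h(1)[of n] by (intro add_mono mult_left_mono sum_mono ZE) auto
      also have "\<dots> = \<delta> * ((1 + t) * K)" using h(2)[of n] by (simp add: algebra_simps)
      also have "\<dots> < e"
      proof -
        have p: "0 \<le> (1 + t) * K" using K0 t by simp
        then have "\<delta> * ((1 + t) * K) \<le> \<delta> * ((1 + t) * K + 1)" using \<delta> by (intro mult_left_mono) auto
        also have "\<dots> = e / 2"
        proof -
          have "e / (2 * C) * C = e / 2" if "C \<noteq> 0" for C :: real using that by simp
          then show ?thesis unfolding \<delta>_def using p by (metis add_nonneg_pos less_irrefl zero_less_one)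
        qed
        finally show ?thesis using e by simp
      qed
      finally have "(\<integral>\<omega>. norm (Q n \<omega>) \<partial>M) < e" .
      moreover have "0 \<le> (\<integral>\<omega>. norm (Q n \<omega>) \<partial>M)" by (intro integral_nonneg_AE) simp
      ultimately show "norm ((\<integral>\<omega>. norm (Q n \<omega>) \<partial>M) - 0) < e" by simp
    qed
  qed
  from tendsto_L1_AE_subseq[OF Qint this] obtain r :: "nat \<Rightarrow> nat"
    where r: "strict_mono r" and Qr: "AE \<omega> in M. (\<lambda>n. Q (r n) \<omega>) \<longlonglongrightarrow> 0" by blast
  have "AE \<omega> in M. (\<lambda>n. euler c \<sigma> W (X 0) (t / 2 ^ r n) (2 ^ r n) \<omega>) \<longlonglongrightarrow> X t \<omega>"
    using SDE Qr AE_space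
  proof eventually_elim
    case (elim \<omega>)
    have Nc: "continuous_on {0..T} (\<lambda>t. N t \<omega>)" using noise elim(3) by (simp add: wiener_integral_def)
    have T0: "0 \<le> T" using T by simp
    have eq: "\<And>t. t \<in> {0..T} \<Longrightarrow> X t \<omega> = X 0 \<omega> + integral {0..t} (\<lambda>r. c (X r \<omega>) r) + N t \<omega>" using elim(1) by blast
    note ic = integral_equation_continuous[OF T0 c_cont c_bd Nc eq]
    have gc: "continuous_on {0..T} (\<lambda>r. c (X r \<omega>) r)"
    proof -
      have "continuous_on {0..T} (\<lambda>r. (\<lambda>(y, t). c y t) (X r \<omega>, r))"
        by (rule continuous_on_compose2[OF c_cont]) (auto intro!: continuous_on_Pair ic(2) continuous_on_id)
      then show ?thesis by simp
    qed
    \<comment> \<open>The modulus \<open>\<epsilon>\<close> may depend on \<open>\<omega>\<close>: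
      continuity of the path gives one for each path separately, and no uniformity over paths is
      used.\<close>
    have bd: "norm (euler c \<sigma> W (X 0) (h n) (2 ^ n) \<omega> - X t \<omega>) \<le> (1 + exp (L * t) * L) * Q n \<omega> + exp (L * t) * t * \<epsilon>"
      if \<epsilon>: "\<forall>r\<in>{0..T}. \<forall>r'\<in>{0..T}. \<bar>r - r'\<bar> \<le> t / 2 ^ n \<longrightarrow> norm (c (X r \<omega>) r - c (X r' \<omega>) r') \<le> \<epsilon>" for n \<epsilon>
    proof -
      have "norm (euler c \<sigma> W (X 0) (h n) (2 ^ n) \<omega> - X (h n * real (2 ^ n)) \<omega>) \<le>
          norm ((\<Sum>l<2 ^ n. \<sigma> (h n * real l) *\<^sub>R (W (h n * real (Suc l)) \<omega> - W (h n * real l) \<omega>)) - N (h n * real (2 ^ n)) \<omega>) +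
          exp (L * h n * real (2 ^ n)) * (\<Sum>i<2 ^ n. h n * (L * norm ((\<Sum>l<i. \<sigma> (h n * real l) *\<^sub>R (W (h n * real (Suc l)) \<omega> - W (h n * real l) \<omega>)) - N (h n * real i) \<omega>) + \<epsilon>))"
      proof (rule euler_error[where T=T and c=c and x="\<lambda>r. X r \<omega>" and \<nu>="\<lambda>r. N r \<omega>"])
        show "h n > 0" "h n * real (2 ^ n) \<le> T" using h t by auto
        show "norm (c (X r \<omega>) r - c (X r' \<omega>) r') \<le> \<epsilon>" if "r \<in> {0..T}" "r' \<in> {0..T}" "\<bar>r - r'\<bar> \<le> h n" for r r'
          using \<epsilon> that by (simp add: h_def)
        show "X t \<omega> = euler c \<sigma> W (X 0) (h n) 0 \<omega> + integral {0..t} (\<lambda>r. c (X r \<omega>) r) + N t \<omega>" if "t \<in> {0..T}" for t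
          using eq[OF that] by simp
      qed (use L c_lip ic(1) in auto)
      then have "norm (euler c \<sigma> W (X 0) (h n) (2 ^ n) \<omega> - X t \<omega>) \<le> Z n (2 ^ n) \<omega> + exp (L * t) * (\<Sum>i<2 ^ n. h n * (L * Z n i \<omega> + \<epsilon>))"
        unfolding Z_def S_def h(2) mult.assoc[of L] by simp
      also have "(\<Sum>i<2 ^ n. h n * (L * Z n i \<omega> + \<epsilon>)) = L * (h n * (\<Sum>i<2^n. Z n i \<omega>)) + t * \<epsilon>"
        using h(2)[of n] by (simp add: distrib_left sum.distrib sum_distrib_left ac_simps)
      also have "Z n (2 ^ n) \<omega> + exp (L * t) * (L * (h n * (\<Sum>i<2^n. Z n i \<omega>)) + t * \<epsilon>) \<le>
          (1 + exp (L * t) * L) * Q n \<omega> + exp (L * t) * t * \<epsilon>"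
      proof -
        have "0 \<le> h n * (\<Sum>i<2^n. Z n i \<omega>)" using h(1)[of n] by (intro mult_nonneg_nonneg sum_nonneg) (auto simp: Z_def)
        moreover have "0 \<le> exp (L * t) * L * Z n (2 ^ n) \<omega>" using L by (simp add: Z_def)
        ultimately show ?thesis unfolding Q_def by (simp add: algebra_simps)
      qed
      finally show ?thesis .
    qed
    show ?case
    proof (rule LIMSEQ_I)
      fix e :: real assume e: "e > 0"
      define \<epsilon> where "\<epsilon> = e / (2 * (exp (L * t) * t))"
      have et: "exp (L * t) * t > 0" using t by simp
      have \<epsilon>: "\<epsilon> > 0" using e et by (simp add: \<epsilon>_def)
      have \<epsilon>e: "exp (L * t) * t * \<epsilon> = e / 2" using et t by (simp add: \<epsilon>_def)
      have "((\<lambda>n. (1 + exp (L * t) * L) * Q (r n) \<omega>) \<longlongrightarrow> (1 + exp (L * t) * L) * 0) sequentially"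
        by (intro tendsto_intros elim(2))
      then have 1: "\<forall>\<^sub>F n in sequentially. (1 + exp (L * t) * L) * Q (r n) \<omega> < e / 2"
        using e by (intro order_tendstoD(2)[where y=0]) auto
      have 2: "\<forall>\<^sub>F n in sequentially. \<forall>s\<in>{0..T}. \<forall>s'\<in>{0..T}. \<bar>s - s'\<bar> \<le> t / 2 ^ r n \<longrightarrow> norm (c (X s \<omega>) s - c (X s' \<omega>) s') \<le> \<epsilon>"
        using filterlim_subseq[OF r] uniform_modulus_dyadic[OF gc \<epsilon>, of t] unfolding filterlim_iff by blast
      have "\<forall>\<^sub>F n in sequentially. norm (euler c \<sigma> W (X 0) (t / 2 ^ r n) (2 ^ r n) \<omega> - X t \<omega>) < e"
        using 1 2
      proof eventually_elim
        case (elim n)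
        from bd[OF elim(2)] elim(1) \<epsilon>e show ?case by (simp add: h_def)
      qed
      then show "\<exists>n0. \<forall>n\<ge>n0. norm (euler c \<sigma> W (X 0) (t / 2 ^ r n) (2 ^ r n) \<omega> - X t \<omega>) < e"
        by (simp add: eventually_sequentially)
    qed
  qed
  with r show ?thesis by blast
qed

text \<open>Two errors occur: the discrete variances differ from
  \<open>V T - V (h n * real i)\<close>, and the sum differs from the integral. The first is
  uniformly small in \<open>i\<close> and is absorbed by uniform continuity of the rate on a compact
  set of positive variances.\<close>

lemma euler_sums_tendsto:
  assumes t: "0 < t" "t < T"
  defines "h \<equiv> \<lambda>n. t / 2 ^ n"
  defines "w \<equiv> \<lambda>n i. V T - (\<Sum>l<i. h n * (\<sigma> (h n * real l))\<^sup>2)"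
  shows "(\<lambda>n. w n (2 ^ n)) \<longlonglongrightarrow> V T - V t"
    and "(\<lambda>n. \<Sum>i<2^n. h n * girsanov_rate c \<sigma> x (w n i) (h n * real i)) \<longlonglongrightarrow> integral {0..t} (rate x)"
proof -
  have h: "h n > 0" "h n * real (2 ^ n) = t" for n using t by (auto simp: h_def)
  have hi: "h n * real i \<in> {0..t}" if "i \<le> 2 ^ n" for n i
  proof -
    have "h n * real i \<le> h n * real (2 ^ n)" using that h(1)[of n] by (intro mult_left_mono) (auto simp del: of_nat_power)
    then have "h n * real i \<le> t" unfolding h(2) .
    then show ?thesis using h(1)[of n] by simp
  qed
  have Verr: "\<bar>w n i - (V T - V (h n * real i))\<bar> \<le> T * \<epsilon>"
    if \<epsilon>: "\<forall>r\<in>{0..T}. \<forall>r'\<in>{0..T}. \<bar>r - r'\<bar> \<le> t / 2 ^ n \<longrightarrow> norm ((\<sigma> r)\<^sup>2 - (\<sigma> r')\<^sup>2) \<le> \<epsilon>" and i: "i \<le> 2 ^ n" for n i \<epsilon>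
  proof -
    have \<epsilon>0: "\<epsilon> \<ge> 0" using \<epsilon> T t by (metis abs_zero atLeastAtMost_iff diff_self divide_nonneg_pos less_imp_le norm_zero order_refl zero_less_numeral zero_less_power)
    have "norm ((\<Sum>l<i. h n *\<^sub>R (\<sigma> (h n * real l))\<^sup>2) - integral {0..h n * real i} (\<lambda>r. (\<sigma> r)\<^sup>2)) \<le> h n * real i * \<epsilon>"
      by (rule riemann_sum_error[OF h(1) _ \<sigma>2_cont]) (use hi[OF i] t \<epsilon> in \<open>auto simp: h_def\<close>)
    also have "\<dots> \<le> T * \<epsilon>" using hi[OF i] t \<epsilon>0 by (intro mult_right_mono) auto
    finally show ?thesis by (simp add: w_def V_def)
  qed
  have Vev: "\<forall>\<^sub>F n in sequentially. \<forall>i\<le>2^n. \<bar>w n i - (V T - V (h n * real i))\<bar> \<le> e" if e: "e > 0" for e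
  proof -
    have "e / T > 0" using e T by simp
    from uniform_modulus_dyadic[OF \<sigma>2_cont this, of t] show ?thesis
    proof eventually_elim
      case (elim n)
      show ?case using Verr[OF elim] T by simp
    qed
  qed
  show "(\<lambda>n. w n (2 ^ n)) \<longlonglongrightarrow> V T - V t"
  proof (rule tendstoI)
    fix e :: real assume "e > 0"
    then have "e / 2 > 0" by simp
    from Vev[OF this] show "\<forall>\<^sub>F n in sequentially. dist (w n (2 ^ n)) (V T - V t) < e"
    proof eventually_elim
      case (elim n)
      from elim[rule_format, of "2 ^ n"] h(2)[of n] \<open>e > 0\<close> show ?case by (simp add: dist_real_def)
    qed
  qed
  \<comment> \<open>Half of the lower bound for \<open>V T - V r\<close>. A perturbation of the
    variance by at most \<open>a\<close> then stays in the compact set \<open>?C\<close>.\<close>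
  define a where "a = s0\<^sup>2 * (T - t) / 2"
  have a: "a > 0" using s0 t by (simp add: a_def)
  have Vr: "V r \<ge> 0" "V T - V r \<ge> 2 * a" if "r \<in> {0..t}" for r
  proof -
    have "0 \<le> s0\<^sup>2 * (r - 0)" using that by simp
    also have "\<dots> \<le> V r - V 0" using that t by (intro V_diff_ge) auto
    finally show "V r \<ge> 0" by (simp add: V_def)
    have "2 * a \<le> s0\<^sup>2 * (T - r)" using that unfolding a_def by (simp add: mult_left_mono)
    also have "\<dots> \<le> V T - V r" using that t by (intro V_diff_ge) auto
    finally show "V T - V r \<ge> 2 * a" .
  qed
  let ?C = "{a..V T + a} \<times> {0..T}"
  have uc: "uniformly_continuous_on ?C (\<lambda>(w, r). girsanov_rate c \<sigma> x w r)"
    by (intro compact_uniformly_continuous girsanov_rate_continuous a compact_Times) auto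
  show "(\<lambda>n. \<Sum>i<2^n. h n * girsanov_rate c \<sigma> x (w n i) (h n * real i)) \<longlonglongrightarrow> integral {0..t} (rate x)"
  proof (rule tendstoI)
    fix e :: real assume e: "e > 0"
    define e' where "e' = e / (4 * t)"
    have e': "e' > 0" using e t by (simp add: e'_def)
    from uc e' obtain d where d: "d > 0"
      and dd: "\<And>p p'. p \<in> ?C \<Longrightarrow> p' \<in> ?C \<Longrightarrow> dist p' p < d \<Longrightarrow>
        dist (case p' of (w, r) \<Rightarrow> girsanov_rate c \<sigma> x w r) (case p of (w, r) \<Rightarrow> girsanov_rate c \<sigma> x w r) < e'"
      unfolding uniformly_continuous_on_def by meson
    have dm: "min (d / 2) a > 0" using d a by simp
    have rc: "continuous_on {0..t} (rate x)" using t by (intro rate_continuous) auto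
    from Vev[OF dm] uniform_modulus_dyadic[OF rc e', of t]
    show "\<forall>\<^sub>F n in sequentially. dist (\<Sum>i<2^n. h n * girsanov_rate c \<sigma> x (w n i) (h n * real i)) (integral {0..t} (rate x)) < e"
    proof eventually_elim
      case (elim n)
      have 1: "\<bar>girsanov_rate c \<sigma> x (w n i) (h n * real i) - rate x (h n * real i)\<bar> \<le> e'" if i: "i < 2 ^ n" for i
      proof -
        let ?r = "h n * real i"
        have r: "?r \<in> {0..t}" using hi i by simp
        have we: "\<bar>w n i - (V T - V ?r)\<bar> \<le> min (d / 2) a" using elim(1) i by simp
        have "(V T - V ?r, ?r) \<in> ?C" using Vr[OF r] r t a by simp
        moreover have "(w n i, ?r) \<in> ?C" using Vr[OF r] r t a we by auto
        moreover have "dist (w n i, ?r) (V T - V ?r, ?r) < d" using we d by (simp add: dist_Pair_Pair dist_real_def)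
        ultimately have "dist (girsanov_rate c \<sigma> x (w n i) ?r) (girsanov_rate c \<sigma> x (V T - V ?r) ?r) < e'"
          using dd[of "(V T - V ?r, ?r)" "(w n i, ?r)"] by simp
        then show ?thesis by (simp add: dist_real_def rate_def)
      qed
      have "\<bar>(\<Sum>i<2^n. h n * girsanov_rate c \<sigma> x (w n i) (h n * real i)) - (\<Sum>i<2^n. h n * rate x (h n * real i))\<bar> \<le> (\<Sum>i<(2::nat)^n. h n * e')"
        unfolding sum_subtractf[symmetric] right_diff_distrib[symmetric]
        by (rule order_trans[OF sum_abs]) (intro sum_mono, use 1 h(1)[of n] in \<open>simp add: abs_mult\<close>)
      also have "\<dots> = t * e'" using h(2)[of n] by (simp add: mult.commute)
      finally have A: "\<bar>(\<Sum>i<2^n. h n * girsanov_rate c \<sigma> x (w n i) (h n * real i)) - (\<Sum>i<2^n. h n * rate x (h n * real i))\<bar> \<le> t * e'" .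
      have "norm ((\<Sum>i<2^n. h n *\<^sub>R rate x (h n * real i)) - integral {0..h n * real (2 ^ n)} (rate x)) \<le> h n * real (2 ^ n) * e'"
        by (rule riemann_sum_error[OF h(1) _ rc]) (use elim(2) h(2)[of n] in \<open>auto simp: h_def\<close>)
      then have B: "\<bar>(\<Sum>i<2^n. h n * rate x (h n * real i)) - integral {0..t} (rate x)\<bar> \<le> t * e'"
        unfolding h(2) by simp
      have "t * e' = e / 4" using t by (simp add: e'_def)
      with A B e show ?case unfolding dist_real_def by linarith
    qed
  qed
qed

text \<open>Limit of the discrete bound. The Gaussian density is continuous in variance and point,
  and bounded as long as the variance stays away from 0, so a constant dominates.\<close>

lemma expectation_gauss_lower_bound:
  fixes W N X :: "real \<Rightarrow> 'a \<Rightarrow> real^'k"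
  assumes BM: "brownian_motion M W" and noise: "wiener_integral M W \<sigma> T N" and init: "indep_of_bm M (X 0) W"
    and SDE: "AE \<omega> in M. \<forall>t\<in>{0..T}. X t \<omega> = X 0 \<omega> + integral {0..t} (\<lambda>r. c (X r \<omega>) r) + N t \<omega>"
    and X0: "distributed M lborel (X 0) (\<lambda>y. ennreal (q0 y))"
    and q0: "\<And>y. q0 y > 0" "q0 \<in> borel_measurable borel"
    and lnq0: "integrable lborel (\<lambda>y. ln (q0 y) * gauss_dens x (V T) y)"
    and t: "0 < t" "t < T" and Xt [measurable]: "X t \<in> borel_measurable M"
  shows "exp ((\<integral>y. ln (q0 y) * gauss_dens x (V T) y \<partial>lborel) + integral {0..t} (rate x))
    \<le> (\<integral>\<omega>. gauss_dens x (V T - V t) (X t \<omega>) \<partial>M)"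
proof -
  interpret prob_space M using BM by (simp add: brownian_motion_def)
  define h where "h n = t / 2 ^ n" for n :: nat
  define w where "w n i = V T - (\<Sum>l<i. h n * (\<sigma> (h n * real l))\<^sup>2)" for n i
  define A where "A = (\<integral>y. ln (q0 y) * gauss_dens x (V T) y \<partial>lborel)"
  have h: "h n > 0" "h n * real (2 ^ n) = t" for n using t by (auto simp: h_def)
  note lims = euler_sums_tendsto[OF t, folded h_def, folded w_def]
  have t': "t \<le> T" using t by simp
  obtain r where r: "strict_mono r"
    and conv: "AE \<omega> in M. (\<lambda>n. euler c \<sigma> W (X 0) (h (r n)) (2 ^ r n) \<omega>) \<longlonglongrightarrow> X t \<omega>"
    using euler_converges[OF BM noise SDE t(1) t'] unfolding h_def by blast
  define a where "a = (V T - V t) / 2"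
  have a: "a > 0"
  proof -
    have "0 < s0\<^sup>2 * (T - t)" using s0 t by simp
    also have "\<dots> \<le> V T - V t" using t by (intro V_diff_ge) auto
    finally show ?thesis by (simp add: a_def)
  qed
  have "\<forall>\<^sub>F n in sequentially. w n (2 ^ n) > a"
    using lims(1) a by (intro order_tendstoD(1)) (auto simp: a_def)
  then have "\<forall>\<^sub>F n in sequentially. w (r n) (2 ^ r n) > a"
    using filterlim_subseq[OF r] unfolding filterlim_iff by blast
  then obtain n0 where n0: "\<And>n. n \<ge> n0 \<Longrightarrow> w (r n) (2 ^ r n) > a" unfolding eventually_sequentially by blast
  \<comment> \<open>Drops the finitely many grids on which the leftover variance might not exceed
    \<open>a\<close>.\<close>
  define r' where "r' n = r (n + n0)" for n
  have wa: "w (r' n) (2 ^ r' n) > a" for n using n0 by (simp add: r'_def)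
  have r': "strict_mono r'" using r by (simp add: r'_def strict_mono_def)
  have conv': "AE \<omega> in M. (\<lambda>n. euler c \<sigma> W (X 0) (h (r' n)) (2 ^ r' n) \<omega>) \<longlonglongrightarrow> X t \<omega>"
    using conv by eventually_elim (auto simp: r'_def dest: LIMSEQ_ignore_initial_segment[of _ _ n0])
  have Wm: "W u \<in> borel_measurable M" if "u \<ge> 0" for u using BM that by (simp add: brownian_motion_def)
  have em [measurable]: "euler c \<sigma> W (X 0) (h n) (2 ^ n) \<in> borel_measurable M" for n
  proof -
    have "euler c \<sigma> W (X 0) (h n) i \<in> borel_measurable M" if "i \<le> 2 ^ n" for i
      using that
    proof (induction i)
      case 0
      have "euler c \<sigma> W (X 0) (h n) 0 = X 0" by (rule ext) simp
      then show ?case using distributed_measurable[OF X0] by simp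
    next
      case (Suc i)
      have [measurable]: "euler c \<sigma> W (X 0) (h n) i \<in> borel_measurable M" using Suc by simp
      have [measurable]: "W (h n * real (Suc i)) \<in> borel_measurable M" "W (h n * real i) \<in> borel_measurable M"
        using h(1)[of n] by (auto intro!: Wm)
      have "h n * real i \<le> h n * real (2 ^ n)" using Suc h(1)[of n] by (intro mult_left_mono) (auto simp del: of_nat_power)
      then have "h n * real i \<le> t" unfolding h(2) .
      then have "h n * real i \<in> {0..T}" using h(1)[of n] t by simp
      note [measurable] = measurable_compose[OF _ c_measurable[OF this]]
      show ?case by (simp cong: measurable_cong del: of_nat_Suc) measurable
    qed
    then show ?thesis by simp
  qed
  have ineq: "exp (A + (\<Sum>i<2^r' n. h (r' n) * girsanov_rate c \<sigma> x (w (r' n) i) (h (r' n) * real i)))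
    \<le> (\<integral>\<omega>. gauss_dens x (w (r' n) (2 ^ r' n)) (euler c \<sigma> W (X 0) (h (r' n)) (2 ^ r' n) \<omega>) \<partial>M)" for n
  proof -
    let ?G = "\<lambda>\<omega>. gauss_dens x (w (r' n) (2 ^ r' n)) (euler c \<sigma> W (X 0) (h (r' n)) (2 ^ r' n) \<omega>)"
    have wp: "w (r' n) (2 ^ r' n) > 0" using wa[of n] a by simp
    have hT: "h (r' n) * real (2 ^ r' n) \<le> T" unfolding h(2) using t by simp
    have "ennreal (exp (A + (\<Sum>i<2^r' n. h (r' n) * girsanov_rate c \<sigma> x (w (r' n) i) (h (r' n) * real i)))) \<le> (\<integral>\<^sup>+\<omega>. ennreal (?G \<omega>) \<partial>M)"
      using euler_lower_bound[OF BM init X0 q0 lnq0 h(1) hT] wp unfolding w_def A_def by simp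
    also have "\<dots> = ennreal (\<integral>\<omega>. ?G \<omega> \<partial>M)"
    proof (rule nn_integral_eq_integral)
      show "integrable M ?G"
        by (rule integrable_const_bound[where B="(1 / sqrt (2 * pi * w (r' n) (2 ^ r' n))) ^ CARD('k)"])
          (auto simp: gauss_dens_le[OF wp])
    qed simp
    finally show ?thesis by (simp add: integral_nonneg_AE)
  qed
  have L1: "(\<lambda>n. exp (A + (\<Sum>i<2^r' n. h (r' n) * girsanov_rate c \<sigma> x (w (r' n) i) (h (r' n) * real i)))) \<longlonglongrightarrow> exp (A + integral {0..t} (rate x))"
    using LIMSEQ_subseq_LIMSEQ[OF lims(2)[of x] r'] by (intro tendsto_intros) (simp add: comp_def)
  have L2: "(\<lambda>n. \<integral>\<omega>. gauss_dens x (w (r' n) (2 ^ r' n)) (euler c \<sigma> W (X 0) (h (r' n)) (2 ^ r' n) \<omega>) \<partial>M) \<longlonglongrightarrow> (\<integral>\<omega>. gauss_dens x (V T - V t) (X t \<omega>) \<partial>M)"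
  proof (rule integral_dominated_convergence[where w="\<lambda>_. (1 / sqrt (2 * pi * a)) ^ CARD('k)"])
    have wl: "(\<lambda>n. w (r' n) (2 ^ r' n)) \<longlonglongrightarrow> V T - V t"
      using LIMSEQ_subseq_LIMSEQ[OF lims(1) r'] by (simp add: comp_def)
    show "AE \<omega> in M. (\<lambda>n. gauss_dens x (w (r' n) (2 ^ r' n)) (euler c \<sigma> W (X 0) (h (r' n)) (2 ^ r' n) \<omega>)) \<longlonglongrightarrow> gauss_dens x (V T - V t) (X t \<omega>)"
      using conv'
    proof eventually_elim
      case (elim \<omega>)
      show ?case using wa a less_trans[OF a wa] by (intro tendsto_gauss_dens wl elim) (auto simp: a_def)
    qed
    show "AE \<omega> in M. norm (gauss_dens x (w (r' n) (2 ^ r' n)) (euler c \<sigma> W (X 0) (h (r' n)) (2 ^ r' n) \<omega>)) \<le> (1 / sqrt (2 * pi * a)) ^ CARD('k)" for n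
    proof (rule AE_I2)
      fix \<omega>
      have wp: "w (r' n) (2 ^ r' n) > 0" using wa[of n] a by simp
      have "gauss_dens x (w (r' n) (2 ^ r' n)) (euler c \<sigma> W (X 0) (h (r' n)) (2 ^ r' n) \<omega>) \<le> (1 / sqrt (2 * pi * w (r' n) (2 ^ r' n))) ^ CARD('k)"
        by (rule gauss_dens_le[OF wp])
      also have "\<dots> \<le> (1 / sqrt (2 * pi * a)) ^ CARD('k)"
        using wa[of n] a by (intro power_mono divide_left_mono) auto
      finally show "norm (gauss_dens x (w (r' n) (2 ^ r' n)) (euler c \<sigma> W (X 0) (h (r' n)) (2 ^ r' n) \<omega>)) \<le> (1 / sqrt (2 * pi * a)) ^ CARD('k)"
        by simp
    qed
  qed auto
  show ?thesis unfolding A_def[symmetric]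
    by (rule LIMSEQ_le[OF L1 L2]) (use ineq in blast)
qed

end

section \<open>Passage to the terminal time\<close>


lemma integral_reflect_about:
  fixes f :: "real \<Rightarrow> 'b::euclidean_space"
  assumes "continuous_on {a..b} f"
  shows "integral {T - b..T - a} (\<lambda>u. f (T - u)) = integral {a..b} f"
proof -
  have "integral {a - T..b - T} (f \<circ> (\<lambda>y. y + T)) = integral {a - T + T..b - T + T} f"
    by (rule integral_shift) (use assms in simp)
  moreover have "integral {- (b - T)..- (a - T)} (\<lambda>u. (f \<circ> (\<lambda>y. y + T)) (- u)) = integral {a - T..b - T} (f \<circ> (\<lambda>y. y + T))"
    by (rule Henstock_Kurzweil_Integration.integral_reflect_real)
  ultimately show ?thesis by (simp add: comp_def)
qed

lemma power_add_le_two_power: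
  fixes a b :: real
  assumes "0 \<le> a" "0 \<le> b"
  shows "(a + b) ^ m \<le> 2 ^ m * (a ^ m + b ^ m)"
proof -
  have "(a + b) ^ m \<le> (2 * max a b) ^ m" using assms by (intro power_mono) auto
  also have "\<dots> = 2 ^ m * max a b ^ m" by (simp add: power_mult_distrib)
  also have "\<dots> \<le> 2 ^ m * (a ^ m + b ^ m)"
    using assms by (intro mult_left_mono) (auto simp: max_def)
  finally show ?thesis .
qed

lemma grad_ln_gauss_dens:
  fixes x y :: "real^'k"
  assumes w: "w > 0"
  shows "grad (\<lambda>z. ln (gauss_dens x w z)) y = (- 1 / w) *\<^sub>R (y - x)"
proof -
  define C where "C = ln ((1 / sqrt (2 * pi * w)) ^ CARD('k))"
  have eq: "(\<lambda>z. ln (gauss_dens x w z)) = (\<lambda>z. C - ((z - x) \<bullet> (z - x)) / (2 * w))"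
  proof
    fix z
    have "(1 / sqrt (2 * pi * w)) ^ CARD('k) > 0" using w by simp
    then show "ln (gauss_dens x w z) = C - ((z - x) \<bullet> (z - x)) / (2 * w)"
      unfolding gauss_dens_exp[OF w] C_def by (subst ln_mult_pos) (auto simp: power2_norm_eq_inner)
  qed
  have "((\<lambda>z. C - ((z - x) \<bullet> (z - x)) / (2 * w)) has_derivative (\<lambda>e. - ((y - x) \<bullet> e) / w)) (at y)"
    using w by (auto intro!: derivative_eq_intros simp: inner_commute field_simps)
  then have "frechet_derivative (\<lambda>z. ln (gauss_dens x w z)) (at y) = (\<lambda>e. - ((y - x) \<bullet> e) / w)"
    unfolding eq by (simp add: frechet_derivative_at[symmetric])
  then show ?thesis
    by (simp add: grad_def vec_eq_iff inner_axis)
qed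

context bounded_drift
begin

text \<open>The exponent \<open>- (1 / 2)\<close> makes the singularity at \<open>T\<close>
  integrable. It results from the bound of order \<open>1 / sqrt w\<close> and the linear lower
  bound on the remaining variance.\<close>

lemma rate_bound:
  assumes r: "0 \<le> r" "r < T"
  shows "\<bar>rate x r\<bar> \<le> B * K1 / s0 * (T - r) powr (- (1 / 2)) + B\<^sup>2 / (2 * s0\<^sup>2)"
proof -
  have K0: "K1 \<ge> 0" unfolding K1_def by (intro integral_nonneg_AE) simp
  have p: "s0\<^sup>2 * (T - r) > 0" using r s0 by simp
  have le: "s0\<^sup>2 * (T - r) \<le> V T - V r" using r by (intro V_diff_ge) auto
  then have w: "V T - V r > 0" using p by linarith
  have "sqrt (s0\<^sup>2 * (T - r)) \<le> sqrt (V T - V r)" using le by simp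
  moreover have "sqrt (s0\<^sup>2 * (T - r)) = s0 * sqrt (T - r)" using s0 by (simp add: real_sqrt_mult)
  ultimately have "B * K1 / sqrt (V T - V r) \<le> B * K1 / (s0 * sqrt (T - r))"
    using K0 B_nonneg s0 r by (intro divide_left_mono) (use w in auto)
  also have "\<dots> = B * K1 / s0 * (T - r) powr (- (1 / 2))"
  proof -
    have "(T - r) powr (- (1 / 2)) = 1 / sqrt (T - r)"
      using r powr_minus_divide[of "T - r" "1 / 2"] powr_half_sqrt[of "T - r"] by simp
    then show ?thesis by simp
  qed
  finally show ?thesis
    using girsanov_rate_bound[OF w, of r x] r unfolding rate_def by simp
qed

lemma rate_reflected_continuous: "continuous_on {0<..<T} (\<lambda>u. rate x (T - u))"
  unfolding continuous_on_eq_continuous_within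
proof
  fix u assume u: "u \<in> {0<..<T}"
  have "continuous_on {u / 2..T} (\<lambda>u. rate x (T - u))"
    by (rule continuous_on_compose2[OF rate_continuous[of "T - u / 2" x]])
      (use u in \<open>auto intro!: continuous_intros\<close>)
  then have "continuous (at u within {u / 2..T}) (\<lambda>u. rate x (T - u))"
    using u by (auto simp: continuous_on_eq_continuous_within)
  moreover have "at u within {u / 2..T} = at u within {0<..<T}"
    using u by (intro at_within_nhd[of u "{u / 2<..<T}"]) auto
  ultimately show "continuous (at u within {0<..<T}) (\<lambda>u. rate x (T - u))" by simp
qed

lemma rate_reflected_set_integrable: "set_integrable lborel {0<..<T} (\<lambda>u. rate x (T - u))"
proof -
  let ?b = "\<lambda>u. B * K1 / s0 * u powr (- (1 / 2)) + B\<^sup>2 / (2 * s0\<^sup>2)"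
  have "(\<lambda>u::real. u powr (- (1 / 2))) integrable_on {0..T}"
    using has_integral_powr_from_0[of "- (1 / 2)" T] T by (auto simp: integrable_on_def)
  then have "?b integrable_on {0..T}"
    by (intro Henstock_Kurzweil_Integration.integrable_add integrable_on_mult_right integrable_const_ivl)
  then have b: "?b integrable_on {0<..<T}" by (simp add: integrable_on_open_interval_real)
  have "(\<lambda>u. rate x (T - u)) absolutely_integrable_on {0<..<T}"
  proof (rule measurable_bounded_by_integrable_imp_absolutely_integrable[OF _ _ b])
    show "(\<lambda>u. rate x (T - u)) \<in> borel_measurable (lebesgue_on {0<..<T})"
      by (intro continuous_imp_measurable_on_sets_lebesgue rate_reflected_continuous) simp
    show "norm (rate x (T - u)) \<le> ?b u" if "u \<in> {0<..<T}" for u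
      using rate_bound[of "T - u" x] that by simp
  qed simp
  \<comment> \<open>Absolute integrability refers to the completed Lebesgue measure; Borel
    measurability allows the return to \<open>lborel\<close>.\<close>
  moreover have "(\<lambda>u. indicator {0<..<T} u *\<^sub>R rate x (T - u)) \<in> borel_measurable lborel"
    using borel_measurable_continuous_on_indicator[OF _ rate_reflected_continuous[of x]] by simp
  ultimately show ?thesis
    unfolding set_integrable_def by (subst (asm) integrable_completion)
qed

lemma rate_interval_integral: "(LBINT u=0..T. rate x (T - u)) = integral {0..T} (\<lambda>u. rate x (T - u))"
proof -
  have "(LBINT u=0..T. rate x (T - u)) = (LINT u:{0<..<T}|lborel. rate x (T - u))"
    using T by (simp add: interval_lebesgue_integral_def zero_ereal_def)
  also have "\<dots> = integral {0<..<T} (\<lambda>u. rate x (T - u))"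
    by (rule set_borel_integral_eq_integral(2)[OF rate_reflected_set_integrable])
  finally show ?thesis by (simp add: integral_open_interval_real)
qed

text \<open>After reflection the approach to \<open>T\<close> becomes a lower limit of integration
  tending to 0, and the integral of an integrable function is continuous in its lower limit.\<close>

lemma rate_integral_tendsto:
  assumes s: "s \<longlonglongrightarrow> 0" "\<And>n. s n \<in> {0<..<T}"
  shows "(\<lambda>n. integral {0..T - s n} (rate x)) \<longlonglongrightarrow> integral {0..T} (\<lambda>u. rate x (T - u))"
proof -
  have "(\<lambda>u. rate x (T - u)) integrable_on {0..T}"
    using set_borel_integral_eq_integral(1)[OF rate_reflected_set_integrable[of x]]
    by (simp add: integrable_on_open_interval_real)
  from indefinite_integral_continuous_1'[OF this]
  have "(\<lambda>n. integral {s n..T} (\<lambda>u. rate x (T - u))) \<longlonglongrightarrow> integral {0..T} (\<lambda>u. rate x (T - u))"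
    by (rule continuous_on_tendsto_compose[OF _ s(1)]) (use s(2) T in \<open>auto simp: less_imp_le\<close>)
  moreover have "integral {s n..T} (\<lambda>u. rate x (T - u)) = integral {0..T - s n} (rate x)" for n
  proof -
    have "continuous_on {0..T - s n} (rate x)" using s(2)[of n] by (intro rate_continuous) auto
    from integral_reflect_about[OF this, of T] show ?thesis by simp
  qed
  ultimately show ?thesis by simp
qed

lemma reverse_variance:
  assumes "u \<in> {0..T}"
  shows "integral {0..u} (\<lambda>r. (\<sigma> (T - r))\<^sup>2) = V T - V (T - u)"
proof -
  have i: "(\<lambda>r. (\<sigma> r)\<^sup>2) integrable_on {0..T}" by (intro integrable_continuous_interval \<sigma>2_cont)
  have "continuous_on {T - u..T} (\<lambda>r. (\<sigma> r)\<^sup>2)" using \<sigma>2_cont assms by (auto elim: continuous_on_subset)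
  from integral_reflect_about[OF this, of T]
  have "integral {0..u} (\<lambda>r. (\<sigma> (T - r))\<^sup>2) = integral {T - u..T} (\<lambda>r. (\<sigma> r)\<^sup>2)" by simp
  moreover have "V (T - u) + integral {T - u..T} (\<lambda>r. (\<sigma> r)\<^sup>2) = V T"
    unfolding V_def using assms i by (intro Henstock_Kurzweil_Integration.integral_combine) auto
  ultimately show ?thesis by simp
qed

text \<open>As \<open>t\<close> tends to \<open>T\<close>, the smoothing Gaussian concentrates at
  \<open>x\<close>. Joint continuity of \<open>q\<close> identifies the limit of the smoothed
  densities as the value at \<open>(T, x)\<close>, and polynomial growth provides the dominating
  function.\<close>

lemma density_lower_bound:
  fixes W N X :: "real \<Rightarrow> 'a \<Rightarrow> real^'k"
  assumes BM: "brownian_motion M W" and noise: "wiener_integral M W \<sigma> T N" and init: "indep_of_bm M (X 0) W"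
    and SDE: "AE \<omega> in M. \<forall>t\<in>{0..T}. X t \<omega> = X 0 \<omega> + integral {0..t} (\<lambda>r. c (X r \<omega>) r) + N t \<omega>"
    and marg: "\<And>t. t \<in> {0..T} \<Longrightarrow> distributed M lborel (X t) (\<lambda>y. ennreal (q t y))"
    and q0: "\<And>y. q 0 y > 0"
    and qc: "continuous_on ({0..T} \<times> UNIV) (\<lambda>(t, y). q t y)"
    and qp: "\<And>t y. t \<in> {0..T} \<Longrightarrow> \<bar>q t y\<bar> \<le> C * (1 + norm y ^ m)"
    and lnq0: "integrable lborel (\<lambda>y. ln (q 0 y) * gauss_dens x (V T) y)"
  shows "(\<integral>y. ln (q 0 y) * gauss_dens x (V T) y \<partial>lborel) + integral {0..T} (\<lambda>u. rate x (T - u)) \<le> ln (q T x)"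
proof -
  interpret prob_space M using BM by (simp add: brownian_motion_def)
  define A where "A = (\<integral>y. ln (q 0 y) * gauss_dens x (V T) y \<partial>lborel)"
  \<comment> \<open>The shift by 2 puts every \<open>s n\<close> strictly between 0 and
    \<open>T\<close>.\<close>
  define s where "s n = T / real (n + 2)" for n
  have s: "s n \<in> {0<..<T}" for n using T by (simp add: s_def divide_less_eq)
  have s0': "s \<longlonglongrightarrow> 0"
  proof -
    have "(\<lambda>n. T / real n) \<longlonglongrightarrow> 0" by (rule lim_const_over_n)
    from LIMSEQ_ignore_initial_segment[OF this, of 2] show ?thesis by (simp add: s_def[abs_def])
  qed
  define t where "t n = T - s n" for n
  have t: "0 < t n" "t n < T" for n using s[of n] by (auto simp: t_def)
  have tT: "t \<longlonglongrightarrow> T" using tendsto_diff[OF tendsto_const s0', of T] by (simp add: t_def[abs_def])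
  define w where "w n = V T - V (t n)" for n
  have w: "w n > 0" for n
  proof -
    have "0 < s0\<^sup>2 * (T - t n)" using s0 t[of n] by simp
    also have "\<dots> \<le> w n" unfolding w_def using t[of n] by (intro V_diff_ge) auto
    finally show ?thesis .
  qed
  have wV: "w n \<le> V T" for n
  proof -
    have "0 \<le> s0\<^sup>2 * (t n - 0)" using t[of n] by simp
    also have "\<dots> \<le> V (t n) - V 0" using t[of n] by (intro V_diff_ge) auto
    finally show ?thesis by (simp add: w_def V_def)
  qed
  have w0: "w \<longlonglongrightarrow> 0"
  proof -
    have "(\<lambda>n. V (t n)) \<longlonglongrightarrow> V T"
      by (rule continuous_on_tendsto_compose[OF V_cont tT]) (use t T in \<open>auto simp: less_imp_le\<close>)
    from tendsto_diff[OF tendsto_const this, of "V T"] show ?thesis by (simp add: w_def[abs_def])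
  qed
  have qm [measurable]: "q r \<in> borel_measurable borel" if "r \<in> {0..T}" for r
  proof -
    have "continuous_on UNIV (\<lambda>y. (\<lambda>(t, y). q t y) (r, y))"
      by (rule continuous_on_compose2[OF qc]) (use that in \<open>auto intro!: continuous_intros\<close>)
    then show ?thesis by (intro borel_measurable_continuous_onI) simp
  qed
  \<comment> \<open>The marginal laws see \<open>q\<close> only through \<open>ennreal\<close>,
    which sends negative values to 0; \<open>Q\<close> is the nonnegative density they actually
    specify.\<close>
  define Q where "Q r y = max 0 (q r y)" for r y
  have eQ: "ennreal (q r y) = ennreal (Q r y)" for r y
    by (cases "q r y \<ge> 0") (simp_all add: Q_def max_def ennreal_neg)
  have ineq: "exp (A + integral {0..t n} (rate x)) \<le> (\<integral>z. gauss_dens 0 1 z * Q (t n) (x + sqrt (w n) *\<^sub>R z) \<partial>lborel)" for n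
  proof -
    have tn: "t n \<in> {0..T}" using t[of n] by simp
    have z: "0 \<in> {0..T}" using T by simp
    have [measurable]: "Q (t n) \<in> borel_measurable borel" unfolding Q_def using qm[OF tn] by measurable
    have X: "X (t n) \<in> borel_measurable M" using distributed_measurable[OF marg[OF tn]] by simp
    have "exp (A + integral {0..t n} (rate x)) \<le> (\<integral>\<omega>. gauss_dens x (w n) (X (t n) \<omega>) \<partial>M)"
      unfolding A_def w_def
      by (rule expectation_gauss_lower_bound[OF BM noise init SDE marg[OF z] q0 qm[OF z] lnq0 t X])
    also have "\<dots> = (\<integral>y. Q (t n) y * gauss_dens x (w n) y \<partial>lborel)"
      using distributed_integral[of M lborel "X (t n)" "Q (t n)" "gauss_dens x (w n)"] marg[OF tn]
      unfolding eQ by (simp add: Q_def)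
    also have "\<dots> = (\<integral>y. gauss_dens x (w n) y *\<^sub>R Q (t n) y \<partial>lborel)" by (simp add: mult.commute)
    also have "\<dots> = (\<integral>z. gauss_dens 0 1 z *\<^sub>R Q (t n) (x + sqrt (w n) *\<^sub>R z) \<partial>lborel)"
      by (rule integral_gauss_dens_standardize[OF _ w]) measurable
    finally show ?thesis by simp
  qed
  have L1: "(\<lambda>n. exp (A + integral {0..t n} (rate x))) \<longlonglongrightarrow> exp (A + integral {0..T} (\<lambda>u. rate x (T - u)))"
    unfolding t_def by (intro tendsto_intros rate_integral_tendsto s0' s)
  have L2: "(\<lambda>n. \<integral>z. gauss_dens 0 1 z * Q (t n) (x + sqrt (w n) *\<^sub>R z) \<partial>lborel) \<longlonglongrightarrow> (\<integral>z. gauss_dens 0 1 z * Q T x \<partial>(lborel :: (real^'k) measure))"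
  proof (rule integral_dominated_convergence)
    define D1 where "D1 = \<bar>C\<bar> * (1 + 2 ^ m * norm x ^ m)"
    define D2 where "D2 = \<bar>C\<bar> * (2 ^ m * sqrt (V T) ^ m)"
    show "integrable lborel (\<lambda>z :: real^'k. D1 * gauss_dens 0 1 z + D2 * (gauss_dens 0 1 z * norm z ^ m))"
      by (intro Bochner_Integration.integrable_add integrable_mult_right integrable_gauss_dens integrable_gauss_dens_norm_power_std) simp
    show "(\<lambda>z :: real^'k. gauss_dens 0 1 z * Q T x) \<in> borel_measurable lborel" by measurable
    show "(\<lambda>z. gauss_dens 0 1 z * Q (t n) (x + sqrt (w n) *\<^sub>R z)) \<in> borel_measurable lborel" for n
    proof -
      have [measurable]: "Q (t n) \<in> borel_measurable borel" unfolding Q_def using qm[of "t n"] t[of n] by simp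
      show ?thesis by measurable
    qed
    show "AE z in lborel. norm (gauss_dens 0 1 z * Q (t n) (x + sqrt (w n) *\<^sub>R z)) \<le> D1 * gauss_dens 0 1 z + D2 * (gauss_dens 0 1 z * norm z ^ m)" for n
    proof (rule AE_I2)
      fix z :: "real^'k"
      let ?y = "x + sqrt (w n) *\<^sub>R z"
      have "norm ?y \<le> norm x + sqrt (V T) * norm z"
      proof -
        have "norm ?y \<le> norm x + sqrt (w n) * norm z" using norm_triangle_ineq[of x "sqrt (w n) *\<^sub>R z"] w[of n] by simp
        also have "sqrt (w n) * norm z \<le> sqrt (V T) * norm z" using wV[of n] by (intro mult_right_mono) auto
        finally show ?thesis by simp
      qed
      then have "norm ?y ^ m \<le> (norm x + sqrt (V T) * norm z) ^ m" by (intro power_mono) auto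
      also have "\<dots> \<le> 2 ^ m * (norm x ^ m + (sqrt (V T) * norm z) ^ m)"
        using w[of n] wV[of n] by (intro power_add_le_two_power) auto
      finally have y: "norm ?y ^ m \<le> 2 ^ m * (norm x ^ m + (sqrt (V T) * norm z) ^ m)" .
      have "\<bar>Q (t n) ?y\<bar> \<le> \<bar>q (t n) ?y\<bar>" by (simp add: Q_def max_def)
      also have "\<dots> \<le> C * (1 + norm ?y ^ m)" using t[of n] by (intro qp) auto
      also have "\<dots> \<le> \<bar>C\<bar> * (1 + norm ?y ^ m)" by (intro mult_right_mono) auto
      also have "\<dots> \<le> \<bar>C\<bar> * (1 + 2 ^ m * (norm x ^ m + (sqrt (V T) * norm z) ^ m))"
        using y by (intro mult_left_mono) auto
      also have "\<dots> = D1 + D2 * norm z ^ m" by (simp add: D1_def D2_def algebra_simps power_mult_distrib)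
      finally have "gauss_dens 0 1 z * \<bar>Q (t n) ?y\<bar> \<le> gauss_dens 0 1 z * (D1 + D2 * norm z ^ m)"
        by (intro mult_left_mono) auto
      then show "norm (gauss_dens 0 1 z * Q (t n) ?y) \<le> D1 * gauss_dens 0 1 z + D2 * (gauss_dens 0 1 z * norm z ^ m)"
        by (simp add: abs_mult algebra_simps)
    qed
    show "AE z in lborel. (\<lambda>n. gauss_dens 0 1 z * Q (t n) (x + sqrt (w n) *\<^sub>R z)) \<longlonglongrightarrow> gauss_dens (0 :: real^'k) 1 z * Q T x"
    proof (rule AE_I2)
      fix z :: "real^'k"
      have "(\<lambda>n. sqrt (w n)) \<longlonglongrightarrow> sqrt 0" using w0 by (intro tendsto_intros)
      then have "(\<lambda>n. x + sqrt (w n) *\<^sub>R z) \<longlonglongrightarrow> x + 0 *\<^sub>R z" by (intro tendsto_intros) simp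
      then have "(\<lambda>n. (t n, x + sqrt (w n) *\<^sub>R z)) \<longlonglongrightarrow> (T, x)" using tT by (intro tendsto_Pair) auto
      then have "(\<lambda>n. (\<lambda>(t, y). q t y) (t n, x + sqrt (w n) *\<^sub>R z)) \<longlonglongrightarrow> (\<lambda>(t, y). q t y) (T, x)"
        by (rule continuous_on_tendsto_compose[OF qc]) (use t T in \<open>auto simp: less_imp_le\<close>)
      then show "(\<lambda>n. gauss_dens 0 1 z * Q (t n) (x + sqrt (w n) *\<^sub>R z)) \<longlonglongrightarrow> gauss_dens 0 1 z * Q T x"
        unfolding Q_def by (intro tendsto_intros) simp
    qed
  qed
  have "exp (A + integral {0..T} (\<lambda>u. rate x (T - u))) \<le> (\<integral>z. gauss_dens 0 1 z * Q T x \<partial>(lborel :: (real^'k) measure))"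
    by (rule LIMSEQ_le[OF L1 L2]) (use ineq in blast)
  also have "\<dots> = Q T x" using integral_gauss_dens[of 1 "0 :: real^'k"] by simp
  finally have le: "exp (A + integral {0..T} (\<lambda>u. rate x (T - u))) \<le> Q T x" .
  \<comment> \<open>The lower bound is itself positive, so it forces \<open>q T x > 0\<close>. This
    makes the truncation trivial at \<open>(T, x)\<close> and the logarithm meaningful.\<close>
  have "0 < Q T x" by (rule less_le_trans[OF exp_gt_zero le])
  then have pos: "q T x > 0" "Q T x = q T x" by (auto simp: Q_def max_def split: if_splits)
  from le show ?thesis unfolding A_def[symmetric] pos(2) using pos(1) by (simp add: ln_ge_iff)
qed

text \<open>For each interior \<open>u\<close> both Gaussian integrals are finite, so they may be
  merged into one. The squared score then cancels, and with it the part that is not integrable as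
  \<open>u\<close> tends to 0.\<close>

lemma rate_eq_score_form:
  fixes x :: "real^'k"
  assumes u: "u \<in> {0<..<T}"
  defines "w \<equiv> V T - V (T - u)"
  defines "s \<equiv> grad (\<lambda>z. ln (gauss_dens x w z))"
  shows "(1/2) * (\<sigma> (T - u))\<^sup>2 * (\<integral>y. (norm (s y))\<^sup>2 * gauss_dens x w y \<partial>lborel)
      - (1/2) * (\<integral>y. (norm ((1 / \<sigma> (T - u)) *\<^sub>R c y (T - u) - \<sigma> (T - u) *\<^sub>R s y))\<^sup>2 * gauss_dens x w y \<partial>lborel)
    = rate x (T - u)"
proof -
  let ?r = "T - u"
  have r: "?r \<in> {0..T}" using u by simp
  define a where "a = \<sigma> ?r"
  have a: "a > 0" using \<sigma>_pos[OF r] by (simp add: a_def)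
  have w: "w > 0"
  proof -
    have "0 < s0\<^sup>2 * (T - ?r)" using s0 u by simp
    also have "\<dots> \<le> w" unfolding w_def using u by (intro V_diff_ge) auto
    finally show ?thesis .
  qed
  have s: "s y = (- 1 / w) *\<^sub>R (y - x)" for y unfolding s_def by (rule grad_ln_gauss_dens[OF w])
  have [measurable]: "(\<lambda>y. c y ?r) \<in> borel_measurable borel" by (rule c_measurable[OF r])
  have [measurable]: "s \<in> borel_measurable borel" unfolding s by measurable
  have sb: "norm (s y) \<le> (1 + norm x) / w * (1 + norm y)" for y
  proof -
    have "norm (y - x) \<le> norm y + norm x" by (rule norm_triangle_ineq4)
    also have "\<dots> \<le> (1 + norm x) * (1 + norm y)" by (simp add: algebra_simps)
    finally show ?thesis using w by (simp add: s divide_right_mono)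
  qed
  have growth: "integrable lborel (\<lambda>y. gauss_dens x w y *\<^sub>R (norm (f y))\<^sup>2)"
    if [measurable]: "f \<in> borel_measurable borel" and f: "\<And>y. norm (f y) \<le> K * (1 + norm y)" for f :: "real^'k \<Rightarrow> real^'k" and K
  proof (rule integrable_gauss_dens_poly_growth[OF _ w])
    show "(\<lambda>y. (norm (f y))\<^sup>2) \<in> borel_measurable borel" by measurable
    fix y
    have "(norm (f y))\<^sup>2 \<le> (K * (1 + norm y))\<^sup>2" by (rule power_mono[OF f norm_ge_zero])
    also have "\<dots> = K\<^sup>2 * (1 + norm y)\<^sup>2" by (simp add: power_mult_distrib)
    also have "\<dots> \<le> K\<^sup>2 * (2\<^sup>2 * (1\<^sup>2 + (norm y)\<^sup>2))"
      by (intro mult_left_mono power_add_le_two_power) auto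
    finally show "norm ((norm (f y))\<^sup>2) \<le> (K\<^sup>2 * 4) * (1 + norm y ^ 2)" by (simp add: algebra_simps)
  qed
  have i1: "integrable lborel (\<lambda>y. gauss_dens x w y * (norm (s y))\<^sup>2)"
    using growth[OF _ sb] by simp
  have i2: "integrable lborel (\<lambda>y. gauss_dens x w y * (norm ((1 / a) *\<^sub>R c y ?r - a *\<^sub>R s y))\<^sup>2)"
  proof -
    have "norm ((1 / a) *\<^sub>R c y ?r - a *\<^sub>R s y) \<le> (B / a + a * ((1 + norm x) / w)) * (1 + norm y)" for y
    proof -
      have "norm ((1 / a) *\<^sub>R c y ?r - a *\<^sub>R s y) \<le> norm ((1 / a) *\<^sub>R c y ?r) + norm (a *\<^sub>R s y)" by (rule norm_triangle_ineq4)
      also have "norm ((1 / a) *\<^sub>R c y ?r) \<le> B / a * (1 + norm y)"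
      proof -
        have "norm ((1 / a) *\<^sub>R c y ?r) \<le> B / a * 1" using c_bd[OF r, of y] a by (simp add: divide_right_mono)
        also have "\<dots> \<le> B / a * (1 + norm y)" using a B_nonneg by (intro mult_left_mono) auto
        finally show ?thesis .
      qed
      also have "norm (a *\<^sub>R s y) \<le> a * ((1 + norm x) / w) * (1 + norm y)"
        using mult_left_mono[OF sb[of y], of a] a by (simp add: mult.assoc)
      finally show ?thesis by (simp add: distrib_right)
    qed
    from growth[OF _ this] show ?thesis by simp
  qed
  have "(1/2) * a\<^sup>2 * (\<integral>y. gauss_dens x w y * (norm (s y))\<^sup>2 \<partial>lborel)
      - (1/2) * (\<integral>y. gauss_dens x w y * (norm ((1 / a) *\<^sub>R c y ?r - a *\<^sub>R s y))\<^sup>2 \<partial>lborel)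
      = (\<integral>y. (1/2) * a\<^sup>2 * (gauss_dens x w y * (norm (s y))\<^sup>2) - (1/2) * (gauss_dens x w y * (norm ((1 / a) *\<^sub>R c y ?r - a *\<^sub>R s y))\<^sup>2) \<partial>lborel)"
    using i1 i2 by simp
  also have "\<dots> = (\<integral>y. gauss_dens x w y * (- c y ?r \<bullet> (y - x) / w - (norm (c y ?r))\<^sup>2 / (2 * a\<^sup>2)) \<partial>lborel)"
  proof (intro Bochner_Integration.integral_cong refl)
    fix y
    have "(norm ((1 / a) *\<^sub>R c y ?r - a *\<^sub>R s y))\<^sup>2 = (norm (c y ?r))\<^sup>2 / a\<^sup>2 - 2 * (c y ?r \<bullet> s y) + a\<^sup>2 * (norm (s y))\<^sup>2"
    proof -
      have "(norm (p - p'))\<^sup>2 = (norm p)\<^sup>2 - 2 * (p \<bullet> p') + (norm p')\<^sup>2" for p p' :: "real^'k"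
        by (simp add: power2_norm_eq_inner inner_diff_left inner_diff_right inner_commute)
      then show ?thesis using a by (simp add: power_divide power_mult_distrib)
    qed
    moreover have "c y ?r \<bullet> s y = - c y ?r \<bullet> (y - x) / w" by (simp add: s)
    ultimately have "(1/2) * a\<^sup>2 * (norm (s y))\<^sup>2 - (1/2) * (norm ((1 / a) *\<^sub>R c y ?r - a *\<^sub>R s y))\<^sup>2 =
        - c y ?r \<bullet> (y - x) / w - (norm (c y ?r))\<^sup>2 / (2 * a\<^sup>2)" by (simp add: field_simps)
    then show "(1/2) * a\<^sup>2 * (gauss_dens x w y * (norm (s y))\<^sup>2) - (1/2) * (gauss_dens x w y * (norm ((1 / a) *\<^sub>R c y ?r - a *\<^sub>R s y))\<^sup>2) =
        gauss_dens x w y * (- c y ?r \<bullet> (y - x) / w - (norm (c y ?r))\<^sup>2 / (2 * a\<^sup>2))"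
      by (metis (no_types, opaque_lifting) mult.assoc mult.left_commute right_diff_distrib)
  qed
  finally show ?thesis
    by (simp add: rate_def girsanov_rate_def w_def[symmetric] a_def mult.commute)
qed

end

theorem mainTheorem7:
  fixes T :: real
    and f s :: "real^'k \<Rightarrow> real \<Rightarrow> real^'k"
    and d :: "real^'k \<Rightarrow> real \<Rightarrow> real"
    and beta g lam :: "real \<Rightarrow> real"
    and M :: "'a measure"
    and W N X :: "real \<Rightarrow> 'a \<Rightarrow> real^'k"
    and q :: "real \<Rightarrow> real^'k \<Rightarrow> real"
    and x :: "real^'k"
  assumes T_pos: "T > 0"
    and nonneg: "\<forall>t\<in>{0..T}. beta t \<ge> 0 \<and> g t \<ge> 0 \<and> lam t \<ge> 0"
    and sigma_pos: "\<forall>t\<in>{0..T}. sigma_of g lam t > 0"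
    and sigma_cont: "continuous_on {0..T} (sigma_of g lam)"
    and d_diff: "\<forall>t\<in>{0..T}. \<forall>y. (\<lambda>z. d z t) differentiable (at y)"
    and c_cont: "continuous_on (UNIV \<times> {0..T}) (\<lambda>(y,t). drift f beta g s d y t)"
    and c_smooth: "\<forall>t\<in>{0..T}. smooth_fun (\<lambda>y. drift f beta g s d y t)"
    and c_bounded: "\<forall>es. \<exists>B. \<forall>t\<in>{0..T}. \<forall>y.
                      norm (iter_pd es (\<lambda>z. drift f beta g s d z t) y) \<le> B"
    and BM: "brownian_motion M W"
    and noise: "wiener_integral M W (sigma_of g lam) T N"
    and init_indep: "indep_of_bm M (X 0) W"
    and SDE: "AE \<omega> in M. \<forall>t\<in>{0..T}.
                X t \<omega> = X 0 \<omega> + integral {0..t} (\<lambda>r. drift f beta g s d (X r \<omega>) r) + N t \<omega>"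
    and marginals: "\<forall>t\<in>{0..T}. distributed M lborel (X t) (\<lambda>y. ennreal (q t y))"
    and q0_pos: "\<forall>y. q 0 y > 0"
    and q0_smooth: "smooth_fun (q 0)"
    and q_C12: "C12_on T q"
    and q_poly: "\<exists>C m. \<forall>t\<in>{0..T}. \<forall>y. \<bar>q t y\<bar> \<le> C * (1 + norm y ^ m)"
    and log_q0_int: "integrable lborel
        (\<lambda>y. ln (q 0 y) * gauss_dens x (integral {0..T} (\<lambda>r. (sigma_of g lam (T - r))\<^sup>2)) y)"
  shows
    "let \<sigma> = sigma_of g lam;
         c = drift f beta g s d;
         v = (\<lambda>u. integral {0..u} (\<lambda>r. (\<sigma> (T - r))\<^sup>2));
         p = (\<lambda>u y. gauss_dens x (v u) y);
         E = (\<lambda>u h. \<integral>y. h y * p u y \<partial>lborel);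
         glp = (\<lambda>u. grad (\<lambda>z. ln (p u z)))
     in ln (q T x) \<ge>
          E T (\<lambda>y. ln (q 0 y))
        + (LBINT u=0..T.
             (1/2) * (\<sigma> (T - u))\<^sup>2 * E u (\<lambda>y. (norm (glp u y))\<^sup>2)
           - (1/2) * E u (\<lambda>y. (norm ((1 / \<sigma> (T - u)) *\<^sub>R c y (T - u)
                                      - \<sigma> (T - u) *\<^sub>R glp u y))\<^sup>2))"
proof -
  define \<sigma> where "\<sigma> = sigma_of g lam"
  define c where "c = drift f beta g s d"
  obtain B where B: "\<And>y t. t \<in> {0..T} \<Longrightarrow> norm (c y t) \<le> B"
    using c_bounded[rule_format, of "[]"] unfolding c_def iter_pd.simps by blast
  obtain L where L: "L \<ge> 0" "\<And>y y' t. t \<in> {0..T} \<Longrightarrow> norm (c y t - c y' t) \<le> L * norm (y - y')"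
    using smooth_bounded_lipschitz[OF c_smooth c_bounded] unfolding c_def by blast
  obtain s0 where s0: "s0 > 0" "\<And>t. t \<in> {0..T} \<Longrightarrow> \<sigma> t \<ge> s0"
  proof -
    \<comment> \<open>Compactness turns pointwise positivity of \<open>\<sigma>\<close> into a
      uniform lower bound, attained at \<open>t0\<close>.\<close>
    have "\<exists>t0\<in>{0..T}. \<forall>t\<in>{0..T}. \<sigma> t0 \<le> \<sigma> t"
      unfolding \<sigma>_def using T_pos by (intro continuous_attains_inf sigma_cont) auto
    then show ?thesis using that sigma_pos unfolding \<sigma>_def by blast
  qed
  interpret bounded_drift T c \<sigma> B L s0
    by unfold_locales (use T_pos c_cont B L s0 sigma_cont in \<open>auto simp: c_def \<sigma>_def\<close>)
  define v where "v = (\<lambda>u. integral {0..u} (\<lambda>r. (\<sigma> (T - r))\<^sup>2))"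
  have v: "v u = V T - V (T - u)" if "u \<in> {0..T}" for u
    unfolding v_def by (rule reverse_variance[OF that])
  have vT: "v T = V T" using v[of T] T by (simp add: V_def)
  have qc: "continuous_on ({0..T} \<times> UNIV) (\<lambda>(t, y). q t y)" using q_C12 by (simp add: C12_on_def)
  obtain C m where qp: "\<And>t y. t \<in> {0..T} \<Longrightarrow> \<bar>q t y\<bar> \<le> C * (1 + norm y ^ m)" using q_poly by blast
  have lnq0: "integrable lborel (\<lambda>y. ln (q 0 y) * gauss_dens x (V T) y)"
    using log_q0_int unfolding \<sigma>_def[symmetric] vT[symmetric] v_def .
  have "(\<integral>y. ln (q 0 y) * gauss_dens x (V T) y \<partial>lborel) + integral {0..T} (\<lambda>u. rate x (T - u)) \<le> ln (q T x)"
    using SDE noise marginals q0_pos unfolding c_def[symmetric] \<sigma>_def[symmetric]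
    by (intro density_lower_bound[where M=M and W=W and N=N and X=X and C=C and m=m] BM init_indep qc qp lnq0) auto
  also have "integral {0..T} (\<lambda>u. rate x (T - u)) = (LBINT u=0..T. rate x (T - u))"
    by (rule rate_interval_integral[symmetric])
  also have "\<dots> = (LBINT u=0..T.
      (1/2) * (\<sigma> (T - u))\<^sup>2 * (\<integral>y. (norm (grad (\<lambda>z. ln (gauss_dens x (v u) z)) y))\<^sup>2 * gauss_dens x (v u) y \<partial>lborel)
      - (1/2) * (\<integral>y. (norm ((1 / \<sigma> (T - u)) *\<^sub>R c y (T - u)
          - \<sigma> (T - u) *\<^sub>R grad (\<lambda>z. ln (gauss_dens x (v u) z)) y))\<^sup>2 * gauss_dens x (v u) y \<partial>lborel))"
  \<comment> \<open>Interval integrals compare integrands on the open interval only, so the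
    degenerate Gaussian at \<open>u = 0\<close>, where \<open>v u = 0\<close>, does not
    arise.\<close>
  proof (rule interval_integral_cong)
    fix u assume "u \<in> einterval (min 0 (ereal T)) (max 0 (ereal T))"
    then have u: "u \<in> {0<..<T}" using T by (simp add: zero_ereal_def)
    then have vu: "v u = V T - V (T - u)" by (intro v) auto
    show "rate x (T - u) =
      (1/2) * (\<sigma> (T - u))\<^sup>2 * (\<integral>y. (norm (grad (\<lambda>z. ln (gauss_dens x (v u) z)) y))\<^sup>2 * gauss_dens x (v u) y \<partial>lborel)
      - (1/2) * (\<integral>y. (norm ((1 / \<sigma> (T - u)) *\<^sub>R c y (T - u)
          - \<sigma> (T - u) *\<^sub>R grad (\<lambda>z. ln (gauss_dens x (v u) z)) y))\<^sup>2 * gauss_dens x (v u) y \<partial>lborel)"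
      unfolding vu by (rule rate_eq_score_form[OF u, symmetric])
  qed
  finally show ?thesis
    unfolding vT[symmetric] v_def Let_def \<sigma>_def[symmetric] c_def[symmetric] .
qed

end
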